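(* Consider the two-user network described in the context. There exist $\alpha_1\in[0,\tfrac12)$ and $\alpha_2\in(\tfrac12,1]$ such that for any nonzero $h_{1,1},h_{2,1}\in\mathbb{C}$ the following holds for all sufficiently large $\gamma$: letting $$\hat\varepsilon=\hat\varepsilon(\gamma)=\arg\max_{\varepsilon\in(0,1]}\mathrm{E}\left\{\varepsilon\log\left(1+\frac{2^{-\mathscr{H}(\varepsilon)}|\boldsymbol{h}_{1,1}|^{2}\gamma}{\varepsilon\left(1+\frac{|\boldsymbol{h}_{2,1}|^{2}\gamma}{\varepsilon}\right)^{\varepsilon}}\right)\right\},$$ where the expectation is over independent $\mathcal{CN}(0,1)$ random variables $\boldsymbol{h}_{1,1},\boldsymbol{h}_{2,1}$, one has $\hat\varepsilon\in(\alpha_1,\alpha_2)$, and user 1 can achieve, by transmission of Gaussian signals with spreading and masking, a rate strictly larger than the masking capacity $\mathscr{MC}_1(\hat\varepsilon;\gamma,h_{1,1},h_{2,1})$.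
   Context: All logarithms are base 2; $\mathscr{H}(x)=-x\log x-(1-x)\log(1-x)$ is the binary entropy function; $\mathrm{I}(\cdot;\cdot)$ is mutual information; $\mathrm{Ber}(\varepsilon)$ is the law on $\{0,1\}$ giving mass $\varepsilon$ to $1$; $\mathcal{CN}(0,C)$ is the circularly symmetric complex Gaussian law with covariance $C$. **Masking capacity.** For $\varepsilon\in(0,1]$, $\gamma>0$ and gains $h_{1,1},h_{2,1}\in\mathbb{C}$, $$\mathscr{MC}_1(\varepsilon;\gamma,h_{1,1},h_{2,1})=\sup_{\substack{\boldsymbol{x}_1,\boldsymbol{x}_2\ \text{i.i.d.}\\ \mathrm{E}\{|\boldsymbol{x}_1|^2\}\le\gamma}}\mathrm{I}(\boldsymbol{x}_1,\boldsymbol{m}_1;\boldsymbol{y}_1),\qquad \boldsymbol{y}_1=\varepsilon^{-1/2}h_{1,1}\boldsymbol{m}_1\boldsymbol{x}_1+\varepsilon^{-1/2}h_{2,1}\boldsymbol{m}_2\boldsymbol{x}_2+\boldsymbol{z}_1,$$ where $\boldsymbol{x}_1,\boldsymbol{x}_2$ are complex random variables, $\boldsymbol{m}_1,\boldsymbol{m}_2\sim\mathrm{Ber}(\varepsilon)$, $\boldsymbol{z}_1\sim\mathcal{CN}(0,1)$, and $\boldsymbol{x}_1,\boldsymbol{x}_2,\boldsymbol{m}_1,\boldsymbol{m}_2,\boldsymbol{z}_1$ are independent. **Gaussian signaling with spreading and masking.** Choose an integer $K\ge1$, a finite alphabet $\mathscr{A}\subset\mathbb{Z}\setminus\{0\}$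 with $\mathscr{A}=-\mathscr{A}$, a probability mass function $(\mathsf{p}_a)_{a\in\mathscr{A}}$ and a masking probability $\varepsilon'\in(0,1]$. The signature codes $\vec{\boldsymbol{s}}_1,\vec{\boldsymbol{s}}_2$ are i.i.d. $K\times1$ random vectors, each being the element-wise product of a vector with i.i.d. entries of law $(\mathsf{p}_a)$ and an independent vector with i.i.d. $\mathrm{Ber}(\varepsilon')$ entries. Let $\boldsymbol{x}_1,\boldsymbol{x}_2\sim\mathcal{CN}(0,\gamma)$ and $\vec{\boldsymbol{z}}_1\sim\mathcal{CN}(0,I_K)$, all independent and independent of the codes, let $\beta>0$ satisfy $\beta^2\mathrm{E}\{\|\vec{\boldsymbol{s}}_1\|_2^2\}=1$, and let $$\vec{\boldsymbol{y}}_1=\beta h_{1,1}\boldsymbol{x}_1\vec{\boldsymbol{s}}_1+\beta h_{2,1}\boldsymbol{x}_2\vec{\boldsymbol{s}}_2+\vec{\boldsymbol{z}}_1 .$$ User 1 can achieve a rate $R$ by transmission of Gaussian signals with spreading and masking if $R\le\frac1K\mathrm{I}(\boldsymbol{x}_1,\vec{\boldsymbol{s}}_1;\vec{\boldsymbol{y}}_1)$ for some choice of $K,\mathscr{A},(\mathsf{p}_a),\varepsilon'$. *)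

theory Defs
  imports "HOL-Probability.Probability"
begin

definition binary_entropy :: "real \<Rightarrow> real" where
  "binary_entropy x = - x * log 2 x - (1 - x) * log 2 (1 - x)"

text \<open>
  The law \<open>CN(0, c)\<close> on the complex plane, for \<open>c > 0\<close>; \<open>c\<close> is the total variance
  \<open>E |z|\<^sup>2\<close>, so that the real and imaginary parts have variance \<open>c / 2\<close> each.
\<close>

definition complex_gaussian :: "real \<Rightarrow> complex measure" where
  "complex_gaussian c = density lborel (\<lambda>z. ennreal (exp (- (cmod z)\<^sup>2 / c) / (pi * c)))"


section \<open>Masking capacity\<close>

text \<open>
  Random variables are modelled canonically, as the coordinates of a product space: a point of
  \<open>masking_space \<epsilon> P\<close> is \<open>(x1, x2, m1, m2, z1)\<close>, where \<open>P\<close> is the common law of \<open>x1\<close> and \<open>x2\<close>.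
  The masks are Boolean and enter the channel through \<^const>\<open>of_bool\<close>.
\<close>

definition masking_space ::
    "real \<Rightarrow> complex measure \<Rightarrow> (complex \<times> complex \<times> bool \<times> bool \<times> complex) measure" where
  "masking_space \<epsilon> P =
     P \<Otimes>\<^sub>M P \<Otimes>\<^sub>M measure_pmf (bernoulli_pmf \<epsilon>) \<Otimes>\<^sub>M measure_pmf (bernoulli_pmf \<epsilon>) \<Otimes>\<^sub>M complex_gaussian 1"

definition masking_output ::
    "real \<Rightarrow> complex \<Rightarrow> complex \<Rightarrow> complex \<times> complex \<times> bool \<times> bool \<times> complex \<Rightarrow> complex" where
  "masking_output \<epsilon> h11 h21 = (\<lambda>(x1, x2, m1, m2, z1).
     of_real (\<epsilon> powr (- 1 / 2)) * h11 * of_bool m1 * x1 +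
     of_real (\<epsilon> powr (- 1 / 2)) * h21 * of_bool m2 * x2 + z1)"

text \<open>
  The Gaussian noise and the power constraint make the joint law of input and output absolutely
  continuous with respect to the product of its marginals, with integrable information density,
  so the Bochner integral in the library's mutual information (in bits, as the base is 2) never
  takes its default value here.
\<close>

definition masking_information :: "real \<Rightarrow> complex \<Rightarrow> complex \<Rightarrow> complex measure \<Rightarrow> real" where
  "masking_information \<epsilon> h11 h21 P =
     prob_space.mutual_information (masking_space \<epsilon> P) 2
       (borel \<Otimes>\<^sub>M count_space UNIV) borel
       (\<lambda>(x1, x2, m1, m2, z1). (x1, m1)) (masking_output \<epsilon> h11 h21)"

text \<open>
  The second moment is a Lebesgue integral in \<^typ>\<open>ennreal\<close>, so that the constraint excludes laws
  of infinite power. The supremum is taken in \<^typ>\<open>ereal\<close>, where it exists without side conditions.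
\<close>

definition power_constrained_laws :: "real \<Rightarrow> complex measure set" where
  "power_constrained_laws \<gamma> =
     {P. prob_space P \<and> sets P = sets borel \<and> (\<integral>\<^sup>+ x. ennreal ((cmod x)\<^sup>2) \<partial>P) \<le> ennreal \<gamma>}"

definition masking_capacity :: "real \<Rightarrow> real \<Rightarrow> complex \<Rightarrow> complex \<Rightarrow> ereal" where
  "masking_capacity \<epsilon> \<gamma> h11 h21 =
     (SUP P \<in> power_constrained_laws \<gamma>. ereal (masking_information \<epsilon> h11 h21 P))"


section \<open>Gaussian signaling with spreading and masking\<close>

text \<open>
  Signature codes of length \<open>K\<close> are functions on \<^typ>\<open>nat\<close> that vanish outside \<open>{..<K}\<close>.
\<close>

definition signature_pmf :: "nat \<Rightarrow> int pmf \<Rightarrow> real \<Rightarrow> (nat \<Rightarrow> int) pmf" where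
  "signature_pmf K p \<epsilon>' =
     map_pmf (\<lambda>(a, m). \<lambda>i. a i * of_bool (m i))
       (pair_pmf (Pi_pmf {..<K} 0 (\<lambda>_. p)) (Pi_pmf {..<K} False (\<lambda>_. bernoulli_pmf \<epsilon>')))"

text \<open>
  A point of \<open>spreading_space\<close> is \<open>(x1, x2, s1, s2, z1)\<close>; \<open>CN(0, I)\<close> in dimension \<open>K\<close> is the
  \<open>K\<close>-fold product of \<open>CN(0, 1)\<close>.
\<close>

definition spreading_space ::
    "real \<Rightarrow> nat \<Rightarrow> int pmf \<Rightarrow> real \<Rightarrow>
     (complex \<times> complex \<times> (nat \<Rightarrow> int) \<times> (nat \<Rightarrow> int) \<times> (nat \<Rightarrow> complex)) measure" where
  "spreading_space \<gamma> K p \<epsilon>' =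
     complex_gaussian \<gamma> \<Otimes>\<^sub>M complex_gaussian \<gamma> \<Otimes>\<^sub>M
     measure_pmf (signature_pmf K p \<epsilon>') \<Otimes>\<^sub>M measure_pmf (signature_pmf K p \<epsilon>') \<Otimes>\<^sub>M
     PiM {..<K} (\<lambda>_. complex_gaussian 1)"

definition spreading_output ::
    "nat \<Rightarrow> real \<Rightarrow> complex \<Rightarrow> complex \<Rightarrow>
     complex \<times> complex \<times> (nat \<Rightarrow> int) \<times> (nat \<Rightarrow> int) \<times> (nat \<Rightarrow> complex) \<Rightarrow> nat \<Rightarrow> complex" where
  "spreading_output K \<beta> h11 h21 = (\<lambda>(x1, x2, s1, s2, z1). \<lambda>i\<in>{..<K}.
     of_real \<beta> * h11 * x1 * of_int (s1 i) + of_real \<beta> * h21 * x2 * of_int (s2 i) + z1 i)"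

definition spreading_information ::
    "real \<Rightarrow> complex \<Rightarrow> complex \<Rightarrow> nat \<Rightarrow> int pmf \<Rightarrow> real \<Rightarrow> real \<Rightarrow> real" where
  "spreading_information \<gamma> h11 h21 K p \<epsilon>' \<beta> =
     prob_space.mutual_information (spreading_space \<gamma> K p \<epsilon>') 2
       (borel \<Otimes>\<^sub>M count_space UNIV) (PiM {..<K} (\<lambda>_. borel))
       (\<lambda>(x1, x2, s1, s2, z1). (x1, s1)) (spreading_output K \<beta> h11 h21)"

definition achievable_by_spreading_and_masking ::
    "real \<Rightarrow> complex \<Rightarrow> complex \<Rightarrow> real \<Rightarrow> bool" where
  "achievable_by_spreading_and_masking \<gamma> h11 h21 R \<longleftrightarrow>
     (\<exists>(K::nat) (A::int set) (p::int pmf) (\<epsilon>'::real) (\<beta>::real).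
        1 \<le> K \<and>
        finite A \<and> 0 \<notin> A \<and> uminus ` A = A \<and> set_pmf p \<subseteq> A \<and>
        \<epsilon>' \<in> {0<..1} \<and>
        \<beta> > 0 \<and>
        \<beta>\<^sup>2 * measure_pmf.expectation (signature_pmf K p \<epsilon>') (\<lambda>s. \<Sum>i<K. (real_of_int (s i))\<^sup>2) = 1 \<and>
        R \<le> spreading_information \<gamma> h11 h21 K p \<epsilon>' \<beta> / real K)"


section \<open>The choice of the masking probability\<close>

definition masking_objective :: "real \<Rightarrow> real \<Rightarrow> real" where
  "masking_objective \<gamma> \<epsilon> =
     (\<integral>(h11, h21).
        \<epsilon> * log 2 (1 + 2 powr (- binary_entropy \<epsilon>) * (cmod h11)\<^sup>2 * \<gamma> /
                        (\<epsilon> * (1 + (cmod h21)\<^sup>2 * \<gamma> / \<epsilon>) powr \<epsilon>))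
      \<partial>(complex_gaussian 1 \<Otimes>\<^sub>M complex_gaussian 1))"

definition is_optimal_masking :: "real \<Rightarrow> real \<Rightarrow> bool" where
  "is_optimal_masking \<gamma> \<epsilon> \<longleftrightarrow> is_arg_max (masking_objective \<gamma>) (\<lambda>\<epsilon>. \<epsilon> \<in> {0<..1}) \<epsilon>"

end

(*
Compare the coefficients of log gamma. Let u_c be the law of c x + z, H the differential entropy and
a, b the two scaled gains. Conditioning on the masks costs O(1) bits and gives
  MC <= e (1 - e) H(u_a) + e^2 (H(a x1 + b x2 + z) - H(u_b)) + O(1).
Since x1 and x2 have the same law, H(u_a) and H(u_b) differ by O(1): given both observations, a linear
combination of them is pure noise. With 0 <= H(u_b) <= log gamma + O(1) and
H(a x1 + b x2 + z) <= log gamma + O(1) this yields MC <= max(e (1 - e), e^2) log gamma + O(1).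
Up to O(1) and small multiples of log gamma, the objective at e is e (1 - e) log gamma, so that its
maximiser stays in (1/8, 3/5), where max(e (1 - e), e^2) <= 9/25.

For spreading take K = 2, no masking and uniform letters in {-2, -1, 1, 2}. Then the information is
E rank(s1, s2) log gamma - log gamma + O(1), and two independent code words are parallel with
probability 3/16, so that the rate is at least (13/32) log gamma - O(1); and 9/25 < 13/32.
*)

theory Submission
  imports Defs "HOL-Real_Asymp.Real_Asymp"
begin

section \<open>Complex Gaussian laws\<close>

text \<open>The obstacle on the masking side is that the input law is arbitrary, so none of its
  entropies can be computed; every bound has to be uniform in the law and in the masking
  probability. All entropy comparisons rest on ln t <= t - 1, applied to a quotient of densities
  with mean 1. This needs integrable logarithms, which a quadratic domination provides. Masks and
  code words are two instances of one channel with discrete marks. For a fixed pair of marks the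
  densities are explicit enough, and averaging over the marks costs no more than their entropy,
  which does not grow with \<gamma>. The constant 3/5 has slack: it must exceed 1/2, so that e (1 -
  e) stays away from 1/4 beyond it, and its square must be below 13/32. Letters of modulus 2 matter:
  with uniform letters 1 and -1 and no masking, two words of length 2 are parallel with probability
  1/2, and the rate is only (1/4) log gamma + O(1). In the objective a fading gain near zero spoils
  the asymptotics, so these events are split off; their probability is small against the difference
  between 1/4 and 6/25, the values of e (1 - e) at 1/2 and 3/5.\<close>

abbreviation CN :: "real \<Rightarrow> complex measure" where "CN \<equiv> complex_gaussian"

abbreviation sq :: "complex \<Rightarrow> real" where "sq z \<equiv> (cmod z)\<^sup>2"

section \<open>Elementary inequalities and Gaussian integrals\<close>

lemma cmod_add_square_le: "sq (x + y) \<le> 2 * sq x + 2 * sq y"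
proof -
  have "sq (x + y) \<le> (cmod x + cmod y)\<^sup>2"
    by (intro power_mono norm_triangle_ineq) simp
  also have "\<dots> \<le> 2 * sq x + 2 * sq y"
    using sum_squares_bound[of "cmod x" "cmod y"] by (simp add: power2_sum)
  finally show ?thesis .
qed

lemma cmod_diff_square_le: "sq (x - y) \<le> 2 * sq x + 2 * sq y"
  using cmod_add_square_le[of x "- y"] by simp

lemma cmod_add3_square_le: "sq (x + y + z) \<le> 3 * sq x + 3 * sq y + 3 * sq z"
proof -
  have "sq (x + y + z) \<le> (cmod x + cmod y + cmod z)\<^sup>2"
    by (intro power_mono order_trans[OF norm_triangle_ineq] add_right_mono norm_triangle_ineq) simp
  also have "\<dots> \<le> 3 * sq x + 3 * sq y + 3 * sq z"
    using sum_squares_bound[of "cmod x" "cmod y"] sum_squares_bound[of "cmod x" "cmod z"]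
      sum_squares_bound[of "cmod y" "cmod z"]
    by (simp add: power2_eq_square algebra_simps)
  finally show ?thesis .
qed

lemma nn_integral_exp_neg_square:
  fixes c m :: real
  assumes "0 < c"
  shows "(\<integral>\<^sup>+ x. ennreal (exp (- c * (x - m)\<^sup>2)) \<partial>lborel) = ennreal (sqrt (pi / c))"
proof -
  define \<sigma> where "\<sigma> = sqrt (1 / (2 * c))"
  have s: "\<sigma>\<^sup>2 = 1 / (2 * c)" "0 < \<sigma>" using assms by (auto simp: \<sigma>_def)
  have *: "exp (- c * (x - m)\<^sup>2) = sqrt (pi / c) * normal_density m \<sigma> x" for x
    using assms by (simp add: normal_density_def s divide_simps real_sqrt_divide mult.commute)
  have "(\<integral>\<^sup>+ x. ennreal (normal_density m \<sigma> x) \<partial>lborel) = 1"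
    using s by (simp add: nn_integral_eq_integral)
  then show ?thesis
    using assms unfolding * by (simp add: ennreal_mult nn_integral_cmult)
qed

text \<open>The squared modulus is the sum over the two real coordinates, so the integral factors
  into two real Gaussian integrals.\<close>

lemma nn_integral_exp_neg_cmod_square:
  fixes w :: complex and c :: real
  assumes "0 < c"
  shows "(\<integral>\<^sup>+ z. ennreal (exp (- c * sq (z - w))) \<partial>lborel) = ennreal (pi / c)"
proof -
  have "exp (- c * sq (z - w)) = (\<Prod>b\<in>Basis. exp (- c * (z \<bullet> b - w \<bullet> b)\<^sup>2))" for z
    by (simp add: Basis_complex_def cmod_power2 exp_add [symmetric] algebra_simps)
  then have "(\<integral>\<^sup>+ z. ennreal (exp (- c * sq (z - w))) \<partial>lborel) =
      (\<integral>\<^sup>+ z. (\<Prod>b\<in>Basis. ennreal (exp (- c * (z \<bullet> b - w \<bullet> b)\<^sup>2))) \<partial>lborel)"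
    by (simp add: prod_ennreal)
  also have "\<dots> = (\<Prod>b\<in>(Basis :: complex set). ennreal (sqrt (pi / c)))"
    using nn_integral_exp_neg_square[OF assms]
    by (subst nn_integral_lborel_prod) (auto intro!: prod.cong)
  also have "\<dots> = ennreal (pi / c)"
    using assms by (simp add: ennreal_power)
  finally show ?thesis .
qed

lemma nn_integral_lborel_translate:
  fixes F :: "'a::euclidean_space \<Rightarrow> ennreal"
  assumes [measurable]: "F \<in> borel_measurable borel"
  shows "(\<integral>\<^sup>+ z. F (w + z) \<partial>lborel) = (\<integral>\<^sup>+ z. F z \<partial>lborel)"
  by (subst (2) lborel_distr_plus[of w, symmetric]) (simp add: nn_integral_distr)

definition gauss_density :: "real \<Rightarrow> complex \<Rightarrow> real" where
  "gauss_density c z = exp (- sq z / c) / (pi * c)"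

lemma gauss_density_measurable [measurable]: "gauss_density c \<in> borel_measurable borel"
  unfolding gauss_density_def by measurable

lemma gauss_density_pos: "0 < c \<Longrightarrow> 0 < gauss_density c z"
  by (simp add: gauss_density_def)

lemma gauss_density_le: "0 < c \<Longrightarrow> gauss_density c z \<le> 1 / (pi * c)"
  by (simp add: gauss_density_def divide_right_mono)

lemma ln_gauss_density: "0 < c \<Longrightarrow> ln (gauss_density c z) = - sq z / c - ln (pi * c)"
  by (simp add: gauss_density_def ln_div)

lemma gauss_density_integral:
  assumes "0 < c"
  shows "(\<integral>\<^sup>+ z. ennreal (gauss_density c (z - w)) \<partial>lborel) = 1"
proof -
  have *: "ennreal (gauss_density c (z - w)) = ennreal (1 / (pi * c)) * ennreal (exp (- (1 / c) * sq (z - w)))" for z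
    using assms by (simp add: gauss_density_def ennreal_mult[symmetric])
  then show ?thesis
    using assms nn_integral_exp_neg_cmod_square[of "1/c" w] unfolding *
    by (subst nn_integral_cmult) (simp_all add: ennreal_mult[symmetric] del: ennreal_1)
qed

lemma complex_gaussian_eq: "CN c = density lborel (\<lambda>z. ennreal (gauss_density c z))"
  by (simp add: complex_gaussian_def gauss_density_def)

lemma sets_complex_gaussian [measurable_cong]: "sets (CN c) = sets borel"
  and space_complex_gaussian [simp]: "space (CN c) = UNIV"
  by (simp_all add: complex_gaussian_def)

lemma prob_space_complex_gaussian: "0 < c \<Longrightarrow> prob_space (CN c)"
  using gauss_density_integral[of c 0]
  by (intro prob_spaceI) (simp add: complex_gaussian_eq emeasure_density)

lemma nn_integral_complex_gaussian:
  assumes [measurable]: "F \<in> borel_measurable borel"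
  shows "(\<integral>\<^sup>+ z. F z \<partial>CN c) = (\<integral>\<^sup>+ z. ennreal (gauss_density c z) * F z \<partial>lborel)"
  by (simp add: complex_gaussian_eq nn_integral_density)

lemma nn_integral_complex_gaussian_shift:
  assumes [measurable]: "F \<in> borel_measurable borel"
  shows "(\<integral>\<^sup>+ z. F (w + z) \<partial>CN c) = (\<integral>\<^sup>+ y. ennreal (gauss_density c (y - w)) * F y \<partial>lborel)"
  by (subst nn_integral_complex_gaussian, simp)
     (subst nn_integral_lborel_translate[of _ w, symmetric], auto)

text \<open>The exact value is \<open>c\<close>. The looser \<open>4 * c\<close> comes without polar
  coordinates: t <= exp t bounds |z|^2 times the density of variance \<open>c\<close> by
  \<open>4 * c\<close> times the density of variance \<open>2 * c\<close>, whose mass is 1.\<close>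

lemma complex_gaussian_second_moment:
  assumes "0 < c"
  shows "(\<integral>\<^sup>+ z. ennreal (sq z) \<partial>CN c) \<le> ennreal (4 * c)"
proof -
  have le: "gauss_density c z * sq z \<le> 4 * c * gauss_density (2 * c) z" for z
  proof -
    define t where "t = sq z / (2 * c)"
    have t: "sq z = 2 * c * t" "0 \<le> t" using assms by (auto simp: t_def)
    have "t \<le> exp t" using exp_ge_add_one_self[of t] by linarith
    then have "exp (- (2 * t)) * t \<le> exp (- (2 * t)) * exp t" by simp
    also have "\<dots> = exp (- t)" by (simp add: exp_add[symmetric])
    finally have "exp (- (2 * t)) * t \<le> exp (- t)" .
    then show ?thesis using assms unfolding gauss_density_def t(1)
      by (simp add: field_simps)
  qed
  have "(\<integral>\<^sup>+ z. ennreal (sq z) \<partial>CN c) =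
      (\<integral>\<^sup>+ z. ennreal (gauss_density c z * sq z) \<partial>lborel)"
    using assms by (subst nn_integral_complex_gaussian) (auto simp: ennreal_mult gauss_density_pos less_imp_le)
  also have "\<dots> \<le> (\<integral>\<^sup>+ z. ennreal (4 * c * gauss_density (2 * c) z) \<partial>lborel)"
    by (intro nn_integral_mono ennreal_leI le)
  also have "\<dots> = ennreal (4 * c) * (\<integral>\<^sup>+ z. ennreal (gauss_density (2 * c) z) \<partial>lborel)"
    using assms by (subst nn_integral_cmult[symmetric])
      (auto simp: ennreal_mult gauss_density_pos less_imp_le intro!: nn_integral_cong)
  also have "\<dots> = ennreal (4 * c)"
    using gauss_density_integral[of "2 * c" 0] assms by simp
  finally show ?thesis .
qed

section \<open>Mutual information of channels with discrete marks\<close>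

text \<open>Once some density of the joint law with respect to the product of the marginals is
  known, the divergence is the mean of its logarithm under the joint law. Every step is an identity
  of Bochner integrals that also holds for the default value, so integrability can be settled
  later.\<close>

lemma (in prob_space) mutual_information_density:
  fixes Dn :: "'b \<times> 'c \<Rightarrow> real"
  assumes b: "1 < b"
  assumes [measurable]: "X \<in> measurable M S" "Y \<in> measurable M T" "Dn \<in> borel_measurable (S \<Otimes>\<^sub>M T)"
  assumes nn: "\<And>x. 0 \<le> Dn x"
  assumes eq: "distr M (S \<Otimes>\<^sub>M T) (\<lambda>x. (X x, Y x)) =
    density (distr M S X \<Otimes>\<^sub>M distr M T Y) (\<lambda>x. ennreal (Dn x))"
  shows "mutual_information b S T X Y = (\<integral>x. log b (Dn (X x, Y x)) \<partial>M)"
proof -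
  interpret X: prob_space "distr M S X" by (rule prob_space_distr) fact
  interpret Y: prob_space "distr M T Y" by (rule prob_space_distr) fact
  interpret XY: pair_prob_space "distr M S X" "distr M T Y" ..
  have "mutual_information b S T X Y =
      (\<integral>x. Dn x * log b (Dn x) \<partial>(distr M S X \<Otimes>\<^sub>M distr M T Y))"
    unfolding mutual_information_def eq
    by (intro XY.KL_density b) (auto simp: nn)
  also have "\<dots> = (\<integral>x. log b (Dn x) \<partial>distr M (S \<Otimes>\<^sub>M T) (\<lambda>x. (X x, Y x)))"
    unfolding eq by (subst integral_density) (auto simp: nn)
  also have "\<dots> = (\<integral>x. log b (Dn (X x, Y x)) \<partial>M)"
    by (subst integral_distr) auto
  finally show ?thesis .
qed

text \<open>\<open>f\<close> is the density of the output given the input and \<open>g\<close> that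
  of the output alone, both with respect to \<open>L\<close>. The quotient f / g is then a density
  of the joint law with respect to the product of the marginals; \<open>g\<close> is positive on the
  whole space, so dividing by it loses no mass.\<close>

lemma (in prob_space) mutual_information_kernel:
  fixes f :: "'b \<Rightarrow> 'c \<Rightarrow> real" and g :: "'c \<Rightarrow> real"
  assumes b: "1 < b"
  assumes X[measurable]: "X \<in> measurable M S" and Y[measurable]: "Y \<in> measurable M T"
  assumes f[measurable]: "case_prod f \<in> borel_measurable (S \<Otimes>\<^sub>M T)" and f0: "\<And>x y. 0 \<le> f x y"
  assumes g[measurable]: "g \<in> borel_measurable T" and gnn: "\<And>y. 0 \<le> g y"
    and g0: "\<And>y. y \<in> space T \<Longrightarrow> 0 < g y"
  assumes L: "sigma_finite_measure L" "sets L = sets T"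
  assumes joint: "\<And>F. F \<in> borel_measurable (S \<Otimes>\<^sub>M T) \<Longrightarrow>
    (\<integral>\<^sup>+ w. F (X w, Y w) \<partial>M) = (\<integral>\<^sup>+ w. (\<integral>\<^sup>+ y. ennreal (f (X w) y) * F (X w, y) \<partial>L) \<partial>M)"
  assumes out: "\<And>F. F \<in> borel_measurable T \<Longrightarrow>
    (\<integral>\<^sup>+ w. F (Y w) \<partial>M) = (\<integral>\<^sup>+ y. ennreal (g y) * F y \<partial>L)"
  shows "mutual_information b S T X Y = (\<integral>w. log b (f (X w) (Y w) / g (Y w)) \<partial>M)"
proof -
  interpret L: sigma_finite_measure L by fact
  note [measurable_cong] = L(2)
  have "mutual_information b S T X Y = (\<integral>w. log b ((\<lambda>(x, y). f x y / g y) (X w, Y w)) \<partial>M)"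
  proof (rule mutual_information_density[OF b X Y])
    interpret X: prob_space "distr M S X" by (rule prob_space_distr) fact
    interpret Y: prob_space "distr M T Y" by (rule prob_space_distr) fact
    interpret XY: pair_prob_space "distr M S X" "distr M T Y" ..
    show "distr M (S \<Otimes>\<^sub>M T) (\<lambda>x. (X x, Y x)) =
      density (distr M S X \<Otimes>\<^sub>M distr M T Y) (\<lambda>x. ennreal ((\<lambda>(x, y). f x y / g y) x))"
    proof (rule measure_eqI)
      fix A assume "A \<in> sets (distr M (S \<Otimes>\<^sub>M T) (\<lambda>x. (X x, Y x)))"
      then have A[measurable]: "A \<in> sets (S \<Otimes>\<^sub>M T)" by simp
      have "emeasure (density (distr M S X \<Otimes>\<^sub>M distr M T Y) (\<lambda>x. ennreal ((\<lambda>(x, y). f x y / g y) x))) A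
          = (\<integral>\<^sup>+ x. \<integral>\<^sup>+ y. ennreal (f x y / g y) * indicator A (x, y) \<partial>distr M T Y \<partial>distr M S X)"
        by (subst emeasure_density) (auto simp: Y.nn_integral_fst[symmetric] split_beta')
      also have "\<dots> = (\<integral>\<^sup>+ w. \<integral>\<^sup>+ y. ennreal (f (X w) y / g y) * indicator A (X w, y) \<partial>distr M T Y \<partial>M)"
        by (subst nn_integral_distr) auto
      also have "\<dots> = (\<integral>\<^sup>+ w. (\<integral>\<^sup>+ y. ennreal (f (X w) y) * indicator A (X w, y) \<partial>L) \<partial>M)"
      proof (rule nn_integral_cong)
        fix w assume "w \<in> space M"
        then have [measurable]: "X w \<in> space S" using X by (rule measurable_space[rotated])
        have "(\<integral>\<^sup>+ y. ennreal (f (X w) y / g y) * indicator A (X w, y) \<partial>distr M T Y) =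
            (\<integral>\<^sup>+ w'. (\<lambda>y. ennreal (f (X w) y / g y) * indicator A (X w, y)) (Y w') \<partial>M)"
          by (subst nn_integral_distr) auto
        \<comment> \<open>The law of \<open>Y\<close> brings in the factor \<open>g\<close>, which
          cancels the denominator.\<close>
        also have "\<dots> = (\<integral>\<^sup>+ y. ennreal (g y) * (ennreal (f (X w) y / g y) * indicator A (X w, y)) \<partial>L)"
          by (rule out) measurable
        also have "\<dots> = (\<integral>\<^sup>+ y. ennreal (f (X w) y) * indicator A (X w, y) \<partial>L)"
          using g0 f0 gnn sets_eq_imp_space_eq[OF L(2)] by (intro nn_integral_cong)
            (auto simp: mult.assoc[symmetric] ennreal_mult[symmetric] less_imp_le less_imp_neq[THEN not_sym])
        finally show "(\<integral>\<^sup>+ y. ennreal (f (X w) y / g y) * indicator A (X w, y) \<partial>distr M T Y) =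
          (\<integral>\<^sup>+ y. ennreal (f (X w) y) * indicator A (X w, y) \<partial>L)" .
      qed
      also have "\<dots> = (\<integral>\<^sup>+ w. indicator A (X w, Y w) \<partial>M)"
        by (rule joint[symmetric]) measurable
      also have "\<dots> = emeasure (distr M (S \<Otimes>\<^sub>M T) (\<lambda>x. (X x, Y x))) A"
        by (subst nn_integral_distr[symmetric, of "\<lambda>w. (X w, Y w)" M "S \<Otimes>\<^sub>M T"]) auto
      finally show "emeasure (distr M (S \<Otimes>\<^sub>M T) (\<lambda>x. (X x, Y x))) A =
        emeasure (density (distr M S X \<Otimes>\<^sub>M distr M T Y) (\<lambda>x. ennreal ((\<lambda>(x, y). f x y / g y) x))) A" ..
    qed simp
  qed (auto simp: f0 gnn)
  then show ?thesis by simp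
qed

text \<open>
  The output \<open>out\<close> is a function of two inputs with law \<open>P\<close>, two discrete marks with law \<open>D\<close>
  (masks or signature codes) and noise with law \<open>N\<close>; \<open>k\<close> is its density with respect to \<open>L\<close>
  given everything but the noise.
\<close>

locale mixture_channel = P: prob_space P + N: prob_space N + L: sigma_finite_measure L
  for P :: "'a measure" and N :: "'y measure" and L :: "'y measure" +
  fixes D :: "'d pmf" and out :: "'a \<Rightarrow> 'a \<Rightarrow> 'd \<Rightarrow> 'd \<Rightarrow> 'y \<Rightarrow> 'y"
    and k :: "'a \<Rightarrow> 'a \<Rightarrow> 'd \<Rightarrow> 'd \<Rightarrow> 'y \<Rightarrow> real"
  assumes fin [simp]: "finite (set_pmf D)"
    and out_measurable [measurable]:
      "(\<lambda>(x1, x2, d1, d2, z). out x1 x2 d1 d2 z) \<in>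
        measurable (P \<Otimes>\<^sub>M P \<Otimes>\<^sub>M count_space UNIV \<Otimes>\<^sub>M count_space UNIV \<Otimes>\<^sub>M N) L"
    and k_measurable [measurable]:
      "(\<lambda>(x1, x2, d1, d2, y). k x1 x2 d1 d2 y) \<in>
        borel_measurable (P \<Otimes>\<^sub>M P \<Otimes>\<^sub>M count_space UNIV \<Otimes>\<^sub>M count_space UNIV \<Otimes>\<^sub>M L)"
    and k_pos: "0 < k x1 x2 d1 d2 y"
    and k_le: "k x1 x2 d1 d2 y \<le> 1"
    and kernel: "\<And>F x1 x2 d1 d2. F \<in> borel_measurable L \<Longrightarrow>
      (\<integral>\<^sup>+ z. F (out x1 x2 d1 d2 z) \<partial>N) = (\<integral>\<^sup>+ y. ennreal (k x1 x2 d1 d2 y) * F y \<partial>L)"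
begin

abbreviation full_space where
  "full_space \<equiv> P \<Otimes>\<^sub>M P \<Otimes>\<^sub>M measure_pmf D \<Otimes>\<^sub>M measure_pmf D \<Otimes>\<^sub>M N"

abbreviation base_space where
  "base_space \<equiv> P \<Otimes>\<^sub>M P \<Otimes>\<^sub>M N"

sublocale PL: pair_sigma_finite P L ..

abbreviation "weight d1 d2 \<equiv> ennreal (pmf D d1) * ennreal (pmf D d2)"

lemma prob_spaces:
  "prob_space P" "prob_space N" "prob_space (P \<Otimes>\<^sub>M N)" "prob_space (measure_pmf D \<Otimes>\<^sub>M N)"
  "prob_space (measure_pmf D \<Otimes>\<^sub>M measure_pmf D \<Otimes>\<^sub>M N)"
  "prob_space (P \<Otimes>\<^sub>M measure_pmf D \<Otimes>\<^sub>M measure_pmf D \<Otimes>\<^sub>M N)"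
  "prob_space full_space" "prob_space base_space"
  by (intro prob_space_pair P.prob_space_axioms N.prob_space_axioms measure_pmf.prob_space_axioms)+

lemmas nn_integral_pairs =
  prob_spaces[THEN prob_space_imp_sigma_finite, THEN sigma_finite_measure.nn_integral_fst, symmetric]

lemma out_measurable' [measurable (raw)]:
  assumes [measurable]: "a \<in> measurable M P" "b \<in> measurable M P" "c \<in> measurable M (count_space UNIV)"
    "d \<in> measurable M (count_space UNIV)" "e \<in> measurable M N"
  shows "(\<lambda>x. out (a x) (b x) (c x) (d x) (e x)) \<in> measurable M L"
  using measurable_compose[OF _ out_measurable, of "\<lambda>x. (a x, b x, c x, d x, e x)" M] by simp

lemma k_measurable' [measurable (raw)]:
  assumes [measurable]: "a \<in> measurable M P" "b \<in> measurable M P" "c \<in> measurable M (count_space UNIV)"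
    "d \<in> measurable M (count_space UNIV)" "e \<in> measurable M L"
  shows "(\<lambda>x. k (a x) (b x) (c x) (d x) (e x)) \<in> borel_measurable M"
  using measurable_compose[OF _ k_measurable, of "\<lambda>x. (a x, b x, c x, d x, e x)" M] by simp

section \<open>Tonelli and a finite sum over the marks\<close>

lemma nn_integral_base_space:
  assumes [measurable]: "case_prod (\<lambda>x1. case_prod (F x1)) \<in> borel_measurable base_space"
  shows "(\<integral>\<^sup>+ (x1, x2, z). F x1 x2 z \<partial>base_space) = (\<integral>\<^sup>+ x1. \<integral>\<^sup>+ x2. \<integral>\<^sup>+ z. F x1 x2 z \<partial>N \<partial>P \<partial>P)"
proof -
  define h where "h = (\<lambda>(x1, x2, z). F x1 x2 z)"
  have [measurable]: "h \<in> borel_measurable base_space" unfolding h_def by fact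
  have "integral\<^sup>N base_space h = (\<integral>\<^sup>+ x1. \<integral>\<^sup>+ x2. \<integral>\<^sup>+ z. h (x1, x2, z) \<partial>N \<partial>P \<partial>P)"
    by (simp add: nn_integral_pairs cong: nn_integral_cong)
  then show ?thesis by (simp add: h_def)
qed

text \<open>The support of \<open>D\<close> is finite, so the integrals over the marks become a
  weighted sum that can be moved outside. Afterwards everything is estimated on
  \<open>base_space\<close> for one fixed pair of marks.\<close>

lemma nn_integral_full_space:
  assumes [measurable]: "(\<lambda>(x1, x2, d1, d2, z). F x1 x2 d1 d2 z) \<in> borel_measurable full_space"
  shows "(\<integral>\<^sup>+ (x1, x2, d1, d2, z). F x1 x2 d1 d2 z \<partial>full_space) =
    (\<Sum>d1\<in>set_pmf D. \<Sum>d2\<in>set_pmf D. weight d1 d2 *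
      (\<integral>\<^sup>+ (x1, x2, z). F x1 x2 d1 d2 z \<partial>base_space))"
proof -
  have "(\<integral>\<^sup>+ (x1, x2, d1, d2, z). F x1 x2 d1 d2 z \<partial>full_space) =
    (\<integral>\<^sup>+ x1. \<integral>\<^sup>+ x2. \<integral>\<^sup>+ d1. \<integral>\<^sup>+ d2. \<integral>\<^sup>+ z. F x1 x2 d1 d2 z \<partial>N \<partial>D \<partial>D \<partial>P \<partial>P)"
  proof -
    define h where "h = (\<lambda>(x1, x2, d1, d2, z). F x1 x2 d1 d2 z)"
    have [measurable]: "h \<in> borel_measurable full_space" unfolding h_def by fact
    have "integral\<^sup>N full_space h =
        (\<integral>\<^sup>+ x1. \<integral>\<^sup>+ x2. \<integral>\<^sup>+ d1. \<integral>\<^sup>+ d2. \<integral>\<^sup>+ z. h (x1, x2, d1, d2, z) \<partial>N \<partial>D \<partial>D \<partial>P \<partial>P)"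
      by (simp add: nn_integral_pairs cong: nn_integral_cong)
    then show ?thesis by (simp add: h_def)
  qed
  also have "\<dots> = (\<Sum>d1\<in>set_pmf D. \<Sum>d2\<in>set_pmf D. weight d1 d2 *
      (\<integral>\<^sup>+ x1. \<integral>\<^sup>+ x2. \<integral>\<^sup>+ z. F x1 x2 d1 d2 z \<partial>N \<partial>P \<partial>P))"
  proof -
    define h where "h = (\<lambda>(x1, x2, d1, d2, z). F x1 x2 d1 d2 z)"
    have [measurable]: "h \<in> borel_measurable full_space" unfolding h_def by fact
    have "(\<integral>\<^sup>+ x1. \<integral>\<^sup>+ x2. \<integral>\<^sup>+ d1. \<integral>\<^sup>+ d2. \<integral>\<^sup>+ z. h (x1, x2, d1, d2, z) \<partial>N \<partial>D \<partial>D \<partial>P \<partial>P) =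
      (\<integral>\<^sup>+ x1. \<integral>\<^sup>+ x2. (\<Sum>d1\<in>set_pmf D. \<Sum>d2\<in>set_pmf D. weight d1 d2 *
        (\<integral>\<^sup>+ z. h (x1, x2, d1, d2, z) \<partial>N)) \<partial>P \<partial>P)"
      by (simp add: nn_integral_measure_pmf_finite sum_distrib_right sum_distrib_left mult_ac)
    also have "\<dots> = (\<Sum>d1\<in>set_pmf D. \<Sum>d2\<in>set_pmf D. weight d1 d2 *
      (\<integral>\<^sup>+ x1. \<integral>\<^sup>+ x2. \<integral>\<^sup>+ z. h (x1, x2, d1, d2, z) \<partial>N \<partial>P \<partial>P))"
      by (simp add: nn_integral_sum nn_integral_cmult cong: nn_integral_cong)
    finally show ?thesis by (simp add: h_def)
  qed
  also have "\<dots> = (\<Sum>d1\<in>set_pmf D. \<Sum>d2\<in>set_pmf D. weight d1 d2 *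
      (\<integral>\<^sup>+ (x1, x2, z). F x1 x2 d1 d2 z \<partial>base_space))"
  proof -
    define h where "h = (\<lambda>(x1, x2, d1, d2, z). F x1 x2 d1 d2 z)"
    have h [measurable]: "h \<in> borel_measurable full_space" unfolding h_def by fact
    have "(\<lambda>(x1, x2, z). h (x1, x2, d1, d2, z)) \<in> borel_measurable base_space" for d1 d2
      by measurable
    then have "(\<lambda>(x1, x2, z). F x1 x2 d1 d2 z) \<in> borel_measurable base_space" for d1 d2
      by (simp add: h_def)
    then show ?thesis
      by (simp add: nn_integral_base_space)
  qed
  finally show ?thesis .
qed

text \<open>Output densities under decreasing knowledge: \<open>h\<close> given the first input and
  both marks, \<open>f\<close> given the first input and its mark, \<open>g_cond\<close> given both
  marks only, and \<open>g\<close> given nothing. The information density is ln (f / g), while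
  \<open>h\<close> and \<open>g_cond\<close> are the ones that can be estimated.\<close>

definition h where
  "h x1 d1 d2 y = (\<integral>x2. k x1 x2 d1 d2 y \<partial>P)"

definition f where
  "f x1 d1 y = (\<Sum>d2\<in>set_pmf D. pmf D d2 * h x1 d1 d2 y)"

definition g_cond where
  "g_cond d1 d2 y = (\<integral>x1. h x1 d1 d2 y \<partial>P)"

definition g where
  "g y = (\<Sum>d1\<in>set_pmf D. \<Sum>d2\<in>set_pmf D. pmf D d1 * pmf D d2 * g_cond d1 d2 y)"

abbreviation "channel_input \<equiv> \<lambda>(x1 :: 'a, x2 :: 'a, d1 :: 'd, d2 :: 'd, z :: 'y). (x1, d1)"
abbreviation "channel_output \<equiv> \<lambda>(x1, x2, d1, d2, z). out x1 x2 d1 d2 z"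
abbreviation "mean_ln_h d1 d2 \<equiv> \<integral>(x1, x2, z). ln (h x1 d1 d2 (out x1 x2 d1 d2 z)) \<partial>base_space"
abbreviation "mean_ln_f d1 d2 \<equiv> \<integral>(x1, x2, z). ln (f x1 d1 (out x1 x2 d1 d2 z)) \<partial>base_space"
abbreviation "mean_ln_g_cond d1 d2 \<equiv> \<integral>(x1, x2, z). ln (g_cond d1 d2 (out x1 x2 d1 d2 z)) \<partial>base_space"
abbreviation "mean_ln_g d1 d2 \<equiv> \<integral>(x1, x2, z). ln (g (out x1 x2 d1 d2 z)) \<partial>base_space"

lemma h_measurable [measurable (raw)]:
  assumes [measurable]: "a \<in> measurable M P" "c \<in> measurable M (count_space UNIV)"
    "d \<in> measurable M (count_space UNIV)" "e \<in> measurable M L"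
  shows "(\<lambda>x. h (a x) (c x) (d x) (e x)) \<in> borel_measurable M"
  unfolding h_def by measurable

lemma f_measurable [measurable (raw)]:
  assumes [measurable]: "a \<in> measurable M P" "c \<in> measurable M (count_space UNIV)" "e \<in> measurable M L"
  shows "(\<lambda>x. f (a x) (c x) (e x)) \<in> borel_measurable M"
  unfolding f_def by measurable

lemma g_cond_measurable [measurable (raw)]:
  assumes [measurable]: "c \<in> measurable M (count_space UNIV)" "d \<in> measurable M (count_space UNIV)"
    "e \<in> measurable M L"
  shows "(\<lambda>x. g_cond (c x) (d x) (e x)) \<in> borel_measurable M"
  unfolding g_cond_def by measurable

lemma g_measurable [measurable]: "g \<in> borel_measurable L"
  unfolding g_def by measurable

lemma integrable_k:
  assumes [measurable]: "x1 \<in> space P" "y \<in> space L"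
  shows "integrable P (\<lambda>x2. k x1 x2 d1 d2 y)"
  by (intro P.integrable_const_bound[of _ 1]) (auto simp: k_pos less_imp_le k_le)

lemma h_nonneg: "0 \<le> h x1 d1 d2 y"
  unfolding h_def by (intro integral_nonneg_AE) (auto simp: k_pos less_imp_le)

lemma h_pos:
  assumes "x1 \<in> space P" "y \<in> space L"
  shows "0 < h x1 d1 d2 y"
  unfolding h_def by (intro P.expectation_greater integrable_k assms) (simp add: k_pos)

lemma h_le:
  assumes "x1 \<in> space P" "y \<in> space L"
  shows "h x1 d1 d2 y \<le> 1"
  unfolding h_def by (intro P.integral_le_const integrable_k assms) (simp add: k_le)

lemma ennreal_h:
  assumes "x1 \<in> space P" "y \<in> space L"
  shows "ennreal (h x1 d1 d2 y) = (\<integral>\<^sup>+ x2. ennreal (k x1 x2 d1 d2 y) \<partial>P)"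
  unfolding h_def by (intro nn_integral_eq_integral[symmetric] integrable_k assms)
    (auto simp: k_pos less_imp_le)

lemma integrable_h:
  assumes [measurable]: "y \<in> space L"
  shows "integrable P (\<lambda>x1. h x1 d1 d2 y)"
  by (intro P.integrable_const_bound[of _ 1]) (auto simp: h_nonneg h_le assms)

lemma g_cond_nonneg: "0 \<le> g_cond d1 d2 y"
  unfolding g_cond_def by (intro integral_nonneg_AE) (auto simp: h_nonneg)

lemma g_cond_pos:
  assumes "y \<in> space L"
  shows "0 < g_cond d1 d2 y"
  unfolding g_cond_def by (intro P.expectation_greater integrable_h assms) (simp add: h_pos assms)

lemma g_cond_le:
  assumes "y \<in> space L"
  shows "g_cond d1 d2 y \<le> 1"
  unfolding g_cond_def by (intro P.integral_le_const integrable_h assms) (simp add: h_le assms)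

lemma ennreal_g_cond:
  assumes "y \<in> space L"
  shows "ennreal (g_cond d1 d2 y) = (\<integral>\<^sup>+ x1. ennreal (h x1 d1 d2 y) \<partial>P)"
  unfolding g_cond_def by (intro nn_integral_eq_integral[symmetric] integrable_h assms)
    (auto simp: h_nonneg)

lemma sum_pmf_set [simp]: "(\<Sum>d\<in>set_pmf D. pmf D d) = 1"
  by (simp add: sum_pmf_eq_1)

lemma f_nonneg: "0 \<le> f x1 d1 y"
  unfolding f_def by (intro sum_nonneg mult_nonneg_nonneg h_nonneg) auto

text \<open>Keeping one term of the mixture: not knowing the second mark lowers the log-density by
  at most - ln (pmf D d2). \<open>g_ge\<close> does the same for both marks.\<close>

lemma f_ge: "d2 \<in> set_pmf D \<Longrightarrow> pmf D d2 * h x1 d1 d2 y \<le> f x1 d1 y"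
  unfolding f_def by (intro member_le_sum) (auto simp: h_nonneg)

lemma f_pos:
  assumes "x1 \<in> space P" "y \<in> space L"
  shows "0 < f x1 d1 y"
proof -
  obtain d2 where d2: "d2 \<in> set_pmf D" using set_pmf_not_empty[of D] by blast
  then show ?thesis using f_ge[OF d2, of x1 d1 y] h_pos[OF assms, of d1 d2] pmf_positive[OF d2]
    by (meson less_le_trans mult_pos_pos)
qed

lemma f_le:
  assumes "x1 \<in> space P" "y \<in> space L"
  shows "f x1 d1 y \<le> 1"
proof -
  have "f x1 d1 y \<le> (\<Sum>d2\<in>set_pmf D. pmf D d2 * 1)"
    unfolding f_def by (intro sum_mono mult_left_mono h_le assms) auto
  then show ?thesis by simp
qed

lemma g_nonneg: "0 \<le> g y"
  unfolding g_def by (intro sum_nonneg mult_nonneg_nonneg g_cond_nonneg) auto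

lemma g_ge:
  assumes "d1 \<in> set_pmf D" "d2 \<in> set_pmf D"
  shows "pmf D d1 * pmf D d2 * g_cond d1 d2 y \<le> g y"
proof -
  have "pmf D d1 * pmf D d2 * g_cond d1 d2 y \<le> (\<Sum>d2\<in>set_pmf D. pmf D d1 * pmf D d2 * g_cond d1 d2 y)"
    by (intro member_le_sum) (auto simp: g_cond_nonneg assms)
  also have "\<dots> \<le> g y"
    unfolding g_def by (intro member_le_sum sum_nonneg) (auto simp: g_cond_nonneg assms)
  finally show ?thesis .
qed

lemma g_pos:
  assumes "y \<in> space L"
  shows "0 < g y"
proof -
  obtain d where d: "d \<in> set_pmf D" using set_pmf_not_empty[of D] by blast
  then show ?thesis using g_ge[OF d d, of y] g_cond_pos[OF assms, of d d] pmf_positive[OF d]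
    by (meson less_le_trans mult_pos_pos)
qed

lemma g_le:
  assumes "y \<in> space L"
  shows "g y \<le> 1"
proof -
  have "g y \<le> (\<Sum>d1\<in>set_pmf D. \<Sum>d2\<in>set_pmf D. pmf D d1 * pmf D d2 * 1)"
    unfolding g_def by (intro sum_mono mult_left_mono g_cond_le assms) auto
  then show ?thesis by (simp add: sum_distrib_left[symmetric])
qed

text \<open>Integrating out the noise by \<open>kernel\<close> and then \<open>x2\<close> by Tonelli
  leaves the first input and the output with \<open>h\<close> as transition density.\<close>

lemma nn_integral_base_out:
  assumes [measurable]: "case_prod F \<in> borel_measurable (P \<Otimes>\<^sub>M L)"
  shows "(\<integral>\<^sup>+ (x1, x2, z). F x1 (out x1 x2 d1 d2 z) \<partial>base_space) =
    (\<integral>\<^sup>+ x1. \<integral>\<^sup>+ y. ennreal (h x1 d1 d2 y) * F x1 y \<partial>L \<partial>P)"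
proof -
  have "(\<integral>\<^sup>+ (x1, x2, z). F x1 (out x1 x2 d1 d2 z) \<partial>base_space) =
    (\<integral>\<^sup>+ x1. \<integral>\<^sup>+ x2. \<integral>\<^sup>+ z. F x1 (out x1 x2 d1 d2 z) \<partial>N \<partial>P \<partial>P)"
    by (rule nn_integral_base_space) measurable
  also have "\<dots> = (\<integral>\<^sup>+ x1. \<integral>\<^sup>+ x2. \<integral>\<^sup>+ y. ennreal (k x1 x2 d1 d2 y) * F x1 y \<partial>L \<partial>P \<partial>P)"
    by (intro nn_integral_cong kernel) measurable
  also have "\<dots> = (\<integral>\<^sup>+ x1. \<integral>\<^sup>+ y. \<integral>\<^sup>+ x2. ennreal (k x1 x2 d1 d2 y) * F x1 y \<partial>P \<partial>L \<partial>P)"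
    by (intro nn_integral_cong PL.Fubini'[symmetric]) measurable
  also have "\<dots> = (\<integral>\<^sup>+ x1. \<integral>\<^sup>+ y. ennreal (h x1 d1 d2 y) * F x1 y \<partial>L \<partial>P)"
    by (intro nn_integral_cong) (simp add: ennreal_h nn_integral_multc)
  finally show ?thesis .
qed

lemma nn_integral_base_out':
  assumes [measurable]: "F \<in> borel_measurable L"
  shows "(\<integral>\<^sup>+ (x1, x2, z). F (out x1 x2 d1 d2 z) \<partial>base_space) =
    (\<integral>\<^sup>+ y. ennreal (g_cond d1 d2 y) * F y \<partial>L)"
proof -
  have "(\<integral>\<^sup>+ (x1, x2, z). F (out x1 x2 d1 d2 z) \<partial>base_space) =
    (\<integral>\<^sup>+ x1. \<integral>\<^sup>+ y. ennreal (h x1 d1 d2 y) * F y \<partial>L \<partial>P)"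
    by (rule nn_integral_base_out) measurable
  also have "\<dots> = (\<integral>\<^sup>+ y. \<integral>\<^sup>+ x1. ennreal (h x1 d1 d2 y) * F y \<partial>P \<partial>L)"
    by (intro PL.Fubini'[symmetric]) measurable
  also have "\<dots> = (\<integral>\<^sup>+ y. ennreal (g_cond d1 d2 y) * F y \<partial>L)"
    by (intro nn_integral_cong) (simp add: ennreal_g_cond nn_integral_multc)
  finally show ?thesis .
qed

lemma emeasure_base_space: "emeasure base_space (space base_space) = 1"
  using prob_spaces(8) by (rule prob_space.emeasure_space_1)

lemma h_integral: "(\<integral>\<^sup>+ x1. \<integral>\<^sup>+ y. ennreal (h x1 d1 d2 y) \<partial>L \<partial>P) = 1"
  using nn_integral_base_out[of "\<lambda>_ _. 1" d1 d2] emeasure_base_space by (simp add: split_beta')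

lemma g_cond_integral: "(\<integral>\<^sup>+ y. ennreal (g_cond d1 d2 y) \<partial>L) = 1"
  using nn_integral_base_out'[of "\<lambda>_. 1" d1 d2] emeasure_base_space by (simp add: split_beta')

lemma ennreal_f: "ennreal (f x1 d1 y) = (\<Sum>d2\<in>set_pmf D. ennreal (pmf D d2) * ennreal (h x1 d1 d2 y))"
  unfolding f_def by (simp add: h_nonneg ennreal_mult[symmetric] sum_ennreal)

lemma ennreal_g: "ennreal (g y) = (\<Sum>d1\<in>set_pmf D. \<Sum>d2\<in>set_pmf D.
    weight d1 d2 * ennreal (g_cond d1 d2 y))"
  unfolding g_def by (simp add: g_cond_nonneg ennreal_mult[symmetric] sum_ennreal sum_nonneg)

lemma sum_ennreal_pmf_set: "(\<Sum>d\<in>set_pmf D. ennreal (pmf D d)) = 1"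
  by (simp add: sum_ennreal)

lemma f_integral: "(\<integral>\<^sup>+ x1. \<integral>\<^sup>+ y. ennreal (f x1 d1 y) \<partial>L \<partial>P) = 1"
  by (simp add: ennreal_f nn_integral_sum nn_integral_cmult h_integral sum_ennreal_pmf_set cong: nn_integral_cong)

lemma g_integral: "(\<integral>\<^sup>+ y. ennreal (g y) \<partial>L) = 1"
  by (simp add: ennreal_g nn_integral_sum nn_integral_cmult g_cond_integral sum_ennreal_pmf_set
    sum_distrib_left[symmetric])

text \<open>The channel input is the pair (x1, d1), so \<open>f\<close> and \<open>g\<close> are the
  densities that \<open>mutual_information_kernel\<close> asks for. \<open>S\<close> and
  \<open>T\<close> are fixed only up to their measurable sets because the informations to be
  computed are taken over \<open>borel\<close> instead of \<open>P\<close> and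
  \<open>L\<close>.\<close>

lemma mutual_information_eq:
  assumes b: "1 < b" and S: "sets S = sets (P \<Otimes>\<^sub>M count_space UNIV)" and T: "sets T = sets L"
  shows "prob_space.mutual_information full_space b S T channel_input
      channel_output =
    (\<integral>(x1, x2, d1, d2, z). log b (f x1 d1 (out x1 x2 d1 d2 z) / g (out x1 x2 d1 d2 z)) \<partial>full_space)"
proof -
  interpret Q: prob_space full_space by (rule prob_spaces(7))
  note [measurable_cong] = S T
  have "Q.mutual_information b S T channel_input
      channel_output =
    (\<integral>w. log b ((\<lambda>(x1, d1). f x1 d1) (channel_input w)
      (channel_output w) / g (channel_output w)) \<partial>full_space)"
  proof (rule Q.mutual_information_kernel[OF b, where L = L])
    show "sigma_finite_measure L" ..
    show "0 < g y" if "y \<in> space T" for y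
      using that g_pos sets_eq_imp_space_eq[OF T] by auto
    have "(\<lambda>w. f (fst (fst w)) (snd (fst w)) (snd w)) \<in> borel_measurable (S \<Otimes>\<^sub>M T)"
      by measurable
    then show "case_prod (\<lambda>(x1, d1). f x1 d1) \<in> borel_measurable (S \<Otimes>\<^sub>M T)"
      by (simp add: split_beta')
  next
    fix F :: "('a \<times> 'd) \<times> 'y \<Rightarrow> ennreal" assume [measurable]: "F \<in> borel_measurable (S \<Otimes>\<^sub>M T)"
    have "(\<integral>\<^sup>+ w. F (channel_input w, channel_output w) \<partial>full_space) =
      (\<integral>\<^sup>+ (x1, x2, d1, d2, z). F ((x1, d1), out x1 x2 d1 d2 z) \<partial>full_space)"
      by (simp add: split_beta')
    also have "\<dots> = (\<Sum>d1\<in>set_pmf D. \<Sum>d2\<in>set_pmf D. weight d1 d2 *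
      (\<integral>\<^sup>+ (x1, x2, z). F ((x1, d1), out x1 x2 d1 d2 z) \<partial>base_space))"
      by (rule nn_integral_full_space) measurable
    also have "\<dots> = (\<Sum>d1\<in>set_pmf D. \<Sum>d2\<in>set_pmf D. weight d1 d2 *
      (\<integral>\<^sup>+ x1. \<integral>\<^sup>+ y. ennreal (h x1 d1 d2 y) * F ((x1, d1), y) \<partial>L \<partial>P))"
      by (intro sum.cong refl arg_cong2[where f="(*)"] nn_integral_base_out) measurable
    also have "\<dots> = (\<Sum>d1\<in>set_pmf D. ennreal (pmf D d1) * (\<Sum>d2\<in>set_pmf D. ennreal (pmf D d2) *
      (\<integral>\<^sup>+ x1. \<integral>\<^sup>+ y. ennreal (h x1 d1 d2 y) * F ((x1, d1), y) \<partial>L \<partial>P)))"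
      by (simp add: sum_distrib_left mult_ac)
    also have "\<dots> = (\<Sum>d1\<in>set_pmf D. ennreal (pmf D d1) *
      (\<integral>\<^sup>+ x1. \<integral>\<^sup>+ y. ennreal (f x1 d1 y) * F ((x1, d1), y) \<partial>L \<partial>P))"
    proof (intro sum.cong refl arg_cong2[where f="(*)"])
      fix d1
      define G where "G x y = F ((x, d1), y)" for x y
      have [measurable]: "case_prod G \<in> borel_measurable (P \<Otimes>\<^sub>M L)"
        unfolding G_def by measurable
      have "(\<Sum>d2\<in>set_pmf D. ennreal (pmf D d2) * (\<integral>\<^sup>+ x1. \<integral>\<^sup>+ y. ennreal (h x1 d1 d2 y) * G x1 y \<partial>L \<partial>P)) =
        (\<integral>\<^sup>+ x1. \<integral>\<^sup>+ y. ennreal (f x1 d1 y) * G x1 y \<partial>L \<partial>P)"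
        by (simp add: ennreal_f sum_distrib_right nn_integral_sum nn_integral_cmult mult.assoc
          cong: nn_integral_cong)
      then show "(\<Sum>d2\<in>set_pmf D. ennreal (pmf D d2) *
          (\<integral>\<^sup>+ x1. \<integral>\<^sup>+ y. ennreal (h x1 d1 d2 y) * F ((x1, d1), y) \<partial>L \<partial>P)) =
        (\<integral>\<^sup>+ x1. \<integral>\<^sup>+ y. ennreal (f x1 d1 y) * F ((x1, d1), y) \<partial>L \<partial>P)"
        by (simp add: G_def)
    qed
    \<comment> \<open>The inner integral is free of \<open>d2\<close>, \<open>x2\<close> and
      \<open>z\<close>. Averaging over these as well changes nothing and brings back the shape of
      \<open>nn_integral_full_space\<close>.\<close>
    also have "\<dots> = (\<Sum>d1\<in>set_pmf D. \<Sum>d2\<in>set_pmf D. weight d1 d2 *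
      (\<integral>\<^sup>+ (x1, x2, z). (\<integral>\<^sup>+ y. ennreal (f x1 d1 y) * F ((x1, d1), y) \<partial>L) \<partial>base_space))"
    proof (rule sum.cong[OF refl])
      fix d1
      have "(\<integral>\<^sup>+ (x1, x2, z). (\<integral>\<^sup>+ y. ennreal (f x1 d1 y) * F ((x1, d1), y) \<partial>L) \<partial>base_space) =
        (\<integral>\<^sup>+ x1. \<integral>\<^sup>+ y. ennreal (f x1 d1 y) * F ((x1, d1), y) \<partial>L \<partial>P)"
        by (subst nn_integral_base_space) (simp_all add: N.emeasure_space_1 P.emeasure_space_1)
      then show "ennreal (pmf D d1) * (\<integral>\<^sup>+ x1. \<integral>\<^sup>+ y. ennreal (f x1 d1 y) * F ((x1, d1), y) \<partial>L \<partial>P) =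
        (\<Sum>d2\<in>set_pmf D. weight d1 d2 *
          (\<integral>\<^sup>+ (x1, x2, z). (\<integral>\<^sup>+ y. ennreal (f x1 d1 y) * F ((x1, d1), y) \<partial>L) \<partial>base_space))"
        by (simp add: sum_distrib_left[symmetric] sum_distrib_right[symmetric] sum_ennreal_pmf_set)
    qed
    also have "\<dots> = (\<integral>\<^sup>+ (x1, x2, d1, d2, z). (\<integral>\<^sup>+ y. ennreal (f x1 d1 y) * F ((x1, d1), y) \<partial>L) \<partial>full_space)"
      by (rule nn_integral_full_space[symmetric]) measurable
    finally show "(\<integral>\<^sup>+ w. F (channel_input w, channel_output w) \<partial>full_space) =
      (\<integral>\<^sup>+ w. (\<integral>\<^sup>+ y. ennreal ((\<lambda>(x1, d1). f x1 d1) (channel_input w) y) *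
        F (channel_input w, y) \<partial>L) \<partial>full_space)"
      by (simp add: split_beta')
  next
    fix F :: "'y \<Rightarrow> ennreal" assume [measurable]: "F \<in> borel_measurable T"
    have "(\<integral>\<^sup>+ w. F (channel_output w) \<partial>full_space) =
      (\<integral>\<^sup>+ (x1, x2, d1, d2, z). F (out x1 x2 d1 d2 z) \<partial>full_space)"
      by (simp add: split_beta')
    also have "\<dots> = (\<Sum>d1\<in>set_pmf D. \<Sum>d2\<in>set_pmf D. weight d1 d2 *
      (\<integral>\<^sup>+ (x1, x2, z). F (out x1 x2 d1 d2 z) \<partial>base_space))"
      by (rule nn_integral_full_space) measurable
    also have "\<dots> = (\<Sum>d1\<in>set_pmf D. \<Sum>d2\<in>set_pmf D. weight d1 d2 *
      (\<integral>\<^sup>+ y. ennreal (g_cond d1 d2 y) * F y \<partial>L))"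
      by (intro sum.cong refl arg_cong2[where f="(*)"] nn_integral_base_out') measurable
    also have "\<dots> = (\<integral>\<^sup>+ y. ennreal (g y) * F y \<partial>L)"
      by (simp add: ennreal_g sum_distrib_right nn_integral_sum nn_integral_cmult mult.assoc cong: nn_integral_cong)
    finally show "(\<integral>\<^sup>+ w. F (channel_output w) \<partial>full_space) =
      (\<integral>\<^sup>+ y. ennreal (g y) * F y \<partial>L)" .
  qed (auto simp: f_nonneg g_nonneg T)
  then show ?thesis by (simp add: split_beta')
qed

text \<open>The argument goes through positive and negative parts; integrability for each pair of
  marks in the support keeps the differences of the sums finite.\<close>

lemma integral_full_space:
  fixes F :: "'a \<Rightarrow> 'a \<Rightarrow> 'd \<Rightarrow> 'd \<Rightarrow> 'y \<Rightarrow> real"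
  assumes "(\<lambda>(x1, x2, d1, d2, z). F x1 x2 d1 d2 z) \<in> borel_measurable full_space"
  assumes int: "\<And>d1 d2. d1 \<in> set_pmf D \<Longrightarrow> d2 \<in> set_pmf D \<Longrightarrow>
    integrable base_space (\<lambda>(x1, x2, z). F x1 x2 d1 d2 z)"
  shows "(\<integral>(x1, x2, d1, d2, z). F x1 x2 d1 d2 z \<partial>full_space) =
    (\<Sum>d1\<in>set_pmf D. \<Sum>d2\<in>set_pmf D. pmf D d1 * pmf D d2 *
      (\<integral>(x1, x2, z). F x1 x2 d1 d2 z \<partial>base_space))"
proof -
  have fin: "(\<integral>\<^sup>+ (x1, x2, z). ennreal (F x1 x2 d1 d2 z) \<partial>base_space) < \<infinity>"
      "(\<integral>\<^sup>+ (x1, x2, z). ennreal (- F x1 x2 d1 d2 z) \<partial>base_space) < \<infinity>"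
    if "d1 \<in> set_pmf D" "d2 \<in> set_pmf D" for d1 d2
    using int[OF that] by (auto simp: real_integrable_def split_beta' top.not_eq_extremum)
  have fin': "weight d1 d2 *
        (\<integral>\<^sup>+ (x1, x2, z). ennreal (F x1 x2 d1 d2 z) \<partial>base_space) < \<infinity>"
      "weight d1 d2 *
        (\<integral>\<^sup>+ (x1, x2, z). ennreal (- F x1 x2 d1 d2 z) \<partial>base_space) < \<infinity>"
    if "d1 \<in> set_pmf D" "d2 \<in> set_pmf D" for d1 d2
    using fin[OF that] by (auto simp: ennreal_mult_less_top)
  have eq: "(\<integral>\<^sup>+ (x1, x2, d1, d2, z). ennreal (F x1 x2 d1 d2 z) \<partial>full_space) =
    (\<Sum>d1\<in>set_pmf D. \<Sum>d2\<in>set_pmf D. weight d1 d2 *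
      (\<integral>\<^sup>+ (x1, x2, z). ennreal (F x1 x2 d1 d2 z) \<partial>base_space))"
    "(\<integral>\<^sup>+ (x1, x2, d1, d2, z). ennreal (- F x1 x2 d1 d2 z) \<partial>full_space) =
    (\<Sum>d1\<in>set_pmf D. \<Sum>d2\<in>set_pmf D. weight d1 d2 *
      (\<integral>\<^sup>+ (x1, x2, z). ennreal (- F x1 x2 d1 d2 z) \<partial>base_space))"
    using measurable_compose[OF assms(1) measurable_ennreal]
      measurable_compose[OF borel_measurable_uminus[OF assms(1)] measurable_ennreal]
    by - (rule nn_integral_full_space, simp add: split_beta')+
  have "integrable full_space (\<lambda>(x1, x2, d1, d2, z). F x1 x2 d1 d2 z)"
    using eq fin' assms(1) by (auto simp: real_integrable_def split_beta' simp flip: top.not_eq_extremum)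
  then have "(\<integral>(x1, x2, d1, d2, z). F x1 x2 d1 d2 z \<partial>full_space) =
      enn2real (\<integral>\<^sup>+ (x1, x2, d1, d2, z). ennreal (F x1 x2 d1 d2 z) \<partial>full_space) -
      enn2real (\<integral>\<^sup>+ (x1, x2, d1, d2, z). ennreal (- F x1 x2 d1 d2 z) \<partial>full_space)"
    by (subst real_lebesgue_integral_def) (auto simp: split_beta')
  also have "\<dots> = (\<Sum>d1\<in>set_pmf D. \<Sum>d2\<in>set_pmf D. pmf D d1 * pmf D d2 *
      (enn2real (\<integral>\<^sup>+ (x1, x2, z). ennreal (F x1 x2 d1 d2 z) \<partial>base_space) -
       enn2real (\<integral>\<^sup>+ (x1, x2, z). ennreal (- F x1 x2 d1 d2 z) \<partial>base_space)))"
    unfolding eq using fin'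
    by (simp add: enn2real_sum enn2real_mult sum_subtractf right_diff_distrib)
  also have "\<dots> = (\<Sum>d1\<in>set_pmf D. \<Sum>d2\<in>set_pmf D. pmf D d1 * pmf D d2 *
      (\<integral>(x1, x2, z). F x1 x2 d1 d2 z \<partial>base_space))"
    using int by (intro sum.cong refl arg_cong2[where f="(*)"])
      (subst real_lebesgue_integral_def, auto simp: split_beta')
  finally show ?thesis .
qed

end

text \<open>
  The functions \<open>e\<close> and \<open>m\<close> bound \<open>- ln k\<close>. They make all information densities integrable, so that
  the Bochner integrals below are never the default value.
\<close>

locale tame_channel = mixture_channel P N L D out k
  for P :: "'a measure" and N :: "'y measure" and L :: "'y measure" and D :: "'d pmf" and out k +
  fixes e :: "'a \<Rightarrow> real" and m :: "'y \<Rightarrow> real" and C0 :: "'d \<Rightarrow> 'd \<Rightarrow> real"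
  assumes e_integrable [measurable]: "integrable P e" and e_nonneg: "0 \<le> e x"
    and m_measurable [measurable]: "m \<in> borel_measurable L"
    and m_integrable: "d1 \<in> set_pmf D \<Longrightarrow> d2 \<in> set_pmf D \<Longrightarrow> integrable base_space (\<lambda>(x1, x2, z). m (out x1 x2 d1 d2 z))"
    and k_ge: "d1 \<in> set_pmf D \<Longrightarrow> d2 \<in> set_pmf D \<Longrightarrow> - ln (k x1 x2 d1 d2 y) \<le> C0 d1 d2 + e x1 + e x2 + m y"
begin

text \<open>Averaging the lower bound for the density over an input replaces the term
  \<open>e\<close> of that input by the constant - ln E (exp (- e)). This happens once on the way
  from \<open>k\<close> to \<open>h\<close> and twice on the way to \<open>g_cond\<close>.\<close>

definition C1 where "C1 d1 d2 = C0 d1 d2 - ln (\<integral>x. exp (- e x) \<partial>P)"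
definition C2 where "C2 d1 d2 = C1 d1 d2 - ln (\<integral>x. exp (- e x) \<partial>P)"

lemma integrable_exp: "integrable P (\<lambda>x. exp (- e x))"
  using e_integrable by (intro P.integrable_const_bound[of _ 1]) (auto simp: e_nonneg)

lemma exp_pos: "0 < (\<integral>x. exp (- e x) \<partial>P)"
  by (intro P.expectation_greater integrable_exp) simp

lemma h_ge:
  assumes xy: "x1 \<in> space P" "y \<in> space L" and d: "d1 \<in> set_pmf D" "d2 \<in> set_pmf D"
  shows "- ln (h x1 d1 d2 y) \<le> C1 d1 d2 + e x1 + m y"
proof -
  have "exp (- (C0 d1 d2 + e x1 + m y)) * exp (- e x2) \<le> k x1 x2 d1 d2 y" for x2
  proof -
    have "- (C0 d1 d2 + e x1 + m y) - e x2 \<le> ln (k x1 x2 d1 d2 y)"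
      using k_ge[OF d, of x1 x2 y] by simp
    then show ?thesis
      using k_pos by (simp add: exp_add[symmetric] ln_ge_iff)
  qed
  then have "(\<integral>x2. exp (- (C0 d1 d2 + e x1 + m y)) * exp (- e x2) \<partial>P) \<le> h x1 d1 d2 y"
    unfolding h_def using integrable_exp integrable_k[OF xy] by (intro integral_mono) auto
  then have "ln (exp (- (C0 d1 d2 + e x1 + m y)) * (\<integral>x2. exp (- e x2) \<partial>P)) \<le> ln (h x1 d1 d2 y)"
    using exp_pos by (intro ln_mono) (auto simp: h_pos[OF xy])
  then show ?thesis
    using exp_pos by (simp add: ln_mult_pos C1_def)
qed

lemma g_cond_ge:
  assumes y: "y \<in> space L" and d: "d1 \<in> set_pmf D" "d2 \<in> set_pmf D"
  shows "- ln (g_cond d1 d2 y) \<le> C2 d1 d2 + m y"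
proof -
  have "exp (- (C1 d1 d2 + m y)) * exp (- e x1) \<le> h x1 d1 d2 y" if "x1 \<in> space P" for x1
  proof -
    have "- (C1 d1 d2 + m y) - e x1 \<le> ln (h x1 d1 d2 y)"
      using h_ge[OF that y d] by simp
    then show ?thesis
      using h_pos[OF that y] by (simp add: exp_add[symmetric] ln_ge_iff)
  qed
  then have "(\<integral>x1. exp (- (C1 d1 d2 + m y)) * exp (- e x1) \<partial>P) \<le> g_cond d1 d2 y"
    unfolding g_cond_def using integrable_exp integrable_h[OF y] by (intro integral_mono) auto
  then have "ln (exp (- (C1 d1 d2 + m y)) * (\<integral>x2. exp (- e x2) \<partial>P)) \<le> ln (g_cond d1 d2 y)"
    using exp_pos by (intro ln_mono) (auto simp: g_cond_pos[OF y])
  then show ?thesis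
    using exp_pos by (simp add: ln_mult_pos C2_def)
qed

lemma out_in_space:
  assumes "w \<in> space base_space"
  shows "fst w \<in> space P" "out (fst w) (fst (snd w)) d1 d2 (snd (snd w)) \<in> space L"
proof -
  have "(\<lambda>w. out (fst w) (fst (snd w)) d1 d2 (snd (snd w))) \<in> measurable base_space L"
    by measurable
  from measurable_space[OF this assms]
  show "out (fst w) (fst (snd w)) d1 d2 (snd (snd w)) \<in> space L" .
  show "fst w \<in> space P" using assms by (auto simp: space_pair_measure)
qed

lemma integrable_base_e: "integrable base_space (\<lambda>(x1, x2, z). e x1)"
proof (rule integrableI_nonneg)
  have "(\<integral>\<^sup>+ (x1, x2, z). ennreal (e x1) \<partial>base_space) = (\<integral>\<^sup>+ x1. ennreal (e x1) \<partial>P)"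
    by (subst nn_integral_base_space) (auto simp: N.emeasure_space_1 P.emeasure_space_1)
  also have "\<dots> < \<infinity>"
    using e_integrable e_nonneg by (simp add: nn_integral_eq_integral)
  finally show "(\<integral>\<^sup>+ w. ennreal (case w of (x1, x2, z) \<Rightarrow> e x1) \<partial>base_space) < \<infinity>"
    by (simp add: split_beta')
qed (auto simp: e_nonneg)

interpretation base: prob_space base_space by (rule prob_spaces)

lemma integrable_dominated:
  fixes F :: "'a \<Rightarrow> 'y \<Rightarrow> real"
  assumes d: "d1 \<in> set_pmf D" "d2 \<in> set_pmf D"
  assumes [measurable]: "case_prod F \<in> borel_measurable (P \<Otimes>\<^sub>M L)"
  assumes le: "\<And>x y. x \<in> space P \<Longrightarrow> y \<in> space L \<Longrightarrow> \<bar>F x y\<bar> \<le> C + e x + m y"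
  shows "integrable base_space (\<lambda>(x1, x2, z). F x1 (out x1 x2 d1 d2 z))"
proof (rule Bochner_Integration.integrable_bound)
  show "integrable base_space (\<lambda>w. C + (case w of (x1, x2, z) \<Rightarrow> e x1) +
      (case w of (x1, x2, z) \<Rightarrow> m (out x1 x2 d1 d2 z)))"
    by (intro Bochner_Integration.integrable_add integrable_base_e m_integrable d) simp
  show "AE w in base_space. norm (case w of (x1, x2, z) \<Rightarrow> F x1 (out x1 x2 d1 d2 z)) \<le>
    norm (C + (case w of (x1, x2, z) \<Rightarrow> e x1) + (case w of (x1, x2, z) \<Rightarrow> m (out x1 x2 d1 d2 z)))"
  proof (rule AE_I2)
    fix w assume w: "w \<in> space base_space"
    obtain x1 x2 z where [simp]: "w = (x1, x2, z)" by (cases w)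
    have "x1 \<in> space P" "out x1 x2 d1 d2 z \<in> space L"
      using out_in_space[OF w] by auto
    from le[OF this]
    show "norm (case w of (x1, x2, z) \<Rightarrow> F x1 (out x1 x2 d1 d2 z)) \<le>
      norm (C + (case w of (x1, x2, z) \<Rightarrow> e x1) + (case w of (x1, x2, z) \<Rightarrow> m (out x1 x2 d1 d2 z)))"
      by simp
  qed
qed measurable

lemma abs_ln_le: "0 < (x::real) \<Longrightarrow> x \<le> 1 \<Longrightarrow> - ln x \<le> c \<Longrightarrow> \<bar>ln x\<bar> \<le> c"
  by simp

lemma integrable_ln_h:
  assumes "d1 \<in> set_pmf D" "d2 \<in> set_pmf D"
  shows "integrable base_space (\<lambda>(x1, x2, z). ln (h x1 d1 d2 (out x1 x2 d1 d2 z)))"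
  by (rule integrable_dominated[of d1 d2 "\<lambda>x1 y. ln (h x1 d1 d2 y)" "C1 d1 d2", OF assms])
    (auto intro!: abs_ln_le h_ge h_pos h_le assms)

lemma integrable_ln_g_cond:
  assumes d: "d1 \<in> set_pmf D" "d2 \<in> set_pmf D"
  shows "integrable base_space (\<lambda>(x1, x2, z). ln (g_cond d1 d2 (out x1 x2 d1 d2 z)))"
proof (rule integrable_dominated[of d1 d2 "\<lambda>x1 y. ln (g_cond d1 d2 y)" "C2 d1 d2", OF d])
  fix x y assume "x \<in> space P" "y \<in> space L"
  then show "\<bar>ln (g_cond d1 d2 y)\<bar> \<le> C2 d1 d2 + e x + m y"
    using g_cond_ge[of y, OF _ d] e_nonneg[of x] by (intro abs_ln_le g_cond_pos g_cond_le) auto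
qed measurable

lemma integrable_ln_f:
  assumes d1: "d1 \<in> set_pmf D" and d2: "d2 \<in> set_pmf D"
  shows "integrable base_space (\<lambda>(x1, x2, z). ln (f x1 d1 (out x1 x2 d1 d2 z)))"
proof (rule integrable_dominated[of d1 d2 "\<lambda>x1 y. ln (f x1 d1 y)" "C1 d1 d2 - ln (pmf D d2)", OF d1 d2])
  fix x y assume *: "x \<in> space P" "y \<in> space L"
  \<comment> \<open>The true second mark is among the terms of the mixture, so \<open>f\<close>
    inherits the lower bound for \<open>h\<close>.\<close>
  have "ln (pmf D d2 * h x d1 d2 y) \<le> ln (f x d1 y)"
    using f_ge[OF d2] h_pos[OF *] pmf_positive[OF d2] by (intro ln_mono) (auto simp: f_pos *)
  then show "\<bar>ln (f x d1 y)\<bar> \<le> C1 d1 d2 - ln (pmf D d2) + e x + m y"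
    using h_ge[OF * d1 d2] h_pos[OF *] pmf_positive[OF d2]
    by (intro abs_ln_le f_pos f_le *) (auto simp: ln_mult_pos)
qed measurable

lemma integrable_ln_g:
  assumes d: "d1 \<in> set_pmf D" "d2 \<in> set_pmf D"
  shows "integrable base_space (\<lambda>(x1, x2, z). ln (g (out x1 x2 d1 d2 z)))"
proof (rule integrable_dominated[of d1 d2 "\<lambda>x1 y. ln (g y)" "C2 d1 d2 - ln (pmf D d1 * pmf D d2)", OF d])
  fix x y assume *: "x \<in> space P" "y \<in> space L"
  have "ln (pmf D d1 * pmf D d2 * g_cond d1 d2 y) \<le> ln (g y)"
    using g_ge[OF d] g_cond_pos[OF *(2)] pmf_positive[OF d(1)] pmf_positive[OF d(2)]
    by (intro ln_mono) (auto simp: g_pos *)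
  then show "\<bar>ln (g y)\<bar> \<le> C2 d1 d2 - ln (pmf D d1 * pmf D d2) + e x + m y"
    using g_cond_ge[OF *(2) d] g_cond_pos[OF *(2)] pmf_positive[OF d(1)] pmf_positive[OF d(2)]
      e_nonneg[of x]
    by (intro abs_ln_le g_pos g_le *) (auto simp: ln_mult_pos)
qed measurable

text \<open>The domination makes both logarithms integrable, so the information density may be split
  into a difference and averaged mark by mark. The factor ln b passes to natural logarithms, in
  which all later estimates are made.\<close>

theorem mutual_information_sum:
  assumes b: "1 < b" and S: "sets S = sets (P \<Otimes>\<^sub>M count_space UNIV)" and T: "sets T = sets L"
  shows "ln b * prob_space.mutual_information full_space b S T channel_input
      channel_output =
    (\<Sum>d1\<in>set_pmf D. \<Sum>d2\<in>set_pmf D. pmf D d1 * pmf D d2 *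
      (mean_ln_f d1 d2 -
       mean_ln_g d1 d2))"
proof -
  let ?F = "\<lambda>x1 x2 d1 d2 z. ln (f x1 d1 (out x1 x2 d1 d2 z)) - ln (g (out x1 x2 d1 d2 z))"
  have int: "has_bochner_integral base_space (\<lambda>(x1, x2, z). ?F x1 x2 d1 d2 z)
      (mean_ln_f d1 d2 -
       mean_ln_g d1 d2)"
    if d: "d1 \<in> set_pmf D" "d2 \<in> set_pmf D" for d1 d2
    using has_bochner_integral_diff[OF has_bochner_integral_integrable[OF integrable_ln_f[OF d]]
      has_bochner_integral_integrable[OF integrable_ln_g[OF d]]]
    by (simp add: split_beta')
  have "ln b * prob_space.mutual_information full_space b S T channel_input
      channel_output =
    ln b * (\<integral>(x1, x2, d1, d2, z). log b (f x1 d1 (out x1 x2 d1 d2 z) / g (out x1 x2 d1 d2 z)) \<partial>full_space)"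
    by (simp add: mutual_information_eq[OF assms])
  also have "\<dots> = (\<integral>w. ln b * (case w of (x1, x2, d1, d2, z) \<Rightarrow>
      log b (f x1 d1 (out x1 x2 d1 d2 z) / g (out x1 x2 d1 d2 z))) \<partial>full_space)"
    by (rule integral_mult_right_zero[symmetric])
  also have "\<dots> = (\<integral>(x1, x2, d1, d2, z). ?F x1 x2 d1 d2 z \<partial>full_space)"
  proof (rule Bochner_Integration.integral_cong[OF refl])
    fix w assume w: "w \<in> space full_space"
    obtain x1 x2 d1 d2 z where [simp]: "w = (x1, x2, d1, d2, z)" by (cases w)
    have "x1 \<in> space P" "out x1 x2 d1 d2 z \<in> space L"
      using out_in_space[of "(x1, x2, z)"] w by (auto simp: space_pair_measure)
    then show "ln b * (case w of (x1, x2, d1, d2, z) \<Rightarrow>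
        log b (f x1 d1 (out x1 x2 d1 d2 z) / g (out x1 x2 d1 d2 z))) =
      (case w of (x1, x2, d1, d2, z) \<Rightarrow> ?F x1 x2 d1 d2 z)"
      using b f_pos[of x1 "out x1 x2 d1 d2 z" d1] g_pos[of "out x1 x2 d1 d2 z"] by (simp add: log_def ln_divide_pos)
  qed
  also have "\<dots> = (\<Sum>d1\<in>set_pmf D. \<Sum>d2\<in>set_pmf D. pmf D d1 * pmf D d2 *
      (\<integral>(x1, x2, z). ?F x1 x2 d1 d2 z \<partial>base_space))"
    by (rule integral_full_space, measurable) (use int in \<open>auto simp: has_bochner_integral_iff\<close>)
  also have "\<dots> = (\<Sum>d1\<in>set_pmf D. \<Sum>d2\<in>set_pmf D. pmf D d1 * pmf D d2 *
      (mean_ln_f d1 d2 -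
       mean_ln_g d1 d2))"
    by (intro sum.cong refl arg_cong2[where f="(*)"] has_bochner_integral_integral_eq int)
  finally show ?thesis .
qed

text \<open>Nonnegativity of relative entropy, from ln U <= ln V + U / V - 1. In the applications V
  is the true conditional density and U a competing one, so that the mean of U / V is the total mass
  of the competitor.\<close>

lemma gibbs:
  fixes u v :: "'a \<Rightarrow> 'y \<Rightarrow> real" and d1 d2 :: 'd
  defines "U \<equiv> \<lambda>(x1, x2, z). u x1 (out x1 x2 d1 d2 z)" and "V \<equiv> \<lambda>(x1, x2, z). v x1 (out x1 x2 d1 d2 z)"
  assumes [measurable]: "case_prod u \<in> borel_measurable (P \<Otimes>\<^sub>M L)" "case_prod v \<in> borel_measurable (P \<Otimes>\<^sub>M L)"
  assumes pos: "\<And>x y. x \<in> space P \<Longrightarrow> y \<in> space L \<Longrightarrow> 0 < u x y \<and> 0 < v x y"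
  assumes int: "integrable base_space (\<lambda>w. ln (U w))" "integrable base_space (\<lambda>w. ln (V w))"
  assumes ratio: "(\<integral>\<^sup>+ w. ennreal (U w / V w) \<partial>base_space) = 1"
  shows "(\<integral>w. ln (U w) \<partial>base_space) \<le> (\<integral>w. ln (V w) \<partial>base_space)"
proof -
  have UV: "0 < U w" "0 < V w" if "w \<in> space base_space" for w
    using out_in_space[OF that] pos by (auto simp: U_def V_def split_beta')
  have [measurable]: "U \<in> borel_measurable base_space" "V \<in> borel_measurable base_space"
    unfolding U_def V_def by measurable
  have Z: "has_bochner_integral base_space (\<lambda>w. U w / V w) 1"
    using UV ratio by (intro has_bochner_integral_nn_integral) (auto intro!: AE_I2 simp: less_imp_le)
  have "(\<integral>w. ln (U w) \<partial>base_space) \<le> (\<integral>w. ln (V w) + (U w / V w - 1) \<partial>base_space)"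
  proof (rule integral_mono[OF int(1)])
    show "integrable base_space (\<lambda>w. ln (V w) + (U w / V w - 1))"
      using int(2) Z by (auto simp: has_bochner_integral_iff)
    show "ln (U w) \<le> ln (V w) + (U w / V w - 1)" if "w \<in> space base_space" for w
      using ln_le_minus_one[of "U w / V w"] UV[OF that] by (simp add: ln_divide_pos)
  qed
  also have "\<dots> = (\<integral>w. ln (V w) \<partial>base_space)"
    using int(2) Z by (simp add: has_bochner_integral_iff base.prob_space)
  finally show ?thesis .
qed

text \<open>For fixed marks the output given \<open>x1\<close> has density \<open>h\<close>, and
  \<open>f\<close> competes with it: revealing the second mark can only raise the expected
  log-density. \<open>integral_ln_g_le\<close> repeats this with \<open>g\<close> against
  \<open>g_cond\<close>.\<close>

lemma integral_ln_f_le: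
  assumes d: "d1 \<in> set_pmf D" "d2 \<in> set_pmf D"
  shows "mean_ln_f d1 d2 \<le> mean_ln_h d1 d2"
proof -
  have "(\<integral>\<^sup>+ (x1, x2, z). ennreal (f x1 d1 (out x1 x2 d1 d2 z) / h x1 d1 d2 (out x1 x2 d1 d2 z)) \<partial>base_space) =
    (\<integral>\<^sup>+ x1. \<integral>\<^sup>+ y. ennreal (h x1 d1 d2 y) * ennreal (f x1 d1 y / h x1 d1 d2 y) \<partial>L \<partial>P)"
    by (rule nn_integral_base_out) measurable
  also have "\<dots> = (\<integral>\<^sup>+ x1. \<integral>\<^sup>+ y. ennreal (f x1 d1 y) \<partial>L \<partial>P)"
    by (intro nn_integral_cong)
      (auto simp: ennreal_mult[symmetric] f_nonneg h_pos less_imp_le less_imp_neq[THEN not_sym])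
  also have "\<dots> = 1" by (rule f_integral)
  finally show ?thesis
    using gibbs[of "\<lambda>x1. f x1 d1" "\<lambda>x1. h x1 d1 d2" d1 d2] integrable_ln_f[OF d] integrable_ln_h[OF d]
    by (simp add: f_pos h_pos split_beta')
qed

lemma integral_ln_g_le:
  assumes d: "d1 \<in> set_pmf D" "d2 \<in> set_pmf D"
  shows "mean_ln_g d1 d2 \<le> mean_ln_g_cond d1 d2"
proof -
  have "(\<integral>\<^sup>+ (x1, x2, z). ennreal (g (out x1 x2 d1 d2 z) / g_cond d1 d2 (out x1 x2 d1 d2 z)) \<partial>base_space) =
    (\<integral>\<^sup>+ y. ennreal (g_cond d1 d2 y) * ennreal (g y / g_cond d1 d2 y) \<partial>L)"
    by (rule nn_integral_base_out') measurable
  also have "\<dots> = (\<integral>\<^sup>+ y. ennreal (g y) \<partial>L)"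
    by (intro nn_integral_cong)
      (auto simp: ennreal_mult[symmetric] g_nonneg g_cond_pos less_imp_le less_imp_neq[THEN not_sym])
  also have "\<dots> = 1" by (rule g_integral)
  finally show ?thesis
    using gibbs[of "\<lambda>_. g" "\<lambda>_. g_cond d1 d2" d1 d2] integrable_ln_g[OF d] integrable_ln_g_cond[OF d]
    by (simp add: g_pos g_cond_pos split_beta')
qed

text \<open>Here \<open>f\<close> is raised to \<open>h\<close> by the Gibbs inequality and
  \<open>g\<close> is lowered to one term of its mixture. The excess is the entropy of the pair of
  marks.\<close>

theorem mutual_information_le:
  assumes b: "1 < b" and S: "sets S = sets (P \<Otimes>\<^sub>M count_space UNIV)" and T: "sets T = sets L"
  shows "ln b * prob_space.mutual_information full_space b S T channel_input
      channel_output \<le>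
    (\<Sum>d1\<in>set_pmf D. \<Sum>d2\<in>set_pmf D. pmf D d1 * pmf D d2 *
      (mean_ln_h d1 d2 -
       mean_ln_g_cond d1 d2 - ln (pmf D d1 * pmf D d2)))"
  unfolding mutual_information_sum[OF assms]
proof (intro sum_mono mult_left_mono)
  fix d1 d2 assume d: "d1 \<in> set_pmf D" "d2 \<in> set_pmf D"
  let ?lg = "\<lambda>(x1, x2, z). ln (g_cond d1 d2 (out x1 x2 d1 d2 z))"
  have "(\<integral>w. ln (pmf D d1 * pmf D d2) + ?lg w \<partial>base_space) \<le>
      mean_ln_g d1 d2"
  proof (intro integral_mono Bochner_Integration.integrable_add integrable_ln_g integrable_ln_g_cond d)
    fix w assume w: "w \<in> space base_space"
    obtain x1 x2 z where [simp]: "w = (x1, x2, z)" by (cases w)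
    have *: "x1 \<in> space P" "out x1 x2 d1 d2 z \<in> space L"
      using out_in_space[OF w] by auto
    have "ln (pmf D d1 * pmf D d2 * g_cond d1 d2 (out x1 x2 d1 d2 z)) \<le> ln (g (out x1 x2 d1 d2 z))"
      using g_ge[OF d] g_cond_pos[OF *(2)] pmf_positive[OF d(1)] pmf_positive[OF d(2)]
      by (intro ln_mono) (auto simp: g_pos *)
    then show "ln (pmf D d1 * pmf D d2) + ?lg w \<le> (case w of (x1, x2, z) \<Rightarrow> ln (g (out x1 x2 d1 d2 z)))"
      using g_cond_pos[OF *(2)] pmf_positive[OF d(1)] pmf_positive[OF d(2)] by (simp add: ln_mult_pos)
  qed simp
  then have "ln (pmf D d1 * pmf D d2) + (\<integral>w. ?lg w \<partial>base_space) \<le>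
      mean_ln_g d1 d2"
    by (subst (asm) Bochner_Integration.integral_add) (auto simp: integrable_ln_g_cond d base.prob_space)
  with integral_ln_f_le[OF d]
  show "mean_ln_f d1 d2 -
      mean_ln_g d1 d2 \<le>
    mean_ln_h d1 d2 -
       mean_ln_g_cond d1 d2 - ln (pmf D d1 * pmf D d2)"
    by linarith
qed auto

text \<open>The two estimates exchange roles: \<open>f\<close> is lowered to one term of its mixture
  and \<open>g\<close> is raised to \<open>g_cond\<close> by the Gibbs inequality. This costs the
  entropy of the second mark only.\<close>

theorem mutual_information_ge:
  assumes b: "1 < b" and S: "sets S = sets (P \<Otimes>\<^sub>M count_space UNIV)" and T: "sets T = sets L"
  shows "(\<Sum>d1\<in>set_pmf D. \<Sum>d2\<in>set_pmf D. pmf D d1 * pmf D d2 *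
      (mean_ln_h d1 d2 -
       mean_ln_g_cond d1 d2 + ln (pmf D d2))) \<le>
    ln b * prob_space.mutual_information full_space b S T channel_input
      channel_output"
  unfolding mutual_information_sum[OF assms]
proof (intro sum_mono mult_left_mono)
  fix d1 d2 assume d: "d1 \<in> set_pmf D" "d2 \<in> set_pmf D"
  let ?lh = "\<lambda>(x1, x2, z). ln (h x1 d1 d2 (out x1 x2 d1 d2 z))"
  have "(\<integral>w. ln (pmf D d2) + ?lh w \<partial>base_space) \<le>
      mean_ln_f d1 d2"
  proof (intro integral_mono Bochner_Integration.integrable_add integrable_ln_f integrable_ln_h d)
    fix w assume w: "w \<in> space base_space"
    obtain x1 x2 z where [simp]: "w = (x1, x2, z)" by (cases w)
    have *: "x1 \<in> space P" "out x1 x2 d1 d2 z \<in> space L"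
      using out_in_space[OF w] by auto
    have "ln (pmf D d2 * h x1 d1 d2 (out x1 x2 d1 d2 z)) \<le> ln (f x1 d1 (out x1 x2 d1 d2 z))"
      using f_ge[OF d(2)] h_pos[OF *] pmf_positive[OF d(2)]
      by (intro ln_mono) (auto simp: f_pos *)
    then show "ln (pmf D d2) + ?lh w \<le> (case w of (x1, x2, z) \<Rightarrow> ln (f x1 d1 (out x1 x2 d1 d2 z)))"
      using h_pos[OF *] pmf_positive[OF d(2)] by (simp add: ln_mult_pos)
  qed simp
  then have "ln (pmf D d2) + (\<integral>w. ?lh w \<partial>base_space) \<le>
      mean_ln_f d1 d2"
    by (subst (asm) Bochner_Integration.integral_add) (auto simp: integrable_ln_h d base.prob_space)
  with integral_ln_g_le[OF d]
  show "mean_ln_h d1 d2 -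
       mean_ln_g_cond d1 d2 + ln (pmf D d2) \<le>
    mean_ln_f d1 d2 -
      mean_ln_g d1 d2"
    by linarith
qed auto

end

section \<open>Differential entropy of smoothed laws\<close>

text \<open>Laws are available as identities of integrals in \<open>ennreal\<close>, but
  log-densities need them for Bochner integrals. The identity says that the image measure has
  density \<open>u\<close>, from which both claims follow.\<close>

lemma integral_by_law:
  assumes X [measurable]: "X \<in> measurable M lborel" and u [measurable]: "u \<in> borel_measurable lborel"
    and u0: "\<And>y. 0 \<le> u y"
    and law: "\<And>F. F \<in> borel_measurable lborel \<Longrightarrow> (\<integral>\<^sup>+ w. F (X w) \<partial>M) = (\<integral>\<^sup>+ y. ennreal (u y) * F y \<partial>lborel)"
    and G [measurable]: "(G :: _ \<Rightarrow> real) \<in> borel_measurable lborel"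
  shows "(\<integral>w. G (X w) \<partial>M) = (\<integral>y. u y * G y \<partial>lborel)"
    "integrable M (\<lambda>w. G (X w)) \<longleftrightarrow> integrable lborel (\<lambda>y. u y * G y)"
proof -
  have eq: "distr M lborel X = density lborel (\<lambda>y. ennreal (u y))"
  proof (rule measure_eqI)
    fix A assume "A \<in> sets (distr M lborel X)"
    then have [measurable]: "A \<in> sets lborel" by simp
    have "emeasure (distr M lborel X) A = (\<integral>\<^sup>+ w. indicator A (X w) \<partial>M)"
    proof -
      have "(\<integral>\<^sup>+ y. indicator A y \<partial>distr M lborel X) = (\<integral>\<^sup>+ w. indicator A (X w) \<partial>M)"
        by (rule nn_integral_distr) measurable
      then show ?thesis using \<open>A \<in> sets lborel\<close> by simp
    qed
    also have "\<dots> = emeasure (density lborel (\<lambda>y. ennreal (u y))) A"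
      using \<open>A \<in> sets lborel\<close> by (subst law) (auto simp: emeasure_density)
    finally show "emeasure (distr M lborel X) A = emeasure (density lborel (\<lambda>y. ennreal (u y))) A" .
  qed simp
  have "(\<integral>w. G (X w) \<partial>M) = (\<integral>y. G y \<partial>distr M lborel X)"
    by (rule integral_distr[OF X G, symmetric])
  then show "(\<integral>w. G (X w) \<partial>M) = (\<integral>y. u y * G y \<partial>lborel)"
    unfolding eq by (simp add: integral_density u0)
  have "integrable M (\<lambda>w. G (X w)) \<longleftrightarrow> integrable (distr M lborel X) G"
    by (rule integrable_distr_eq[OF X G, symmetric])
  then show "integrable M (\<lambda>w. G (X w)) \<longleftrightarrow> integrable lborel (\<lambda>y. u y * G y)"
    unfolding eq by (simp add: integrable_density u0)
qed

text \<open>The convolution of \<open>Q\<close> with the density of CN(0, 1), that is the density of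
  x + z for x with law \<open>Q\<close> and independent noise z. The noise makes it positive and
  bounded by 1 / pi.\<close>

definition smooth :: "complex measure \<Rightarrow> complex \<Rightarrow> real" where
  "smooth Q y = (\<integral>x. gauss_density 1 (y - x) \<partial>Q)"

definition diff_entropy :: "(complex \<Rightarrow> real) \<Rightarrow> real" where
  "diff_entropy u = - (\<integral>y. u y * ln (u y) \<partial>lborel)"

lemma gauss_density_1_le: "gauss_density 1 z \<le> 1 / pi"
  using gauss_density_le[of 1 z] by simp

lemma ln_gauss_density_1_nonpos: "ln (gauss_density 1 z) \<le> 0"
proof -
  have "0 \<le> ln pi" using pi_gt3 by (intro ln_ge_zero) simp
  then have "- sq z \<le> ln pi" using zero_le_power2[of "cmod z"] by linarith
  then show ?thesis by (simp add: ln_gauss_density)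
qed

locale power_law = prob_space Q for Q :: "complex measure" +
  fixes V :: real
  assumes sets_Q [measurable_cong]: "sets Q = sets borel"
    and power: "(\<integral>\<^sup>+ x. ennreal (sq x) \<partial>Q) \<le> ennreal V" and V_nonneg: "0 \<le> V"
begin

sublocale N1: prob_space "CN 1" by (rule prob_space_complex_gaussian) simp
sublocale QL: pair_sigma_finite Q "lborel :: complex measure" ..

lemma space_Q [simp]: "space Q = UNIV"
  using sets_eq_imp_space_eq[OF sets_Q] by simp

lemma smooth_measurable [measurable]: "smooth Q \<in> borel_measurable borel"
  unfolding smooth_def[abs_def] by measurable

lemma integrable_gauss: "integrable Q (\<lambda>x. gauss_density 1 (y - x))"
  using gauss_density_1_le by (intro integrable_const_bound[of _ "1 / pi"]) (auto simp: gauss_density_pos less_imp_le)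

lemma smooth_pos: "0 < smooth Q y"
  unfolding smooth_def by (intro expectation_greater integrable_gauss) (simp add: gauss_density_pos)

lemma smooth_nonneg: "0 \<le> smooth Q y" using smooth_pos[of y] by simp

lemma smooth_le: "smooth Q y \<le> 1 / pi"
  unfolding smooth_def by (intro integral_le_const integrable_gauss) (simp add: gauss_density_1_le)

lemma ln_smooth_nonpos: "ln (smooth Q y) \<le> 0"
proof -
  have "1 / pi \<le> 1" using pi_gt3 by simp
  then have "smooth Q y \<le> 1" using smooth_le[of y] by linarith
  then show ?thesis using smooth_pos by simp
qed

lemma ennreal_smooth: "ennreal (smooth Q y) = (\<integral>\<^sup>+ x. ennreal (gauss_density 1 (y - x)) \<partial>Q)"
  unfolding smooth_def by (intro nn_integral_eq_integral[symmetric] integrable_gauss)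
    (simp add: gauss_density_pos less_imp_le)

lemma smooth_law:
  assumes [measurable]: "F \<in> borel_measurable borel"
  shows "(\<integral>\<^sup>+ x. \<integral>\<^sup>+ z. F (x + z) \<partial>CN 1 \<partial>Q) = (\<integral>\<^sup>+ y. ennreal (smooth Q y) * F y \<partial>lborel)"
proof -
  have "(\<integral>\<^sup>+ x. \<integral>\<^sup>+ z. F (x + z) \<partial>CN 1 \<partial>Q) =
    (\<integral>\<^sup>+ x. \<integral>\<^sup>+ y. ennreal (gauss_density 1 (y - x)) * F y \<partial>lborel \<partial>Q)"
    by (intro nn_integral_cong nn_integral_complex_gaussian_shift) measurable
  also have "\<dots> = (\<integral>\<^sup>+ y. \<integral>\<^sup>+ x. ennreal (gauss_density 1 (y - x)) * F y \<partial>Q \<partial>lborel)"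
    by (intro QL.Fubini'[symmetric]) measurable
  also have "\<dots> = (\<integral>\<^sup>+ y. ennreal (smooth Q y) * F y \<partial>lborel)"
    by (intro nn_integral_cong) (simp add: ennreal_smooth nn_integral_multc)
  finally show ?thesis .
qed

lemma nn_integral_smooth: "(\<integral>\<^sup>+ y. ennreal (smooth Q y) \<partial>lborel) = 1"
  using smooth_law[of "\<lambda>_. 1"] by (simp add: N1.emeasure_space_1 emeasure_space_1 del: space_Q space_complex_gaussian)

lemma integrable_smooth: "has_bochner_integral lborel (smooth Q) 1"
  by (rule has_bochner_integral_nn_integral) (auto simp: nn_integral_smooth smooth_nonneg)

text \<open>The inequality |x + z|^2 <= 2 |x|^2 + 2 |z|^2 avoids the cross term; 8 is twice the
  bound 4 for the noise.\<close>

lemma smooth_second_moment: 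
  "integrable lborel (\<lambda>y. smooth Q y * sq y)"
  "(\<integral>y. smooth Q y * sq y \<partial>lborel) \<le> 2 * V + 8"
proof -
  have "(\<integral>\<^sup>+ y. ennreal (smooth Q y * sq y) \<partial>lborel) =
      (\<integral>\<^sup>+ x. \<integral>\<^sup>+ z. ennreal (sq (x + z)) \<partial>CN 1 \<partial>Q)"
    by (subst smooth_law) (auto simp: ennreal_mult smooth_nonneg)
  also have "\<dots> \<le> (\<integral>\<^sup>+ x. \<integral>\<^sup>+ z. 2 * ennreal (sq x) + 2 * ennreal (sq z) \<partial>CN 1 \<partial>Q)"
  proof (intro nn_integral_mono)
    fix x z
    have "ennreal (sq (x + z)) \<le> ennreal (2 * sq x + 2 * sq z)"
      by (intro ennreal_leI cmod_add_square_le)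
    also have "\<dots> = 2 * ennreal (sq x) + 2 * ennreal (sq z)"
      by (simp add: ennreal_mult)
    finally show "ennreal (sq (x + z)) \<le> 2 * ennreal (sq x) + 2 * ennreal (sq z)" .
  qed
  also have "\<dots> = 2 * (\<integral>\<^sup>+ x. ennreal (sq x) \<partial>Q) + 2 * (\<integral>\<^sup>+ z. ennreal (sq z) \<partial>CN 1)"
    by (simp add: nn_integral_add nn_integral_cmult N1.emeasure_space_1 emeasure_space_1 del: space_Q space_complex_gaussian)
  also have "\<dots> \<le> 2 * ennreal V + 2 * ennreal (4 * 1)"
    by (intro add_mono mult_left_mono power complex_gaussian_second_moment) auto
  also have "\<dots> = ennreal (2 * V + 8)"
  proof -
    have "ennreal (2 * V + 8) = ennreal 2 * ennreal V + ennreal 2 * ennreal 4"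
      using V_nonneg by (subst ennreal_mult[symmetric], simp, simp)+ (subst ennreal_plus[symmetric], auto)
    then show ?thesis by simp
  qed
  finally have le: "(\<integral>\<^sup>+ y. ennreal (smooth Q y * sq y) \<partial>lborel) \<le> ennreal (2 * V + 8)" .
  then show int: "integrable lborel (\<lambda>y. smooth Q y * sq y)"
    by (intro integrableI_nonneg) (auto simp: smooth_nonneg intro: le_less_trans)
  have "(\<integral>\<^sup>+ y. ennreal (smooth Q y * sq y) \<partial>lborel) =
      ennreal (\<integral>y. smooth Q y * sq y \<partial>lborel)"
    by (intro nn_integral_eq_integral int) (auto simp: smooth_nonneg)
  then show "(\<integral>y. smooth Q y * sq y \<partial>lborel) \<le> 2 * V + 8"
    using le V_nonneg by (simp del: ennreal_plus)
qed

text \<open>The inequality |y - x|^2 <= 2 |y|^2 + 2 |x|^2 separates \<open>x\<close> from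
  \<open>y\<close>, and what remains of \<open>x\<close> averages to a positive number. The constant
  depends on \<open>Q\<close>, but it serves integrability only and never enters an entropy
  bound.\<close>

lemma ln_smooth_ge: "\<exists>C. \<forall>y. - ln (smooth Q y) \<le> C + 2 * sq y"
proof -
  have int: "integrable Q (\<lambda>x. exp (- 2 * sq x))"
    by (intro integrable_const_bound[of _ 1]) auto
  have pos: "0 < (\<integral>x. exp (- 2 * sq x) \<partial>Q)"
    by (intro expectation_greater int) simp
  have "- ln (smooth Q y) \<le> ln pi - ln (\<integral>x. exp (- 2 * sq x) \<partial>Q) + 2 * sq y" for y
  proof -
    have "exp (- 2 * sq y) / pi * exp (- 2 * sq x) \<le> gauss_density 1 (y - x)" for x
      using cmod_diff_square_le[of y x]
      by (simp add: gauss_density_def divide_right_mono exp_add[symmetric])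
    then have "(\<integral>x. exp (- 2 * sq y) / pi * exp (- 2 * sq x) \<partial>Q) \<le> smooth Q y"
      unfolding smooth_def using int by (intro integral_mono integrable_gauss) auto
    then have "ln (exp (- 2 * sq y) / pi * (\<integral>x. exp (- 2 * sq x) \<partial>Q)) \<le> ln (smooth Q y)"
      using pos by (intro ln_mono smooth_pos) auto
    then show ?thesis
      using pos by (simp add: ln_mult_pos ln_divide_pos)
  qed
  then show ?thesis by blast
qed

lemma integrable_smooth_ln: "integrable lborel (\<lambda>y. smooth Q y * ln (smooth Q y))"
proof -
  obtain C where C: "\<And>y. - ln (smooth Q y) \<le> C + 2 * sq y"
    using ln_smooth_ge by blast
  show ?thesis
  proof (rule Bochner_Integration.integrable_bound)
    show "integrable lborel (\<lambda>y. C * smooth Q y + 2 * (smooth Q y * sq y))"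
      using integrable_smooth smooth_second_moment(1)
      by (intro Bochner_Integration.integrable_add integrable_mult_right) (auto simp: has_bochner_integral_iff)
    show "AE y in lborel. norm (smooth Q y * ln (smooth Q y)) \<le> norm (C * smooth Q y + 2 * (smooth Q y * sq y))"
    proof (rule AE_I2)
      fix y
      have "norm (smooth Q y * ln (smooth Q y)) = smooth Q y * (- ln (smooth Q y))"
        using ln_smooth_nonpos[of y] smooth_nonneg[of y] by (simp add: abs_mult)
      also have "\<dots> \<le> smooth Q y * (C + 2 * sq y)"
        by (intro mult_left_mono C smooth_nonneg)
      finally show "norm (smooth Q y * ln (smooth Q y)) \<le> norm (C * smooth Q y + 2 * (smooth Q y * sq y))"
        by (simp add: algebra_simps)
    qed
  qed measurable
qed

text \<open>The noise keeps the density below 1 / pi < 1, so the integrand of the entropy is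
  nonnegative.\<close>

lemma diff_entropy_nonneg: "0 \<le> diff_entropy (smooth Q)"
proof -
  have "0 \<le> (\<integral>y. - (smooth Q y * ln (smooth Q y)) \<partial>lborel)"
    using mult_nonneg_nonpos[OF smooth_nonneg ln_smooth_nonpos]
    by (intro Bochner_Integration.integral_nonneg) simp
  then show ?thesis by (simp add: diff_entropy_def)
qed

text \<open>The maximum entropy principle, as the Gibbs inequality against the density of CN(0, v).
  The variance \<open>v\<close> is left free; it becomes the power \<gamma> later, which makes the
  last term bounded.\<close>

lemma diff_entropy_le:
  assumes v: "0 < v"
  shows "diff_entropy (smooth Q) \<le> ln (pi * v) + (2 * V + 8) / v"
proof -
  let ?q = "gauss_density v"
  have q: "has_bochner_integral lborel ?q 1"
    using gauss_density_integral[OF v, of 0] v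
    by (intro has_bochner_integral_nn_integral) (auto simp: gauss_density_pos less_imp_le)
  have u: "integrable lborel (smooth Q)" "(\<integral>y. smooth Q y \<partial>lborel) = 1"
    using integrable_smooth by (auto simp: has_bochner_integral_iff)
  \<comment> \<open>With u the smoothed and q the Gaussian density, the left integrand is u ln q -
    (q - u).\<close>
  have "(\<integral>y. - (1 / v) * (smooth Q y * sq y) - ln (pi * v) * smooth Q y - (?q y - smooth Q y) \<partial>lborel)
      \<le> (\<integral>y. smooth Q y * ln (smooth Q y) \<partial>lborel)"
  proof (rule integral_mono)
    fix y
    have "ln (?q y / smooth Q y) \<le> ?q y / smooth Q y - 1"
      using smooth_pos[of y] gauss_density_pos[OF v, of y] by (intro ln_le_minus_one) simp
    then have "smooth Q y * (ln (?q y) - ln (smooth Q y)) \<le> smooth Q y * (?q y / smooth Q y - 1)"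
      using smooth_pos[of y] gauss_density_pos[OF v, of y]
      by (intro mult_left_mono) (auto simp: ln_divide_pos)
    also have "\<dots> = ?q y - smooth Q y"
      using smooth_pos[of y] by (simp add: field_simps)
    finally show "- (1 / v) * (smooth Q y * sq y) - ln (pi * v) * smooth Q y - (?q y - smooth Q y) \<le>
      smooth Q y * ln (smooth Q y)"
      by (simp add: ln_gauss_density[OF v] algebra_simps)
  qed (use u q smooth_second_moment(1) integrable_smooth_ln in \<open>auto simp: has_bochner_integral_iff\<close>)
  also have "(\<integral>y. - (1 / v) * (smooth Q y * sq y) - ln (pi * v) * smooth Q y - (?q y - smooth Q y) \<partial>lborel)
    = - (1 / v) * (\<integral>y. smooth Q y * sq y \<partial>lborel) - ln (pi * v)"
    using u q smooth_second_moment(1) by (simp add: has_bochner_integral_iff)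
  finally have "diff_entropy (smooth Q) \<le> ln (pi * v) + (\<integral>y. smooth Q y * sq y \<partial>lborel) / v"
    by (simp add: diff_entropy_def)
  also have "\<dots> \<le> ln (pi * v) + (2 * V + 8) / v"
    using smooth_second_moment(2) v by (simp add: divide_right_mono)
  finally show ?thesis .
qed

lemma power_law_distr_scale: "power_law (distr Q borel (\<lambda>x. c * x)) (sq c * V)"
proof -
  interpret D: prob_space "distr Q borel (\<lambda>x. c * x)" by (rule prob_space_distr) measurable
  show ?thesis
  proof
    have "(\<integral>\<^sup>+ x. ennreal (sq x) \<partial>distr Q borel (\<lambda>x. c * x)) =
      (\<integral>\<^sup>+ x. ennreal (sq c) * ennreal (sq x) \<partial>Q)"
      by (subst nn_integral_distr) (auto simp: norm_mult power_mult_distrib ennreal_mult)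
    also have "\<dots> = ennreal (sq c) * (\<integral>\<^sup>+ x. ennreal (sq x) \<partial>Q)"
      by (simp add: nn_integral_cmult)
    also have "\<dots> \<le> ennreal (sq c) * ennreal V"
      by (intro mult_left_mono power) simp
    finally show "(\<integral>\<^sup>+ x. ennreal (sq x) \<partial>distr Q borel (\<lambda>x. c * x)) \<le> ennreal (sq c * V)"
      by (simp add: ennreal_mult V_nonneg)
  qed (auto simp: V_nonneg)
qed

lemma smooth_scale: "smooth (distr Q borel (\<lambda>x. c * x)) y = (\<integral>x. gauss_density 1 (y - c * x) \<partial>Q)"
  unfolding smooth_def by (subst integral_distr) auto

lemma nn_integral_triple:
  assumes F [measurable]: "F \<in> borel_measurable (Q \<Otimes>\<^sub>M CN 1 \<Otimes>\<^sub>M CN 1)"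
  shows "integral\<^sup>N (Q \<Otimes>\<^sub>M CN 1 \<Otimes>\<^sub>M CN 1) F =
    (\<integral>\<^sup>+ x. \<integral>\<^sup>+ z1. \<integral>\<^sup>+ z2. F (x, z1, z2) \<partial>CN 1 \<partial>CN 1 \<partial>Q)"
proof -
  have NN: "prob_space (CN 1 \<Otimes>\<^sub>M CN 1)"
    by (intro prob_space_pair N1.prob_space_axioms)
  show ?thesis
    by (simp add: N1.nn_integral_fst[symmetric]
      sigma_finite_measure.nn_integral_fst[OF prob_space_imp_sigma_finite[OF NN], symmetric])
qed

text \<open>
  Observing \<open>a x + z\<^sub>1\<close> in addition to \<open>b x + z\<^sub>2\<close> gives boundedly many bits, because
  \<open>(a x + z\<^sub>1) - (a / b) (b x + z\<^sub>2)\<close> is pure noise.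
\<close>

lemma diff_entropy_scale_le:
  assumes b: "b \<noteq> 0"
  shows "diff_entropy (smooth (distr Q borel (\<lambda>x. a * x))) \<le>
    diff_entropy (smooth (distr Q borel (\<lambda>x. b * x))) + ln pi + 8 + 8 * sq (a / b)"
proof -
  let ?N = "CN 1" and ?\<phi> = "gauss_density 1"
  let ?M = "Q \<Otimes>\<^sub>M ?N \<Otimes>\<^sub>M ?N"
  define r where "r = a / b"
  interpret A: power_law "distr Q borel (\<lambda>x. a * x)" "sq a * V" by (rule power_law_distr_scale)
  interpret B: power_law "distr Q borel (\<lambda>x. b * x)" "sq b * V" by (rule power_law_distr_scale)
  interpret M: prob_space ?M
    by (intro prob_space_pair N1.prob_space_axioms prob_space_axioms)
  define ua where "ua = smooth (distr Q borel (\<lambda>x. a * x))"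
  define ub where "ub = smooth (distr Q borel (\<lambda>x. b * x))"
  have [measurable]: "ua \<in> borel_measurable borel" "ub \<in> borel_measurable borel"
    by (auto simp: ua_def ub_def)
  note pos = A.smooth_pos[folded ua_def] B.smooth_pos[folded ub_def]
  have law_a: "(\<integral>\<^sup>+ x. \<integral>\<^sup>+ z. F (a * x + z) \<partial>?N \<partial>Q) = (\<integral>\<^sup>+ y. ennreal (ua y) * F y \<partial>lborel)"
    if [measurable]: "F \<in> borel_measurable borel" for F
    using A.smooth_law[OF that] by (subst (asm) nn_integral_distr) (auto simp: ua_def)
  have law_b: "(\<integral>\<^sup>+ x. \<integral>\<^sup>+ z. F (b * x + z) \<partial>?N \<partial>Q) = (\<integral>\<^sup>+ y. ennreal (ub y) * F y \<partial>lborel)"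
    if [measurable]: "F \<in> borel_measurable borel" for F
    using B.smooth_law[OF that] by (subst (asm) nn_integral_distr) (auto simp: ub_def)
  have law_a': "(\<integral>\<^sup>+ (x, z1, z2). F (a * x + z1) \<partial>?M) = (\<integral>\<^sup>+ y. ennreal (ua y) * F y \<partial>lborel)"
    if [measurable]: "F \<in> borel_measurable lborel" for F
    by (simp add: nn_integral_triple N1.emeasure_space_1 law_a del: space_complex_gaussian)
  have law_b': "(\<integral>\<^sup>+ (x, z1, z2). F (b * x + z2) \<partial>?M) = (\<integral>\<^sup>+ y. ennreal (ub y) * F y \<partial>lborel)"
    if [measurable]: "F \<in> borel_measurable lborel" for F
    by (simp add: nn_integral_triple N1.emeasure_space_1 law_b del: space_complex_gaussian)
  have ea: "(\<integral>(x, z1, z2). ln (ua (a * x + z1)) \<partial>?M) = - diff_entropy ua"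
      "integrable ?M (\<lambda>(x, z1, z2). ln (ua (a * x + z1)))"
    using integral_by_law[of "\<lambda>(x, z1, z2). a * x + z1" ?M ua "\<lambda>y. ln (ua y)"]
      law_a' A.integrable_smooth_ln A.smooth_nonneg
    by (auto simp: diff_entropy_def ua_def split_beta')
  have eb: "(\<integral>(x, z1, z2). ln (ub (b * x + z2)) \<partial>?M) = - diff_entropy ub"
      "integrable ?M (\<lambda>(x, z1, z2). ln (ub (b * x + z2)))"
    using integral_by_law[of "\<lambda>(x, z1, z2). b * x + z2" ?M ub "\<lambda>y. ln (ub y)"]
      law_b' B.integrable_smooth_ln B.smooth_nonneg
    by (auto simp: diff_entropy_def ub_def split_beta')
  \<comment> \<open>Put y1 = a x + z1 and y2 = b x + z2. Since r b = a, z1 - r z2 = y1 - r y2, so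
    the numerator is a probability density in (y1, y2): y2 from \<open>ub\<close>, then y1 Gaussian
    around r y2. The denominator is the density of y1 times that of y2 given x.\<close>
  let ?Z = "\<lambda>(x, z1, z2). ub (b * x + z2) * ?\<phi> (z1 - r * z2) / (ua (a * x + z1) * ?\<phi> z2)"
  have "(\<integral>\<^sup>+ w. ennreal (?Z w) \<partial>?M) =
    (\<integral>\<^sup>+ x. \<integral>\<^sup>+ z1. \<integral>\<^sup>+ z2. ennreal (ub (b * x + z2) * ?\<phi> (z1 - r * z2) / (ua (a * x + z1) * ?\<phi> z2)) \<partial>?N \<partial>?N \<partial>Q)"
    by (subst nn_integral_triple) auto
  also have "\<dots> = (\<integral>\<^sup>+ x. \<integral>\<^sup>+ z1. ennreal (1 / ua (a * x + z1)) *
      (\<integral>\<^sup>+ y. ennreal (ub y * ?\<phi> ((a * x + z1) - r * y)) \<partial>lborel) \<partial>?N \<partial>Q)"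
  proof (intro nn_integral_cong)
    fix x z1
    have "(\<integral>\<^sup>+ z2. ennreal (ub (b * x + z2) * ?\<phi> (z1 - r * z2) / (ua (a * x + z1) * ?\<phi> z2)) \<partial>?N) =
      (\<integral>\<^sup>+ z2. (\<lambda>y. ennreal (ub y * ?\<phi> ((a * x + z1) - r * y) / (ua (a * x + z1) * ?\<phi> (y - b * x)))) (b * x + z2) \<partial>?N)"
      using b by (intro nn_integral_cong) (simp add: r_def algebra_simps)
    also have "\<dots> = (\<integral>\<^sup>+ y. ennreal (?\<phi> (y - b * x)) *
        ennreal (ub y * ?\<phi> ((a * x + z1) - r * y) / (ua (a * x + z1) * ?\<phi> (y - b * x))) \<partial>lborel)"
      by (rule nn_integral_complex_gaussian_shift) measurable
    also have "\<dots> = (\<integral>\<^sup>+ y. ennreal (1 / ua (a * x + z1)) * ennreal (ub y * ?\<phi> ((a * x + z1) - r * y)) \<partial>lborel)"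
      using pos(1)[of "a * x + z1"] pos(2) gauss_density_pos[of 1]
      by (intro nn_integral_cong) (auto simp: ennreal_mult[symmetric] less_imp_le less_imp_neq[THEN not_sym])
    finally show "(\<integral>\<^sup>+ z2. ennreal (ub (b * x + z2) * ?\<phi> (z1 - r * z2) / (ua (a * x + z1) * ?\<phi> z2)) \<partial>?N) =
      ennreal (1 / ua (a * x + z1)) * (\<integral>\<^sup>+ y. ennreal (ub y * ?\<phi> ((a * x + z1) - r * y)) \<partial>lborel)"
      by (simp add: nn_integral_cmult)
  qed
  \<comment> \<open>The integrand depends on \<open>x\<close> and \<open>z1\<close> through a x + z1
    only, whose density \<open>ua\<close> cancels its reciprocal.\<close>
  also have "\<dots> = (\<integral>\<^sup>+ y1. ennreal (ua y1) * (ennreal (1 / ua y1) *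
      (\<integral>\<^sup>+ y. ennreal (ub y * ?\<phi> (y1 - r * y)) \<partial>lborel)) \<partial>lborel)"
    by (rule law_a) measurable
  also have "\<dots> = (\<integral>\<^sup>+ y1. \<integral>\<^sup>+ y. ennreal (ub y) * ennreal (?\<phi> (y1 - r * y)) \<partial>lborel \<partial>lborel)"
    using pos gauss_density_pos[of 1]
    by (intro nn_integral_cong) (auto simp: mult.assoc[symmetric] ennreal_mult[symmetric] less_imp_le less_imp_neq[THEN not_sym])
  also have "\<dots> = (\<integral>\<^sup>+ y. \<integral>\<^sup>+ y1. ennreal (ub y) * ennreal (?\<phi> (y1 - r * y)) \<partial>lborel \<partial>lborel)"
    by (rule lborel_pair.Fubini') measurable
  also have "\<dots> = (\<integral>\<^sup>+ y. ennreal (ub y) \<partial>lborel)"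
    by (simp add: nn_integral_cmult gauss_density_integral)
  also have "\<dots> = ennreal 1"
    using B.nn_integral_smooth by (simp add: ub_def)
  finally have Z: "has_bochner_integral ?M ?Z 1"
    using pos gauss_density_pos[of 1]
    by (intro has_bochner_integral_nn_integral) (auto simp: less_imp_le)
  let ?s = "\<lambda>(x :: complex, z1, z2). 2 * sq z1 + 2 * sq r * sq z2"
  have "(\<integral>\<^sup>+ w. ennreal (?s w) \<partial>?M) = (\<integral>\<^sup>+ x. \<integral>\<^sup>+ z1. \<integral>\<^sup>+ z2. 2 * ennreal (sq z1) +
      2 * ennreal (sq r) * ennreal (sq z2) \<partial>?N \<partial>?N \<partial>Q)"
    by (subst nn_integral_triple) (auto simp: ennreal_mult)
  also have "\<dots> = 2 * (\<integral>\<^sup>+ z1. ennreal (sq z1) \<partial>?N) + 2 * ennreal (sq r) * (\<integral>\<^sup>+ z2. ennreal (sq z2) \<partial>?N)"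
    by (simp add: nn_integral_add nn_integral_cmult N1.emeasure_space_1 emeasure_space_1 del: space_Q space_complex_gaussian)
  also have "\<dots> \<le> 2 * ennreal (4 * 1) + 2 * ennreal (sq r) * ennreal (4 * 1)"
    by (intro add_mono mult_left_mono complex_gaussian_second_moment) auto
  also have "\<dots> = ennreal (8 + 8 * sq r)"
  proof -
    have "ennreal (8 + 8 * sq r) = ennreal 2 * ennreal 4 + ennreal 2 * ennreal (sq r) * ennreal 4"
      by (subst ennreal_mult[symmetric], simp, simp)+ (subst ennreal_plus[symmetric], auto)
    then show ?thesis by simp
  qed
  finally have sle: "(\<integral>\<^sup>+ w. ennreal (?s w) \<partial>?M) \<le> ennreal (8 + 8 * sq r)" .
  then have sint: "integrable ?M ?s"
    by (intro integrableI_nonneg) (auto intro: le_less_trans)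
  have "(\<integral>\<^sup>+ w. ennreal (?s w) \<partial>?M) = ennreal (\<integral>w. ?s w \<partial>?M)"
    by (intro nn_integral_eq_integral sint) auto
  with sle have s: "(\<integral>w. ?s w \<partial>?M) \<le> 8 + 8 * sq r"
    by (simp del: ennreal_plus)
  let ?la = "\<lambda>(x, z1, z2 :: complex). ln (ua (a * x + z1))" and ?lb = "\<lambda>(x, z1 :: complex, z2). ln (ub (b * x + z2))"
  \<comment> \<open>ln Z <= Z - 1 is solved for the term with \<open>ub\<close>; \<open>?s\<close>
    bounds |z1 - r z2|^2, and the log-density of the noise at \<open>z2\<close> is at most
    0.\<close>
  have "(\<integral>w. ?lb w \<partial>?M) \<le> (\<integral>w. ?la w + ?s w + ln pi + (?Z w - 1) \<partial>?M)"
  proof (rule integral_mono)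
    fix w :: "complex \<times> complex \<times> complex"
    obtain x z1 z2 where [simp]: "w = (x, z1, z2)" by (cases w)
    have p: "0 < ub (b * x + z2)" "0 < ?\<phi> (z1 - r * z2)" "0 < ua (a * x + z1)" "0 < ?\<phi> z2"
      using pos gauss_density_pos[of 1] by auto
    have "ln (?Z w) \<le> ?Z w - 1"
      using p by (intro ln_le_minus_one) simp
    moreover have "ln (?Z w) = ?lb w + ln (?\<phi> (z1 - r * z2)) - ?la w - ln (?\<phi> z2)"
      using p by (simp add: ln_divide_pos ln_mult_pos)
    moreover have "- ln (?\<phi> (z1 - r * z2)) \<le> ln pi + ?s w"
      using cmod_diff_square_le[of z1 "r * z2"]
      by (simp add: ln_gauss_density norm_mult power_mult_distrib)
    moreover have "ln (?\<phi> z2) \<le> 0"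
      by (rule ln_gauss_density_1_nonpos)
    ultimately show "?lb w \<le> ?la w + ?s w + ln pi + (?Z w - 1)"
      by linarith
  qed (use ea(2) eb(2) sint Z in \<open>auto simp: has_bochner_integral_iff\<close>)
  also have "\<dots> = (\<integral>w. ?la w \<partial>?M) + (\<integral>w. ?s w \<partial>?M) + ln pi"
  proof -
    have "has_bochner_integral ?M (\<lambda>w. ?la w + ?s w + ln pi + (?Z w - 1))
      ((\<integral>w. ?la w \<partial>?M) + (\<integral>w. ?s w \<partial>?M) + ln pi + (1 - 1))"
      using has_bochner_integral_integrable[OF ea(2)] has_bochner_integral_integrable[OF sint] Z
        M.integrable_const[of "ln pi"] M.integrable_const[of "1 :: real"]
      by (intro has_bochner_integral_add has_bochner_integral_diff)
        (auto simp: has_bochner_integral_iff M.prob_space)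
    then show ?thesis by (simp add: has_bochner_integral_iff)
  qed
  finally show ?thesis
    using s ea(1) eb(1) by (simp add: ua_def ub_def r_def)
qed

end

section \<open>Upper bound for the masking capacity\<close>

text \<open>\<open>a\<close> and \<open>b\<close> stand for the gains including the factor
  \<epsilon>^(-1/2). As 0 < \<epsilon> < 1, both mask values occur and sums over the support run
  over all of \<open>bool\<close>; \<open>b\<close> is the denominator in
  \<open>diff_entropy_scale_le\<close>.\<close>

locale masking = power_law P \<gamma> for P :: "complex measure" and \<gamma> :: real +
  fixes \<epsilon> :: real and a b :: complex
  assumes eps: "0 < \<epsilon>" "\<epsilon> < 1" and b: "b \<noteq> 0"
begin

definition out :: "complex \<Rightarrow> complex \<Rightarrow> bool \<Rightarrow> bool \<Rightarrow> complex \<Rightarrow> complex" where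
  "out x1 x2 m1 m2 z = a * of_bool m1 * x1 + b * of_bool m2 * x2 + z"

definition k :: "complex \<Rightarrow> complex \<Rightarrow> bool \<Rightarrow> bool \<Rightarrow> complex \<Rightarrow> real" where
  "k x1 x2 m1 m2 y = gauss_density 1 (y - (a * of_bool m1 * x1 + b * of_bool m2 * x2))"

text \<open>The factor 9 = 3 * 3 comes from dominating 3 |out|^2, where |out|^2 is at most three
  times a sum of three squares.\<close>

definition e :: "complex \<Rightarrow> real" where
  "e x = 9 * (sq a + sq b) * sq x"

sublocale mixture_channel P "CN 1" lborel "bernoulli_pmf \<epsilon>" out k
proof
  show "finite (set_pmf (bernoulli_pmf \<epsilon>))" by (rule finite_subset[of _ UNIV]) auto
  show "(\<lambda>(x1, x2, m1, m2, z). out x1 x2 m1 m2 z) \<in>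
    P \<Otimes>\<^sub>M P \<Otimes>\<^sub>M count_space UNIV \<Otimes>\<^sub>M count_space UNIV \<Otimes>\<^sub>M CN 1 \<rightarrow>\<^sub>M lborel"
    unfolding out_def by measurable
  show "(\<lambda>(x1, x2, m1, m2, y). k x1 x2 m1 m2 y) \<in>
    borel_measurable (P \<Otimes>\<^sub>M P \<Otimes>\<^sub>M count_space UNIV \<Otimes>\<^sub>M count_space UNIV \<Otimes>\<^sub>M lborel)"
    unfolding k_def by measurable
  show "0 < k x1 x2 d1 d2 y" for x1 x2 d1 d2 y
    unfolding k_def by (rule gauss_density_pos) simp
  show "k x1 x2 d1 d2 y \<le> 1" for x1 x2 d1 d2 y
  proof -
    have "1 / pi \<le> 1" using pi_gt3 by simp
    then show ?thesis unfolding k_def using gauss_density_1_le by (rule order_trans[rotated])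
  qed
  show "(\<integral>\<^sup>+ z. F (out x1 x2 d1 d2 z) \<partial>CN 1) = (\<integral>\<^sup>+ y. ennreal (k x1 x2 d1 d2 y) * F y \<partial>lborel)"
    if "F \<in> borel_measurable lborel" for F :: "complex \<Rightarrow> ennreal" and x1 x2 d1 d2
    using that unfolding out_def k_def by (intro nn_integral_complex_gaussian_shift) simp
qed

lemma nn_integral_square: "(\<integral>\<^sup>+ x. ennreal (c * sq x) \<partial>P) < \<infinity>" if "0 \<le> c"
proof -
  have "(\<integral>\<^sup>+ x. ennreal (c * sq x) \<partial>P) = ennreal c * (\<integral>\<^sup>+ x. ennreal (sq x) \<partial>P)"
    using that by (simp add: ennreal_mult nn_integral_cmult)
  also have "\<dots> \<le> ennreal c * ennreal \<gamma>" by (intro mult_left_mono power) simp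
  also have "\<dots> < \<infinity>" by (simp add: ennreal_mult_less_top)
  finally show ?thesis .
qed

lemma of_bool_square_le: "sq (c * of_bool m * x) \<le> sq c * sq x"
  by (cases m) (auto simp: norm_mult power_mult_distrib)

sublocale tame_channel P "CN 1" lborel "bernoulli_pmf \<epsilon>" out k e
    "\<lambda>y. 3 * sq y" "\<lambda>_ _. ln pi"
proof
  have e_meas: "e \<in> borel_measurable P" unfolding e_def by measurable
  note [measurable] = e_meas
  have e_fin: "(\<integral>\<^sup>+ x. ennreal (e x) \<partial>P) < \<infinity>"
    unfolding e_def by (rule nn_integral_square) simp
  show "0 \<le> e x" for x by (simp add: e_def)
  then show "integrable P e"
    using e_fin by (intro integrableI_nonneg) auto
  show "(\<lambda>y. 3 * sq y) \<in> borel_measurable lborel" by measurable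
  show "integrable base_space (\<lambda>(x1, x2, z). 3 * sq (out x1 x2 d1 d2 z))" for d1 d2
  proof (rule integrableI_nonneg)
    have "(\<integral>\<^sup>+ (x1, x2, z). ennreal (3 * sq (out x1 x2 d1 d2 z)) \<partial>base_space) \<le>
      (\<integral>\<^sup>+ (x1, x2, z). ennreal (e x1) + ennreal (e x2) + ennreal (9 * sq z) \<partial>base_space)"
    proof (rule nn_integral_mono)
      fix w :: "complex \<times> complex \<times> complex"
      obtain x1 x2 z where w: "w = (x1, x2, z)" by (cases w)
      have "3 * sq (out x1 x2 d1 d2 z) \<le>
        9 * sq (a * of_bool d1 * x1) + 9 * sq (b * of_bool d2 * x2) + 9 * sq z"
        unfolding out_def using cmod_add3_square_le[of "a * of_bool d1 * x1" "b * of_bool d2 * x2" z] by linarith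
      also have "\<dots> \<le> 9 * (sq a * sq x1) + 9 * (sq b * sq x2) + 9 * sq z"
        by (intro add_mono mult_left_mono of_bool_square_le) auto
      also have "\<dots> \<le> e x1 + e x2 + 9 * sq z"
        by (simp add: e_def algebra_simps)
      finally show "(case w of (x1, x2, z) \<Rightarrow> ennreal (3 * sq (out x1 x2 d1 d2 z))) \<le>
        (case w of (x1, x2, z) \<Rightarrow> ennreal (e x1) + ennreal (e x2) + ennreal (9 * sq z))"
        using \<open>\<And>x. 0 \<le> e x\<close> by (auto simp: w ennreal_plus[symmetric] intro!: ennreal_leI simp del: ennreal_plus)
    qed
    also have "\<dots> = (\<integral>\<^sup>+ x. ennreal (e x) \<partial>P) + (\<integral>\<^sup>+ x. ennreal (e x) \<partial>P) +
        (\<integral>\<^sup>+ z. ennreal (9 * sq z) \<partial>CN 1)"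
      by (subst nn_integral_base_space)
        (simp_all add: nn_integral_add N1.emeasure_space_1 emeasure_space_1 del: space_Q space_complex_gaussian)
    also have "\<dots> < \<infinity>"
    proof -
      have "(\<integral>\<^sup>+ z. ennreal (9 * sq z) \<partial>CN 1) = 9 * (\<integral>\<^sup>+ z. ennreal (sq z) \<partial>CN 1)"
        by (simp add: ennreal_mult nn_integral_cmult)
      also have "\<dots> \<le> 9 * ennreal (4 * 1)"
        by (intro mult_left_mono complex_gaussian_second_moment) auto
      also have "\<dots> < \<infinity>" by (simp add: ennreal_mult_less_top)
      finally show ?thesis using e_fin by simp
    qed
    finally show "(\<integral>\<^sup>+ w. ennreal (case w of (x1, x2, z) \<Rightarrow> 3 * sq (out x1 x2 d1 d2 z)) \<partial>base_space) < \<infinity>"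
      by (simp add: split_beta')
    show "(\<lambda>(x1, x2, z). 3 * sq (out x1 x2 d1 d2 z)) \<in> borel_measurable base_space"
      unfolding out_def by measurable
  qed auto
  show "- ln (k x1 x2 d1 d2 y) \<le> ln pi + e x1 + e x2 + 3 * sq y" for x1 x2 d1 d2 y
  proof -
    have "sq (y - (a * of_bool d1 * x1 + b * of_bool d2 * x2)) \<le>
      3 * sq y + 3 * sq (a * of_bool d1 * x1) + 3 * sq (b * of_bool d2 * x2)"
      using cmod_add3_square_le[of y "- (a * of_bool d1 * x1)" "- (b * of_bool d2 * x2)"]
      by (simp only: norm_minus_cancel) (simp add: algebra_simps)
    also have "\<dots> \<le> 3 * sq y + 9 * (sq a * sq x1) + 9 * (sq b * sq x2)"
      by (intro add_mono mult_mono of_bool_square_le) auto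
    also have "\<dots> \<le> e x1 + e x2 + 3 * sq y"
      by (simp add: e_def algebra_simps)
    finally show ?thesis
      by (simp add: k_def ln_gauss_density)
  qed
qed

section \<open>Entropies of the mask patterns\<close>

sublocale A: power_law "distr P borel (\<lambda>x. a * x)" "sq a * \<gamma>" by (rule power_law_distr_scale)
sublocale B: power_law "distr P borel (\<lambda>x. b * x)" "sq b * \<gamma>" by (rule power_law_distr_scale)
sublocale PP: pair_prob_space P P ..

definition sum_law where "sum_law = distr (P \<Otimes>\<^sub>M P) borel (\<lambda>(x1, x2). a * x1 + b * x2)"

lemma power_law_sum: "power_law sum_law (2 * (sq a + sq b) * \<gamma>)"
proof -
  interpret S: prob_space sum_law
    unfolding sum_law_def by (rule PP.prob_space_distr) measurable
  show ?thesis
  proof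
    have "(\<integral>\<^sup>+ x. ennreal (sq x) \<partial>sum_law) = (\<integral>\<^sup>+ x1. \<integral>\<^sup>+ x2. ennreal (sq (a * x1 + b * x2)) \<partial>P \<partial>P)"
      unfolding sum_law_def by (subst nn_integral_distr) (auto simp: nn_integral_fst[symmetric] split_beta')
    also have "\<dots> \<le> (\<integral>\<^sup>+ x1. \<integral>\<^sup>+ x2. ennreal (2 * sq a) * ennreal (sq x1) +
        ennreal (2 * sq b) * ennreal (sq x2) \<partial>P \<partial>P)"
    proof (intro nn_integral_mono)
      fix x1 x2
      have "ennreal (sq (a * x1 + b * x2)) \<le> ennreal (2 * sq a * sq x1 + 2 * sq b * sq x2)"
        using cmod_add_square_le[of "a * x1" "b * x2"]
        by (intro ennreal_leI) (simp add: norm_mult power_mult_distrib)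
      then show "ennreal (sq (a * x1 + b * x2)) \<le> ennreal (2 * sq a) * ennreal (sq x1) +
        ennreal (2 * sq b) * ennreal (sq x2)"
        by (simp add: ennreal_mult[symmetric] ennreal_plus[symmetric] del: ennreal_plus)
    qed
    also have "\<dots> = ennreal (2 * sq a) * (\<integral>\<^sup>+ x. ennreal (sq x) \<partial>P) +
        ennreal (2 * sq b) * (\<integral>\<^sup>+ x. ennreal (sq x) \<partial>P)"
      by (simp add: nn_integral_add nn_integral_cmult emeasure_space_1 del: space_Q)
    also have "\<dots> \<le> ennreal (2 * sq a) * ennreal \<gamma> + ennreal (2 * sq b) * ennreal \<gamma>"
      by (intro add_mono mult_left_mono power) auto
    also have "\<dots> = ennreal (2 * (sq a + sq b) * \<gamma>)"
      using V_nonneg by (simp add: ennreal_mult[symmetric] ennreal_plus[symmetric] algebra_simps del: ennreal_plus)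
    finally show "(\<integral>\<^sup>+ x. ennreal (sq x) \<partial>sum_law) \<le> ennreal (2 * (sq a + sq b) * \<gamma>)" .
  qed (auto simp: sum_law_def V_nonneg)
qed

sublocale S: power_law sum_law "2 * (sq a + sq b) * \<gamma>" by (rule power_law_sum)

lemma expectation_ln_g_cond:
  "mean_ln_g_cond d1 d2 = - diff_entropy (g_cond d1 d2)"
proof -
  have law: "(\<integral>\<^sup>+ w. F ((\<lambda>(x1, x2, z). out x1 x2 d1 d2 z) w) \<partial>base_space) =
      (\<integral>\<^sup>+ y. ennreal (g_cond d1 d2 y) * F y \<partial>lborel)"
    if "F \<in> borel_measurable lborel" for F :: "complex \<Rightarrow> ennreal"
    using nn_integral_base_out'[OF that, of d1 d2] by (simp add: split_beta')
  have "(\<integral>w. ln (g_cond d1 d2 ((\<lambda>(x1, x2, z). out x1 x2 d1 d2 z) w)) \<partial>base_space) =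
    (\<integral>y. g_cond d1 d2 y * ln (g_cond d1 d2 y) \<partial>lborel)"
  proof (rule integral_by_law(1)[OF _ _ _ law])
    show "(\<lambda>(x1, x2, z). out x1 x2 d1 d2 z) \<in> base_space \<rightarrow>\<^sub>M lborel"
      unfolding out_def by measurable
  qed (auto simp: g_cond_nonneg)
  then show ?thesis by (simp add: diff_entropy_def split_beta')
qed

text \<open>With the first mask off the input leaves no trace, so these patterns carry no
  information. With only the second mask off the residual given \<open>x1\<close> is pure noise, and
  with both on it is b x2 + z.\<close>

lemma h_False: "h x1 False d2 y = g_cond False d2 y"
  by (simp add: g_cond_def h_def k_def prob_space del: space_Q)

lemma h_True_False: "h x1 True False (out x1 x2 True False z) = gauss_density 1 z"
  by (simp add: h_def k_def out_def prob_space del: space_Q)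

lemma h_True_True: "h x1 True True (out x1 x2 True True z) = smooth (distr P borel (\<lambda>x. b * x)) (b * x2 + z)"
  by (simp add: h_def k_def out_def smooth_scale add_diff_eq)

lemma g_cond_True_False: "g_cond True False = smooth (distr P borel (\<lambda>x. a * x))"
  by (simp add: fun_eq_iff g_cond_def h_def k_def smooth_scale prob_space del: space_Q)

lemma g_cond_True_True: "g_cond True True = smooth sum_law"
proof
  fix y
  have int: "integrable (P \<Otimes>\<^sub>M P) (\<lambda>(x1, x2). gauss_density 1 (y - (a * x1 + b * x2)))"
    using gauss_density_1_le
    by (intro PP.integrable_const_bound[of _ "1 / pi"]) (auto simp: gauss_density_pos less_imp_le)
  have "smooth sum_law y = (\<integral>(x1, x2). gauss_density 1 (y - (a * x1 + b * x2)) \<partial>(P \<Otimes>\<^sub>M P))"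
    unfolding smooth_def sum_law_def by (subst integral_distr) (auto simp: split_beta')
  also have "\<dots> = g_cond True True y"
    using PP.integral_fst'[OF int] by (simp add: g_cond_def h_def k_def)
  finally show "g_cond True True y = smooth sum_law y" ..
qed

lemma expectation_ln_h_True_True:
  "(\<integral>(x1, x2, z). ln (h x1 True True (out x1 x2 True True z)) \<partial>base_space) =
    - diff_entropy (smooth (distr P borel (\<lambda>x. b * x)))"
proof -
  have law: "(\<integral>\<^sup>+ w. F ((\<lambda>(x1, x2, z). b * x2 + z) w) \<partial>base_space) =
      (\<integral>\<^sup>+ y. ennreal (smooth (distr P borel (\<lambda>x. b * x)) y) * F y \<partial>lborel)"
    if [measurable]: "F \<in> borel_measurable lborel" for F :: "complex \<Rightarrow> ennreal"
  proof -
    have "(\<integral>\<^sup>+ (x1, x2, z). F (b * x2 + z) \<partial>base_space) = (\<integral>\<^sup>+ x2. \<integral>\<^sup>+ z. F (b * x2 + z) \<partial>CN 1 \<partial>P)"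
      by (subst nn_integral_base_space) (simp_all add: emeasure_space_1 del: space_Q)
    also have "\<dots> = (\<integral>\<^sup>+ y. ennreal (smooth (distr P borel (\<lambda>x. b * x)) y) * F y \<partial>lborel)"
    proof -
      have "(\<integral>\<^sup>+ x2. \<integral>\<^sup>+ z. F (b * x2 + z) \<partial>CN 1 \<partial>P) =
        (\<integral>\<^sup>+ x. \<integral>\<^sup>+ z. F (x + z) \<partial>CN 1 \<partial>distr P borel (\<lambda>x. b * x))"
        by (subst nn_integral_distr) auto
      then show ?thesis using B.smooth_law[of F] by simp
    qed
    finally show ?thesis by (simp add: split_beta')
  qed
  show ?thesis
    using integral_by_law(1)[OF _ _ _ law, of "\<lambda>y. ln (smooth (distr P borel (\<lambda>x. b * x)) y)"]
    by (simp add: diff_entropy_def h_True_True split_beta' B.smooth_nonneg)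
qed

text \<open>The entropy of the noise is subtracted in the information, so its sign is all that an
  upper bound requires.\<close>

lemma expectation_ln_h_True_False:
  "(\<integral>(x1, x2, z). ln (h x1 True False (out x1 x2 True False z)) \<partial>base_space) \<le> 0"
proof -
  have "0 \<le> (\<integral>w. - (case w of (x1, x2, z) \<Rightarrow> ln (gauss_density 1 z)) \<partial>base_space)"
    using ln_gauss_density_1_nonpos
    by (intro Bochner_Integration.integral_nonneg) (auto simp: split_beta')
  then show ?thesis by (simp add: h_True_False split_beta')
qed

text \<open>From ln (1 / p) <= 1 / p - 1. Summed over the four mask patterns this gives the 4 in
  \<open>information_le\<close>.\<close>

lemma pmf_product_entropy_le: "- (pmf (bernoulli_pmf \<epsilon>) d1 * pmf (bernoulli_pmf \<epsilon>) d2 * ln (pmf (bernoulli_pmf \<epsilon>) d1 * pmf (bernoulli_pmf \<epsilon>) d2)) \<le> 1"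
proof -
  define p where "p = pmf (bernoulli_pmf \<epsilon>) d1 * pmf (bernoulli_pmf \<epsilon>) d2"
  have p: "0 < p"
    using eps by (cases d1; cases d2) (auto simp: p_def)
  have "ln (1 / p) \<le> 1 / p - 1" using p by (intro ln_le_minus_one) simp
  then have "- ln p \<le> 1 / p - 1" using p by (simp add: ln_divide_pos)
  then have "p * (- ln p) \<le> p * (1 / p - 1)" using p by (intro mult_left_mono) auto
  also have "\<dots> \<le> 1" using p by (simp add: field_simps)
  finally show ?thesis unfolding p_def[symmetric] by simp
qed

definition information where
  "information = prob_space.mutual_information full_space 2 (borel \<Otimes>\<^sub>M count_space UNIV) borel
      channel_input channel_output"

lemma information_le:
  "ln 2 * information \<le> \<epsilon> * (1 - \<epsilon>) * diff_entropy (smooth (distr P borel (\<lambda>x. a * x))) +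
    \<epsilon>\<^sup>2 * (diff_entropy (smooth sum_law) - diff_entropy (smooth (distr P borel (\<lambda>x. b * x)))) + 4"
proof -
  have *: "sets (borel \<Otimes>\<^sub>M count_space UNIV) = sets (P \<Otimes>\<^sub>M count_space (UNIV :: bool set))"
    by (intro sets_pair_measure_cong) (auto simp: sets_Q)
  define J where "J d1 d2 = mean_ln_h d1 d2 -
    mean_ln_g_cond d1 d2" for d1 d2
  let ?p = "pmf (bernoulli_pmf \<epsilon>)"
  have J: "J False d2 = 0" "J True False \<le> diff_entropy (smooth (distr P borel (\<lambda>x. a * x)))"
    "J True True = diff_entropy (smooth sum_law) - diff_entropy (smooth (distr P borel (\<lambda>x. b * x)))" for d2
    using expectation_ln_h_True_False
    by (simp_all add: J_def h_False expectation_ln_g_cond expectation_ln_h_True_True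
      g_cond_True_True[symmetric] g_cond_True_False[symmetric])
  have sum2: "(\<Sum>d\<in>(UNIV :: bool set). F d) = F True + F False" for F :: "bool \<Rightarrow> real"
    by (simp add: UNIV_bool)
  have "ln 2 * information \<le> (\<Sum>d1\<in>UNIV. \<Sum>d2\<in>UNIV. ?p d1 * ?p d2 * (J d1 d2 - ln (?p d1 * ?p d2)))"
    using mutual_information_le[of 2, OF _ *, of borel] eps
    by (simp add: information_def J_def)
  also have "\<dots> = (\<Sum>d1\<in>UNIV. \<Sum>d2\<in>UNIV. ?p d1 * ?p d2 * J d1 d2 + - (?p d1 * ?p d2 * ln (?p d1 * ?p d2)))"
    by (simp add: algebra_simps)
  also have "\<dots> \<le> (\<Sum>d1\<in>UNIV. \<Sum>d2\<in>UNIV. ?p d1 * ?p d2 * J d1 d2 + 1)"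
    by (intro sum_mono add_left_mono pmf_product_entropy_le)
  also have "\<dots> = \<epsilon> * (1 - \<epsilon>) * J True False + \<epsilon>\<^sup>2 * J True True + 4"
    using eps by (simp add: sum2 J power2_eq_square)
  also have "\<dots> \<le> \<epsilon> * (1 - \<epsilon>) * diff_entropy (smooth (distr P borel (\<lambda>x. a * x))) +
    \<epsilon>\<^sup>2 * (diff_entropy (smooth sum_law) - diff_entropy (smooth (distr P borel (\<lambda>x. b * x)))) + 4"
    using J eps by (intro add_mono mult_left_mono) auto
  finally show ?thesis .
qed

end

text \<open>The bound depends neither on \<open>P\<close> nor on \<epsilon>: the lower limit 1 / 8
  keeps the squared moduli of the scaled gains within a factor 8 of the given ones, and the upper
  limit 3 / 5 keeps the coefficients at most 9 / 25.\<close>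

lemma masking_information_le:
  assumes P: "P \<in> power_constrained_laws \<gamma>" and g: "1 \<le> \<gamma>"
    and eps_bounds: "1 / 8 < \<epsilon>" "\<epsilon> < 3 / 5" and h: "h21 \<noteq> 0"
  shows "ln 2 * masking_information \<epsilon> h11 h21 P \<le>
    9 / 25 * (ln \<gamma> + ln pi + 32 * (sq h11 + sq h21) + 8) + ln pi + 8 * sq (h11 / h21) + 12"
proof -
  define a where "a = of_real (\<epsilon> powr (- 1 / 2)) * h11"
  define b where "b = of_real (\<epsilon> powr (- 1 / 2)) * h21"
  interpret P: prob_space P using P by (simp add: power_constrained_laws_def)
  interpret masking P \<gamma> \<epsilon> a b
    using P eps_bounds h g by unfold_locales (auto simp: power_constrained_laws_def b_def)
  have info: "masking_information \<epsilon> h11 h21 P = information"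
    unfolding masking_information_def masking_space_def masking_output_def information_def out_def
    by (simp only: a_def b_def)
  have sq: "(\<epsilon> powr (- 1 / 2))\<^sup>2 = 1 / \<epsilon>"
    using eps_bounds by (simp add: power2_eq_square powr_add[symmetric] powr_minus_divide)
  have "1 / \<epsilon> \<le> 8" using eps_bounds by (simp add: field_simps)
  then have "(\<epsilon> powr - (1 / 2))\<^sup>2 \<le> 8" using sq by simp
  then have ab: "sq a \<le> 8 * sq h11" "sq b \<le> 8 * sq h21"
    by (auto simp: a_def b_def norm_mult power_mult_distrib intro!: mult_right_mono)
  have quotient: "a / b = h11 / h21"
    using eps_bounds by (simp add: a_def b_def)
  define T where "T = diff_entropy (smooth (distr P borel (\<lambda>x. b * x)))"
  define L where "L = ln \<gamma> + ln pi + 32 * (sq h11 + sq h21) + 8"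
  define c where "c = ln pi + 8 + 8 * sq (h11 / h21)"
  have "0 \<le> ln pi" using pi_gt3 by (intro ln_ge_zero) simp
  then have c: "0 \<le> c" by (simp add: c_def)
  have T0: "0 \<le> T" unfolding T_def by (rule B.diff_entropy_nonneg)
  have ln_mult_pi: "ln (pi * \<gamma>) = ln \<gamma> + ln pi" using g by (simp add: ln_mult_pos)
  have g0: "0 < \<gamma>" using g by simp
  \<comment> \<open>The maximum entropy bound with v = \<gamma>: the power of b x is at most a
    constant times \<gamma>, so the quotient stays bounded. The bound for \<open>sum_law\<close> is
    obtained in the same way.\<close>
  have TL: "T \<le> L"
  proof -
    have "(2 * (sq b * \<gamma>) + 8) / \<gamma> \<le> 2 * sq b + 8"
      using g by (simp add: field_simps)
    then have "T \<le> ln \<gamma> + ln pi + (2 * sq b + 8)"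
      using B.diff_entropy_le[OF g0] unfolding T_def ln_mult_pi by (meson add_left_mono order_trans)
    then show ?thesis
    proof -
      have "2 * sq b \<le> 16 * sq h21" using ab(2) by simp
      also have "\<dots> \<le> 32 * (sq h11 + sq h21)" by simp
      finally show ?thesis using \<open>T \<le> ln \<gamma> + ln pi + (2 * sq b + 8)\<close> unfolding L_def by linarith
    qed
  qed
  have SL: "diff_entropy (smooth sum_law) \<le> L"
  proof -
    have "(2 * (2 * (sq a + sq b) * \<gamma>) + 8) / \<gamma> \<le> 4 * (sq a + sq b) + 8"
      using g by (simp add: field_simps)
    then have "diff_entropy (smooth sum_law) \<le> ln \<gamma> + ln pi + (4 * (sq a + sq b) + 8)"
      using S.diff_entropy_le[OF g0] unfolding ln_mult_pi by (meson add_left_mono order_trans)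
    moreover have "4 * (sq a + sq b) \<le> 4 * (8 * sq h11 + 8 * sq h21)"
      by (intro mult_left_mono add_mono ab) simp
    moreover have "4 * (8 * sq h11 + 8 * sq h21) = 32 * (sq h11 + sq h21)"
      by simp
    ultimately show ?thesis unfolding L_def by linarith
  qed
  have A: "diff_entropy (smooth (distr P borel (\<lambda>x. a * x))) \<le> T + c"
    using diff_entropy_scale_le[OF b, of a] by (simp add: T_def c_def quotient)
  have e1: "0 \<le> \<epsilon> * (1 - \<epsilon>)" "\<epsilon> * (1 - \<epsilon>) \<le> 9 / 25" "\<epsilon> * (1 - \<epsilon>) \<le> 1"
  proof -
    show "0 \<le> \<epsilon> * (1 - \<epsilon>)" using eps_bounds by simp
    have "\<epsilon> * (1 - \<epsilon>) = 1 / 4 - (\<epsilon> - 1 / 2)\<^sup>2" by (simp add: power2_eq_square algebra_simps)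
    then have "\<epsilon> * (1 - \<epsilon>) \<le> 1 / 4" by simp
    then show "\<epsilon> * (1 - \<epsilon>) \<le> 9 / 25" "\<epsilon> * (1 - \<epsilon>) \<le> 1" by linarith+
  qed
  have e2: "\<epsilon>\<^sup>2 \<le> 9 / 25"
    using power_mono[of \<epsilon> "3 / 5" 2] eps_bounds by (simp add: power2_eq_square)
  have "ln 2 * information \<le> \<epsilon> * (1 - \<epsilon>) * (T + c) + \<epsilon>\<^sup>2 * (L - T) + 4"
    using information_le A SL e1(1)
    by (intro order_trans[OF information_le] add_mono mult_left_mono) (auto simp: T_def)
  also have "\<dots> = \<epsilon> * (1 - \<epsilon>) * T + \<epsilon> * (1 - \<epsilon>) * c + \<epsilon>\<^sup>2 * (L - T) + 4"
    by (simp add: algebra_simps)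
  \<comment> \<open>\<open>T\<close> depends on the arbitrary law and is only known to lie in
    [0, L]. As \<open>T\<close> and \<open>L - T\<close> are both nonnegative, replacing both
    coefficients by 9 / 25 makes it cancel.\<close>
  also have "\<dots> \<le> 9 / 25 * T + 1 * c + 9 / 25 * (L - T) + 4"
    using e1 e2 T0 TL c by (intro add_mono mult_right_mono) auto
  also have "\<dots> = 9 / 25 * L + c + 4" by (simp add: field_simps)
  finally show ?thesis unfolding info L_def c_def by simp
qed

text \<open>The preceding bound is free of the law and therefore passes to the supremum.\<close>

lemma masking_capacity_le:
  assumes g: "1 \<le> \<gamma>" and eps: "1 / 8 < \<epsilon>" "\<epsilon> < 3 / 5" and h: "h21 \<noteq> 0"
  shows "masking_capacity \<epsilon> \<gamma> h11 h21 \<le>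
    ereal ((9 / 25 * (ln \<gamma> + ln pi + 32 * (sq h11 + sq h21) + 8) + ln pi +
      8 * sq (h11 / h21) + 12) / ln 2)"
  unfolding masking_capacity_def
  using masking_information_le[OF _ assms, of _ h11]
  by (intro SUP_least) (simp add: field_simps)

section \<open>Gaussian vectors and quadratic exponents\<close>

text \<open>The translated noise and the measure with the product density agree on boxes with the
  product of the shifted Gaussian laws, and boxes determine a finite product.\<close>

lemma nn_integral_PiM_complex_gaussian_shift:
  fixes c :: "'i \<Rightarrow> complex"
  assumes fin [simp]: "finite I"
  assumes F [measurable]: "F \<in> borel_measurable (PiM I (\<lambda>_. lborel :: complex measure))"
  shows "(\<integral>\<^sup>+ z. F (\<lambda>i\<in>I. c i + z i) \<partial>PiM I (\<lambda>_. CN 1)) =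
    (\<integral>\<^sup>+ y. ennreal (\<Prod>i\<in>I. gauss_density 1 (y i - c i)) * F y \<partial>PiM I (\<lambda>_. lborel))"
proof -
  let ?N = "CN 1" and ?L = "PiM I (\<lambda>_. lborel :: complex measure)"
  let ?d = "\<lambda>i y. ennreal (gauss_density 1 (y - c i))"
  let ?D = "\<lambda>i. density lborel (?d i)"
  have D: "prob_space (?D i)" for i
    using gauss_density_integral[of 1 "c i"] by (intro prob_spaceI) (simp add: emeasure_density)
  have N: "prob_space ?N" by (rule prob_space_complex_gaussian) simp
  interpret D: product_sigma_finite ?D
    using D by (simp add: product_sigma_finite_def prob_space_imp_sigma_finite)
  interpret N: product_sigma_finite "\<lambda>_. ?N"
    using N by (simp add: product_sigma_finite_def prob_space_imp_sigma_finite)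
  interpret L: product_sigma_finite "\<lambda>_. lborel :: complex measure" ..
  have sets_D: "sets (PiM I ?D) = sets ?L" by (intro sets_PiM_cong) auto
  \<comment> \<open>Extensionality matters: a point of the box must also be \<open>undefined\<close>
    outside \<open>I\<close>. The restriction in the integrand on the left guarantees this.\<close>
  have ind: "indicator (Pi\<^sub>E I A) y = (\<Prod>i\<in>I. indicator (A i) (y i) :: ennreal)" if "y \<in> extensional I" for A and y :: "'i \<Rightarrow> complex"
    using that by (auto simp: indicator_def PiE_iff)
  define T where "T z = (\<lambda>i\<in>I. c i + z i)" for z :: "'i \<Rightarrow> complex"
  have T [measurable]: "T \<in> PiM I (\<lambda>_. ?N) \<rightarrow>\<^sub>M ?L" unfolding T_def by measurable
  have "distr (PiM I (\<lambda>_. ?N)) ?L T = PiM I ?D"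
  proof (rule D.PiM_eqI)
    fix A assume A: "\<And>i. i \<in> I \<Longrightarrow> A i \<in> sets (?D i)"
    then have A' [measurable]: "\<And>i. i \<in> I \<Longrightarrow> A i \<in> sets borel" by simp
    have "Pi\<^sub>E I A \<in> sets ?L" using A' by (intro sets_PiM_I_finite) auto
    then have "emeasure (distr (PiM I (\<lambda>_. ?N)) ?L T) (Pi\<^sub>E I A) =
        (\<integral>\<^sup>+ y. indicator (Pi\<^sub>E I A) y \<partial>distr (PiM I (\<lambda>_. ?N)) ?L T)"
      by (intro nn_integral_indicator[symmetric]) simp
    also have "\<dots> = (\<integral>\<^sup>+ z. indicator (Pi\<^sub>E I A) (T z) \<partial>PiM I (\<lambda>_. ?N))"
      using \<open>Pi\<^sub>E I A \<in> sets ?L\<close> by (intro nn_integral_distr) auto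
    also have "\<dots> = (\<integral>\<^sup>+ z. (\<Prod>i\<in>I. indicator (A i) (c i + z i)) \<partial>PiM I (\<lambda>_. ?N))"
      by (intro nn_integral_cong) (simp add: ind T_def)
    also have "\<dots> = (\<Prod>i\<in>I. \<integral>\<^sup>+ z. indicator (A i) (c i + z) \<partial>?N)"
      by (rule N.product_nn_integral_prod) auto
    also have "\<dots> = (\<Prod>i\<in>I. emeasure (?D i) (A i))"
      by (intro prod.cong refl, subst nn_integral_complex_gaussian_shift[of "indicator _"])
        (auto simp: emeasure_density)
    finally show "emeasure (distr (PiM I (\<lambda>_. ?N)) ?L T) (Pi\<^sub>E I A) = (\<Prod>i\<in>I. emeasure (?D i) (A i))" .
  qed (simp_all add: sets_D)
  moreover have "density ?L (\<lambda>y. \<Prod>i\<in>I. ?d i (y i)) = PiM I ?D"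
  proof (rule D.PiM_eqI)
    fix A assume A: "\<And>i. i \<in> I \<Longrightarrow> A i \<in> sets (?D i)"
    then have A' [measurable]: "\<And>i. i \<in> I \<Longrightarrow> A i \<in> sets borel" by simp
    have "Pi\<^sub>E I A \<in> sets ?L" using A' by (intro sets_PiM_I_finite) auto
    then have "emeasure (density ?L (\<lambda>y. \<Prod>i\<in>I. ?d i (y i))) (Pi\<^sub>E I A) =
        (\<integral>\<^sup>+ y. (\<Prod>i\<in>I. ?d i (y i)) * indicator (Pi\<^sub>E I A) y \<partial>?L)"
      by (intro emeasure_density) auto
    also have "\<dots> = (\<integral>\<^sup>+ y. (\<Prod>i\<in>I. ?d i (y i) * indicator (A i) (y i)) \<partial>?L)"
      by (intro nn_integral_cong) (simp add: ind prod.distrib space_PiM PiE_iff)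
    also have "\<dots> = (\<Prod>i\<in>I. \<integral>\<^sup>+ y. ?d i y * indicator (A i) y \<partial>lborel)"
      by (rule L.product_nn_integral_prod) auto
    also have "\<dots> = (\<Prod>i\<in>I. emeasure (?D i) (A i))"
      by (intro prod.cong refl) (auto simp: emeasure_density)
    finally show "emeasure (density ?L (\<lambda>y. \<Prod>i\<in>I. ?d i (y i))) (Pi\<^sub>E I A) = (\<Prod>i\<in>I. emeasure (?D i) (A i))" .
  qed (simp_all add: sets_D)
  ultimately have eq: "distr (PiM I (\<lambda>_. ?N)) ?L T = density ?L (\<lambda>y. \<Prod>i\<in>I. ?d i (y i))"
    by simp
  have "(\<integral>\<^sup>+ z. F (T z) \<partial>PiM I (\<lambda>_. ?N)) = (\<integral>\<^sup>+ y. F y \<partial>distr (PiM I (\<lambda>_. ?N)) ?L T)"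
    by (intro nn_integral_distr[symmetric]) measurable
  also have "\<dots> = (\<integral>\<^sup>+ y. (\<Prod>i\<in>I. ?d i (y i)) * F y \<partial>?L)"
    unfolding eq by (rule nn_integral_density) measurable
  also have "\<dots> = (\<integral>\<^sup>+ y. ennreal (\<Prod>i\<in>I. gauss_density 1 (y i - c i)) * F y \<partial>?L)"
    by (simp add: prod_ennreal gauss_density_pos less_imp_le)
  finally show ?thesis by (simp add: T_def)
qed

lemma cmod_diff_square: "sq (u - v) = sq u + sq v - 2 * Re (cnj v * u)"
  by (simp add: cmod_power2) (simp add: power2_eq_square algebra_simps)

text \<open>\<open>p\<close> is the precision of the prior for \<open>x\<close>: 1 / \<gamma> for
  the Gaussian input and 0 for Lebesgue measure.\<close>

lemma complete_square:
  fixes w0 w1 \<alpha>0 \<alpha>1 x :: complex and p :: real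
  defines "S \<equiv> p + sq \<alpha>0 + sq \<alpha>1" and "B \<equiv> cnj \<alpha>0 * w0 + cnj \<alpha>1 * w1"
  assumes S: "0 < S"
  shows "p * sq x + sq (w0 - \<alpha>0 * x) + sq (w1 - \<alpha>1 * x) =
    S * sq (x - B / of_real S) + (sq w0 + sq w1 - sq B / S)"
proof -
  have 1: "sq (x - B / of_real S) = sq x + sq B / S\<^sup>2 - 2 * Re (cnj B * x) / S"
    using S by (simp add: cmod_diff_square norm_divide power_divide)
  have "S * sq (x - B / of_real S) = S * sq x + sq B / S - 2 * Re (cnj B * x)"
    using S unfolding 1 by (simp add: field_simps power2_eq_square)
  moreover have "sq (w0 - \<alpha>0 * x) = sq w0 + sq \<alpha>0 * sq x - 2 * Re (cnj \<alpha>0 * cnj x * w0)"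
    "sq (w1 - \<alpha>1 * x) = sq w1 + sq \<alpha>1 * sq x - 2 * Re (cnj \<alpha>1 * cnj x * w1)"
    by (simp_all add: cmod_diff_square norm_mult power_mult_distrib)
  moreover have "Re (cnj B * x) = Re (cnj \<alpha>0 * cnj x * w0) + Re (cnj \<alpha>1 * cnj x * w1)"
    by (simp add: B_def algebra_simps)
  ultimately show ?thesis
    by (simp add: S_def algebra_simps)
qed

lemma nn_integral_exp_quadratic:
  fixes w0 w1 \<alpha>0 \<alpha>1 :: complex and p :: real
  defines "S \<equiv> p + sq \<alpha>0 + sq \<alpha>1" and "B \<equiv> cnj \<alpha>0 * w0 + cnj \<alpha>1 * w1"
  assumes S: "0 < S"
  shows "(\<integral>\<^sup>+ x. ennreal (exp (- (p * sq x + sq (w0 - \<alpha>0 * x) + sq (w1 - \<alpha>1 * x)))) \<partial>lborel) =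
    ennreal (pi / S * exp (- (sq w0 + sq w1 - sq B / S)))"
proof -
  have "exp (- (p * sq x + sq (w0 - \<alpha>0 * x) + sq (w1 - \<alpha>1 * x))) =
    exp (- (sq w0 + sq w1 - sq B / S)) * exp (- S * sq (x - B / of_real S))" for x
    using complete_square[of p \<alpha>0 \<alpha>1 x w0 w1] S unfolding S_def[symmetric] B_def[symmetric]
    by (simp add: exp_add[symmetric])
  then have "(\<integral>\<^sup>+ x. ennreal (exp (- (p * sq x + sq (w0 - \<alpha>0 * x) + sq (w1 - \<alpha>1 * x)))) \<partial>lborel) =
    ennreal (exp (- (sq w0 + sq w1 - sq B / S))) *
      (\<integral>\<^sup>+ x. ennreal (exp (- S * sq (x - B / of_real S))) \<partial>lborel)"
    by (simp only: ennreal_mult exp_ge_zero) (rule nn_integral_cmult, measurable)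
  also have "\<dots> = ennreal (exp (- (sq w0 + sq w1 - sq B / S))) * ennreal (pi / S)"
    by (simp only: nn_integral_exp_neg_cmod_square[OF S])
  also have "\<dots> = ennreal (pi / S * exp (- (sq w0 + sq w1 - sq B / S)))"
    using S by (subst ennreal_mult[symmetric]) (auto simp: mult.commute)
  finally show ?thesis .
qed

text \<open>The exponent left by the integration is the minimum of the quadratic expression over x,
  so its value at any chosen point bounds the integral from below.\<close>

lemma nn_integral_exp_quadratic_ge:
  fixes w0 w1 \<alpha>0 \<alpha>1 x0 :: complex and p :: real
  assumes S: "0 < p + sq \<alpha>0 + sq \<alpha>1"
  shows "ennreal (pi / (p + sq \<alpha>0 + sq \<alpha>1) *
      exp (- (p * sq x0 + sq (w0 - \<alpha>0 * x0) + sq (w1 - \<alpha>1 * x0)))) \<le>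
    (\<integral>\<^sup>+ x. ennreal (exp (- (p * sq x + sq (w0 - \<alpha>0 * x) + sq (w1 - \<alpha>1 * x)))) \<partial>lborel)"
  unfolding nn_integral_exp_quadratic[OF S]
proof (intro ennreal_leI mult_left_mono iffD2[OF exp_le_cancel_iff])
  show "- (p * sq x0 + sq (w0 - \<alpha>0 * x0) + sq (w1 - \<alpha>1 * x0)) \<le>
    - (sq w0 + sq w1 - sq (cnj \<alpha>0 * w0 + cnj \<alpha>1 * w1) / (p + sq \<alpha>0 + sq \<alpha>1))"
    using complete_square[OF S, of x0 w0 w1] S
    by (simp add: less_imp_le)
qed (use S in simp)

text \<open>The defect in the Cauchy-Schwarz inequality in dimension two is a determinant. For
  \<alpha> = b s2 and w = y - a x1 s1 it is affine in x1, and for nonzero gains its slope vanishes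
  exactly when the code words are parallel.\<close>

lemma lagrange_identity:
  fixes w0 w1 \<alpha>0 \<alpha>1 :: complex
  shows "(sq \<alpha>0 + sq \<alpha>1) * (sq w0 + sq w1) - sq (cnj \<alpha>0 * w0 + cnj \<alpha>1 * w1) =
    sq (\<alpha>1 * w0 - \<alpha>0 * w1)"
  by (simp add: cmod_power2) (simp add: power2_eq_square algebra_simps)

lemma nn_integral_exp_quadratic_0:
  fixes w0 w1 \<alpha>0 \<alpha>1 :: complex
  defines "S \<equiv> sq \<alpha>0 + sq \<alpha>1"
  assumes S: "0 < S"
  shows "(\<integral>\<^sup>+ x. ennreal (exp (- (sq (w0 - \<alpha>0 * x) + sq (w1 - \<alpha>1 * x)))) \<partial>lborel) =
    ennreal (pi / S) * ennreal (exp (- (sq (\<alpha>1 * w0 - \<alpha>0 * w1) / S)))"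
proof -
  have "sq w0 + sq w1 - sq (cnj \<alpha>0 * w0 + cnj \<alpha>1 * w1) / S = sq (\<alpha>1 * w0 - \<alpha>0 * w1) / S"
    using lagrange_identity[of \<alpha>0 \<alpha>1 w0 w1] S unfolding S_def[symmetric] by (simp add: field_simps)
  then show ?thesis
    using nn_integral_exp_quadratic[of 0 \<alpha>0 \<alpha>1 w0 w1] S unfolding S_def
    by (simp add: ennreal_mult[symmetric])
qed

lemma nn_integral_exp_affine:
  fixes w \<delta> :: complex and c :: real
  assumes "\<delta> \<noteq> 0" "0 < c"
  shows "(\<integral>\<^sup>+ x. ennreal (exp (- (sq (w - \<delta> * x) / c))) \<partial>lborel) = ennreal (pi * c / sq \<delta>)"
proof -
  have "exp (- (sq (w - \<delta> * x) / c)) = exp (- (sq \<delta> / c) * sq (x - w / \<delta>))" for x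
  proof -
    have "w - \<delta> * x = - \<delta> * (x - w / \<delta>)" using assms by (simp add: field_simps)
    then have "sq (w - \<delta> * x) = sq \<delta> * sq (x - w / \<delta>)"
      by (simp add: norm_mult power_mult_distrib)
    then show ?thesis by simp
  qed
  then show ?thesis
    using nn_integral_exp_neg_cmod_square[of "sq \<delta> / c" "w / \<delta>"] assms by simp
qed

lemma nn_integral_PiM_complex_gaussian_component:
  assumes "i \<in> I" and [measurable]: "F \<in> borel_measurable borel"
  shows "(\<integral>\<^sup>+ z. F (z i) \<partial>PiM I (\<lambda>_. CN 1)) = (\<integral>\<^sup>+ z. F z \<partial>CN 1)"
proof -
  have "(\<integral>\<^sup>+ z. F z \<partial>CN 1) =
    (\<integral>\<^sup>+ z. F z \<partial>distr (PiM I (\<lambda>_. CN 1)) (CN 1) (\<lambda>z. z i))"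
    using assms by (subst distr_PiM_component) (auto intro: prob_space_complex_gaussian)
  also have "\<dots> = (\<integral>\<^sup>+ z. F (z i) \<partial>PiM I (\<lambda>_. CN 1))"
    using assms(1) by (intro nn_integral_distr) auto
  finally show ?thesis ..
qed

section \<open>Rates of spreading and masking\<close>

lemma sum_lessThan_two: "(\<Sum>i<2. F i) = F 0 + F (1::nat)" for F :: "nat \<Rightarrow> 'z::comm_monoid_add"
  by (simp add: numeral_2_eq_2)

lemma prod_lessThan_two: "(\<Prod>i<2. F i) = F 0 * F (1::nat)" for F :: "nat \<Rightarrow> 'z::comm_monoid_mult"
  by (simp add: numeral_2_eq_2)

abbreviation nonparallel :: "(nat \<Rightarrow> int) \<Rightarrow> (nat \<Rightarrow> int) \<Rightarrow> bool" where
  "nonparallel s1 s2 \<equiv> s1 0 * s2 1 \<noteq> s1 1 * s2 0"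

text \<open>Kept as a constant with its own measurability rule, so that a letter is a measurable
  function of the code word.\<close>

definition sig :: "nat \<Rightarrow> (nat \<Rightarrow> int) \<Rightarrow> complex" where
  "sig i s = of_int (s i)"

lemma sig_measurable [measurable]: "sig i \<in> borel_measurable (count_space UNIV)"
  by simp

text \<open>The codes have length 2 and no masked letter. Letters of modulus at least 1 give the
  upper bounds on the densities, and modulus at most 2 gives the lower bounds.\<close>

locale spreading =
  fixes \<gamma> :: real and D :: "(nat \<Rightarrow> int) pmf" and a b :: complex
  assumes \<gamma>: "1 \<le> \<gamma>" and finite_D: "finite (set_pmf D)"
    and a: "a \<noteq> 0" and b: "b \<noteq> 0"
    and supp: "\<And>s i. s \<in> set_pmf D \<Longrightarrow> i < 2 \<Longrightarrow> s i \<noteq> 0 \<and> \<bar>s i\<bar> \<le> 2"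
begin

definition out :: "complex \<Rightarrow> complex \<Rightarrow> (nat \<Rightarrow> int) \<Rightarrow> (nat \<Rightarrow> int) \<Rightarrow> (nat \<Rightarrow> complex) \<Rightarrow> nat \<Rightarrow> complex" where
  "out x1 x2 s1 s2 z = (\<lambda>i\<in>{..<2}. a * x1 * sig i s1 + b * x2 * sig i s2 + z i)"

definition k :: "complex \<Rightarrow> complex \<Rightarrow> (nat \<Rightarrow> int) \<Rightarrow> (nat \<Rightarrow> int) \<Rightarrow> (nat \<Rightarrow> complex) \<Rightarrow> real" where
  "k x1 x2 s1 s2 y = (\<Prod>i<2. gauss_density 1 (y i - (a * x1 * sig i s1 + b * x2 * sig i s2)))"

text \<open>72 = 2 * 4 * 9: two coordinates, squared letters up to 4, and 3 * 3 as in the masking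
  channel.\<close>

definition e :: "complex \<Rightarrow> real" where
  "e x = 72 * (sq a + sq b) * sq x"

definition m :: "(nat \<Rightarrow> complex) \<Rightarrow> real" where
  "m y = (\<Sum>i<2. 3 * sq (y i))"

abbreviation "noise \<equiv> PiM {..<2 :: nat} (\<lambda>_. CN 1)"
abbreviation "ref \<equiv> PiM {..<2 :: nat} (\<lambda>_. lborel :: complex measure)"

sublocale L: product_sigma_finite "\<lambda>_ :: nat. lborel :: complex measure" ..

sublocale mixture_channel "CN \<gamma>" noise ref D out k
proof (intro mixture_channel.intro mixture_channel_axioms.intro)
  show "prob_space (CN \<gamma>)" using \<gamma> by (intro prob_space_complex_gaussian) simp
  show "prob_space noise" by (intro prob_space_PiM prob_space_complex_gaussian) simp
  show "sigma_finite_measure ref" by (rule L.sigma_finite) simp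
  show "finite (set_pmf D)" by (rule finite_D)
  show "(\<lambda>(x1, x2, s1, s2, z). out x1 x2 s1 s2 z) \<in>
    CN \<gamma> \<Otimes>\<^sub>M CN \<gamma> \<Otimes>\<^sub>M count_space UNIV \<Otimes>\<^sub>M count_space UNIV \<Otimes>\<^sub>M noise \<rightarrow>\<^sub>M ref"
    unfolding out_def by measurable
  show "(\<lambda>(x1, x2, s1, s2, y). k x1 x2 s1 s2 y) \<in>
    borel_measurable (CN \<gamma> \<Otimes>\<^sub>M CN \<gamma> \<Otimes>\<^sub>M count_space UNIV \<Otimes>\<^sub>M count_space UNIV \<Otimes>\<^sub>M ref)"
    unfolding k_def by measurable
  show "0 < k x1 x2 d1 d2 y" for x1 x2 d1 d2 y
    unfolding k_def by (intro prod_pos) (auto intro: gauss_density_pos)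
  show "k x1 x2 d1 d2 y \<le> 1" for x1 x2 d1 d2 y
  proof -
    have "1 / pi \<le> 1" using pi_gt3 by simp
    then have "gauss_density 1 z \<le> 1" for z
      using order_trans[OF gauss_density_le[of 1 z], of 1] by simp
    then show ?thesis
      unfolding k_def by (intro prod_le_1) (auto simp: gauss_density_pos less_imp_le)
  qed
  show "(\<integral>\<^sup>+ z. F (out x1 x2 d1 d2 z) \<partial>noise) = (\<integral>\<^sup>+ y. ennreal (k x1 x2 d1 d2 y) * F y \<partial>ref)"
    if "F \<in> borel_measurable ref" for F :: "(nat \<Rightarrow> complex) \<Rightarrow> ennreal" and x1 x2 d1 d2
    unfolding out_def k_def using that by (rule nn_integral_PiM_complex_gaussian_shift[rotated]) simp
qed

lemma second_moment: "(\<integral>\<^sup>+ x. ennreal (c * sq x) \<partial>CN \<gamma>) \<le> ennreal (c * (4 * \<gamma>))"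
  if "0 \<le> c"
proof -
  have "(\<integral>\<^sup>+ x. ennreal (c * sq x) \<partial>CN \<gamma>) =
      ennreal c * (\<integral>\<^sup>+ x. ennreal (sq x) \<partial>CN \<gamma>)"
    using that by (simp add: ennreal_mult nn_integral_cmult)
  also have "\<dots> \<le> ennreal c * ennreal (4 * \<gamma>)"
    using \<gamma> by (intro mult_left_mono complex_gaussian_second_moment) auto
  also have "\<dots> = ennreal (c * (4 * \<gamma>))" using that \<gamma> by (simp add: ennreal_mult)
  finally show ?thesis .
qed

lemma noise_second_moment:
  assumes "0 \<le> c" "i < 2"
  shows "(\<integral>\<^sup>+ z. ennreal (c * sq (z i)) \<partial>noise) \<le> ennreal (c * 4)"
proof -
  have "(\<integral>\<^sup>+ z. ennreal (c * sq (z i)) \<partial>noise) =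
      (\<integral>\<^sup>+ z. ennreal (c * sq z) \<partial>CN 1)"
    using assms by (intro nn_integral_PiM_complex_gaussian_component) auto
  also have "\<dots> = ennreal c * (\<integral>\<^sup>+ x. ennreal (sq x) \<partial>CN 1)"
    using assms by (simp add: ennreal_mult nn_integral_cmult)
  also have "\<dots> \<le> ennreal c * ennreal (4 * 1)"
    by (intro mult_left_mono complex_gaussian_second_moment) auto
  also have "\<dots> = ennreal (c * 4)" using assms by (simp add: ennreal_mult)
  finally show ?thesis .
qed

lemma nn_integral_base_quadratic:
  assumes c: "0 \<le> c1" "0 \<le> c2" "0 \<le> c3"
  shows "(\<integral>\<^sup>+ (x1, x2, z). ennreal (c1 * sq x1 + c2 * sq x2 + c3 * (sq (z 0) + sq (z 1))) \<partial>base_space)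
    \<le> ennreal (4 * c1 * \<gamma> + 4 * c2 * \<gamma> + 8 * c3)"
proof -
  have "(\<integral>\<^sup>+ (x1, x2, z). ennreal (c1 * sq x1 + c2 * sq x2 + c3 * (sq (z 0) + sq (z 1))) \<partial>base_space) =
    (\<integral>\<^sup>+ x1. \<integral>\<^sup>+ x2. \<integral>\<^sup>+ z. ennreal (c1 * sq x1) + ennreal (c2 * sq x2) +
      (ennreal (c3 * sq (z 0)) + ennreal (c3 * sq (z 1))) \<partial>noise \<partial>CN \<gamma> \<partial>CN \<gamma>)"
    using c by (subst nn_integral_base_space)
      (auto simp: ennreal_plus[symmetric] distrib_left simp del: ennreal_plus intro!: nn_integral_cong)
  also have "\<dots> = (\<integral>\<^sup>+ x. ennreal (c1 * sq x) \<partial>CN \<gamma>) +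
    (\<integral>\<^sup>+ x. ennreal (c2 * sq x) \<partial>CN \<gamma>) +
    ((\<integral>\<^sup>+ z. ennreal (c3 * sq (z 0)) \<partial>noise) + (\<integral>\<^sup>+ z. ennreal (c3 * sq (z 1)) \<partial>noise))"
    by (simp add: nn_integral_add N.emeasure_space_1 P.emeasure_space_1 del: space_complex_gaussian)
  also have "\<dots> \<le> ennreal (c1 * (4 * \<gamma>)) + ennreal (c2 * (4 * \<gamma>)) + (ennreal (c3 * 4) + ennreal (c3 * 4))"
    by (intro add_mono second_moment noise_second_moment c) auto
  also have "\<dots> = ennreal (4 * c1 * \<gamma> + 4 * c2 * \<gamma> + 8 * c3)"
    using c \<gamma> by (simp add: ennreal_plus[symmetric] algebra_simps del: ennreal_plus)
  finally show ?thesis .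
qed

lemma supp_square_le:
  assumes "s \<in> set_pmf D" "i < 2"
  shows "sq (c * x * sig i s) \<le> 4 * (sq c * sq x)"
proof -
  have "\<bar>real_of_int (s i)\<bar> \<le> 2" using supp[OF assms] by linarith
  then have "\<bar>real_of_int (s i)\<bar>\<^sup>2 \<le> 2\<^sup>2" by (intro power_mono) auto
  then have "(real_of_int (s i))\<^sup>2 \<le> 4" by simp
  then have "(sq c * sq x) * (real_of_int (s i))\<^sup>2 \<le> (sq c * sq x) * 4"
    by (intro mult_left_mono) auto
  then show ?thesis by (simp add: sig_def norm_mult power_mult_distrib mult_ac)
qed

sublocale tame_channel "CN \<gamma>" noise ref D out k e m "\<lambda>_ _. 2 * ln pi"
proof
  have fin: "(\<integral>\<^sup>+ x. ennreal (e x) \<partial>CN \<gamma>) < \<infinity>"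
    unfolding e_def by (rule le_less_trans[OF second_moment]) auto
  show e0: "0 \<le> e x" for x by (simp add: e_def)
  show "integrable (CN \<gamma>) e"
  proof (intro integrableI_nonneg)
    show "e \<in> borel_measurable (CN \<gamma>)" unfolding e_def by measurable
  qed (use fin e0 in auto)
  show m_meas: "m \<in> borel_measurable ref" unfolding m_def by measurable
  show "- ln (k x1 x2 d1 d2 y) \<le> 2 * ln pi + e x1 + e x2 + m y"
    if d: "d1 \<in> set_pmf D" "d2 \<in> set_pmf D" for x1 x2 d1 d2 y
  proof -
    have c: "sq (y i - (a * x1 * sig i d1 + b * x2 * sig i d2)) \<le>
      3 * sq (y i) + 12 * (sq a * sq x1) + 12 * (sq b * sq x2)" if "i < 2" for i
    proof -
      have "sq (y i - (a * x1 * sig i d1 + b * x2 * sig i d2)) \<le>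
        3 * sq (y i) + 3 * sq (a * x1 * sig i d1) + 3 * sq (b * x2 * sig i d2)"
        using cmod_add3_square_le[of "y i" "- (a * x1 * sig i d1)" "- (b * x2 * sig i d2)"]
        by (simp only: norm_minus_cancel) (simp add: algebra_simps)
      also have "\<dots> \<le> 3 * sq (y i) + 3 * (4 * (sq a * sq x1)) + 3 * (4 * (sq b * sq x2))"
        using d that by (intro add_mono mult_left_mono supp_square_le) auto
      finally show ?thesis by simp
    qed
    have "- ln (k x1 x2 d1 d2 y) = 2 * ln pi + sq (y 0 - (a * x1 * sig 0 d1 + b * x2 * sig 0 d2)) +
      sq (y 1 - (a * x1 * sig 1 d1 + b * x2 * sig 1 d2))"
      by (simp add: k_def prod_lessThan_two ln_mult_pos gauss_density_pos ln_gauss_density)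
    also have "\<dots> \<le> 2 * ln pi + m y + 24 * (sq a * sq x1) + 24 * (sq b * sq x2)"
      using c[of 0] c[of 1] by (simp add: m_def sum_lessThan_two)
    also have "\<dots> \<le> 2 * ln pi + e x1 + e x2 + m y"
      by (simp add: e_def algebra_simps)
    finally show ?thesis .
  qed
  show "integrable base_space (\<lambda>(x1, x2, z). m (out x1 x2 d1 d2 z))"
    if d: "d1 \<in> set_pmf D" "d2 \<in> set_pmf D" for d1 d2
  proof (rule integrableI_nonneg)
    note [measurable] = m_meas
    show "(\<lambda>(x1, x2, z). m (out x1 x2 d1 d2 z)) \<in> borel_measurable base_space"
      by measurable
    let ?c1 = "72 * sq a" and ?c2 = "72 * sq b"
    have "(\<integral>\<^sup>+ w. ennreal (case w of (x1, x2, z) \<Rightarrow> m (out x1 x2 d1 d2 z)) \<partial>base_space) \<le>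
      (\<integral>\<^sup>+ (x1, x2, z). ennreal (?c1 * sq x1 + ?c2 * sq x2 + 9 * (sq (z 0) + sq (z 1))) \<partial>base_space)"
    proof (rule nn_integral_mono)
      fix w :: "complex \<times> complex \<times> (nat \<Rightarrow> complex)"
      obtain x1 x2 z where w: "w = (x1, x2, z)" by (cases w)
      have c: "3 * sq (out x1 x2 d1 d2 z i) \<le>
        36 * (sq a * sq x1) + 36 * (sq b * sq x2) + 9 * sq (z i)" if "i < 2" for i
      proof -
        have "3 * sq (out x1 x2 d1 d2 z i) \<le>
          9 * sq (a * x1 * sig i d1) + 9 * sq (b * x2 * sig i d2) + 9 * sq (z i)"
          using cmod_add3_square_le[of "a * x1 * sig i d1" "b * x2 * sig i d2" "z i"] that
          by (simp add: out_def)
        also have "\<dots> \<le> 9 * (4 * (sq a * sq x1)) + 9 * (4 * (sq b * sq x2)) + 9 * sq (z i)"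
          using d that by (intro add_mono mult_left_mono supp_square_le) auto
        finally show ?thesis by simp
      qed
      have "m (out x1 x2 d1 d2 z) \<le> ?c1 * sq x1 + ?c2 * sq x2 + 9 * (sq (z 0) + sq (z 1))"
        using c[of 0] c[of 1] by (simp add: m_def sum_lessThan_two)
      then show "ennreal (case w of (x1, x2, z) \<Rightarrow> m (out x1 x2 d1 d2 z)) \<le>
        (case w of (x1, x2, z) \<Rightarrow> ennreal (?c1 * sq x1 + ?c2 * sq x2 + 9 * (sq (z 0) + sq (z 1))))"
        unfolding w prod.case by (rule ennreal_leI)
    qed
    also have "\<dots> < \<infinity>"
      by (rule le_less_trans[OF nn_integral_base_quadratic]) auto
    finally show "(\<integral>\<^sup>+ w. ennreal (case w of (x1, x2, z) \<Rightarrow> m (out x1 x2 d1 d2 z)) \<partial>base_space) < \<infinity>" .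
  qed (auto simp: m_def sum_nonneg)
qed

section \<open>Expected log-densities for fixed code words\<close>

lemma gauss_prior: "gauss_density \<gamma> x * k x1 x d1 d2 y = 1 / (pi ^ 3 * \<gamma>) *
    exp (- ((1 / \<gamma>) * sq x + sq ((y 0 - a * x1 * sig 0 d1) - (b * sig 0 d2) * x) +
      sq ((y 1 - a * x1 * sig 1 d1) - (b * sig 1 d2) * x)))"
  by (simp add: k_def prod_lessThan_two gauss_density_def exp_add[symmetric] power3_eq_cube algebra_simps)

lemma cmod_sig: "sq (c * sig i s) = sq c * (real_of_int (s i))\<^sup>2"
  by (simp add: sig_def norm_mult power_mult_distrib)

text \<open>The minimum of the quadratic exponent over \<open>x\<close> is at most its value at the true \<open>x2\<close>.\<close>

lemma h_out_ge:
  assumes d: "d2 \<in> set_pmf D"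
  shows "- ln (pi\<^sup>2 * (1 + 8 * sq b * \<gamma>)) - (sq x2 / \<gamma> + sq (z 0) + sq (z 1)) \<le>
    ln (h x1 d1 d2 (out x1 x2 d1 d2 z))"
proof -
  define y where "y = out x1 x2 d1 d2 z"
  define S where "S = 1 / \<gamma> + sq (b * sig 0 d2) + sq (b * sig 1 d2)"
  define q where "q = sq x2 / \<gamma> + sq (z 0) + sq (z 1)"
  have S: "0 < S" using \<gamma> unfolding S_def by (intro add_pos_nonneg) auto
  have sq: "(real_of_int (d2 i))\<^sup>2 \<le> 4" if "i < 2" for i
  proof -
    have "\<bar>real_of_int (d2 i)\<bar> \<le> 2" using supp[OF d that] by linarith
    then have "\<bar>real_of_int (d2 i)\<bar>\<^sup>2 \<le> 2\<^sup>2" by (intro power_mono) auto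
    then show ?thesis by simp
  qed
  have "S \<le> 1 / \<gamma> + sq b * 4 + sq b * 4"
    unfolding S_def cmod_sig by (intro add_mono mult_left_mono sq) auto
  then have S_le: "\<gamma> * S \<le> 1 + 8 * sq b * \<gamma>"
    using \<gamma> by (simp add: field_simps)
  have y_space: "y \<in> space ref"
    by (simp add: y_def out_def space_PiM)
  have "ennreal (1 / (pi ^ 3 * \<gamma>)) * ennreal (pi / S * exp (- ((1 / \<gamma>) * sq x2 +
      sq ((y 0 - a * x1 * sig 0 d1) - (b * sig 0 d2) * x2) +
      sq ((y 1 - a * x1 * sig 1 d1) - (b * sig 1 d2) * x2)))) \<le>
    ennreal (1 / (pi ^ 3 * \<gamma>)) * (\<integral>\<^sup>+ x. ennreal (exp (- ((1 / \<gamma>) * sq x +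
      sq ((y 0 - a * x1 * sig 0 d1) - (b * sig 0 d2) * x) +
      sq ((y 1 - a * x1 * sig 1 d1) - (b * sig 1 d2) * x)))) \<partial>lborel)"
    using S unfolding S_def by (intro mult_left_mono nn_integral_exp_quadratic_ge) auto
  also have "\<dots> = (\<integral>\<^sup>+ x. ennreal (gauss_density \<gamma> x * k x1 x d1 d2 y) \<partial>lborel)"
  proof -
    have "ennreal (gauss_density \<gamma> x * k x1 x d1 d2 y) = ennreal (1 / (pi ^ 3 * \<gamma>)) *
      ennreal (exp (- ((1 / \<gamma>) * sq x + sq ((y 0 - a * x1 * sig 0 d1) - (b * sig 0 d2) * x) +
      sq ((y 1 - a * x1 * sig 1 d1) - (b * sig 1 d2) * x))))" for x
      using \<gamma> unfolding gauss_prior by (intro ennreal_mult) auto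
    then show ?thesis
      by (simp only:) (rule nn_integral_cmult[symmetric], measurable)
  qed
  also have "\<dots> = (\<integral>\<^sup>+ x. ennreal (k x1 x d1 d2 y) \<partial>CN \<gamma>)"
  proof -
    have "ennreal (gauss_density \<gamma> x * k x1 x d1 d2 y) = ennreal (gauss_density \<gamma> x) * ennreal (k x1 x d1 d2 y)" for x
      using \<gamma> by (intro ennreal_mult) (auto simp: gauss_density_pos k_pos less_imp_le)
    then show ?thesis
      by (simp only:) (rule nn_integral_complex_gaussian[symmetric], simp add: k_def)
  qed
  also have "\<dots> = ennreal (h x1 d1 d2 y)"
    by (rule ennreal_h[symmetric]) (auto simp: y_space)
  \<comment> \<open>At the true \<open>x2\<close> the residuals are the two noise
    coordinates.\<close>
  also have "((1 / \<gamma>) * sq x2 + sq ((y 0 - a * x1 * sig 0 d1) - (b * sig 0 d2) * x2) +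
      sq ((y 1 - a * x1 * sig 1 d1) - (b * sig 1 d2) * x2)) = q"
    by (simp add: q_def y_def out_def algebra_simps)
  finally have "ennreal (1 / (pi ^ 3 * \<gamma>) * (pi / S * exp (- q))) \<le> ennreal (h x1 d1 d2 y)"
    using \<gamma> S by (subst ennreal_mult) simp_all
  then have "1 / (pi ^ 3 * \<gamma>) * (pi / S * exp (- q)) \<le> h x1 d1 d2 y"
    by (simp add: h_nonneg)
  then have "ln (1 / (pi ^ 3 * \<gamma>) * (pi / S * exp (- q))) \<le> ln (h x1 d1 d2 y)"
    using \<gamma> S by (intro ln_mono) (auto simp: h_pos y_space)
  moreover have "1 / (pi ^ 3 * \<gamma>) * (pi / S * exp (- q)) = 1 / (pi\<^sup>2 * (\<gamma> * S)) * exp (- q)"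
    using \<gamma> S by (simp add: power3_eq_cube power2_eq_square field_simps)
  moreover have "ln (1 / (pi\<^sup>2 * (\<gamma> * S)) * exp (- q)) = - ln (pi\<^sup>2 * (\<gamma> * S)) - q"
    using \<gamma> S by (simp add: ln_mult_pos ln_divide_pos)
  moreover have "ln (pi\<^sup>2 * (\<gamma> * S)) \<le> ln (pi\<^sup>2 * (1 + 8 * sq b * \<gamma>))"
    using S_le \<gamma> S by (intro ln_mono mult_left_mono) (auto intro!: mult_pos_pos add_pos_nonneg)
  ultimately show ?thesis by (simp add: q_def y_def)
qed

text \<open>Given the first input and the code words, the interference lies along one direction
  only, so the remaining entropy is at most one ln \<gamma> up to a constant. The 12 is 4 for |x2|^2
  / \<gamma> plus 4 for each noise coordinate.\<close>

lemma expectation_ln_h_ge: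
  assumes d: "d1 \<in> set_pmf D" "d2 \<in> set_pmf D"
  shows "- ln (pi\<^sup>2 * (1 + 8 * sq b * \<gamma>)) - 12 \<le>
    mean_ln_h d1 d2"
proof -
  let ?q = "\<lambda>(x1 :: complex, x2, z). 0 * sq x1 + (1 / \<gamma>) * sq x2 + 1 * (sq (z (0::nat)) + sq (z 1))"
  interpret base: prob_space base_space by (rule prob_spaces)
  have "(\<integral>\<^sup>+ w. ennreal (?q w) \<partial>base_space) =
    (\<integral>\<^sup>+ (x1, x2, z). ennreal (0 * sq x1 + (1 / \<gamma>) * sq x2 + 1 * (sq (z (0::nat)) + sq (z 1))) \<partial>base_space)"
    by (intro nn_integral_cong) (simp add: split_beta')
  also have "\<dots> \<le> ennreal (4 * 0 * \<gamma> + 4 * (1 / \<gamma>) * \<gamma> + 8 * 1)"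
    using \<gamma> by (intro nn_integral_base_quadratic) auto
  also have "4 * 0 * \<gamma> + 4 * (1 / \<gamma>) * \<gamma> + 8 * 1 = 12" using \<gamma> by simp
  finally have le: "(\<integral>\<^sup>+ w. ennreal (?q w) \<partial>base_space) \<le> ennreal 12" .
  have int: "integrable base_space ?q"
    using le \<gamma> by (intro integrableI_nonneg) (auto intro: le_less_trans)
  have "(\<integral>\<^sup>+ w. ennreal (?q w) \<partial>base_space) = ennreal (\<integral>w. ?q w \<partial>base_space)"
    using \<gamma> by (intro nn_integral_eq_integral int) auto
  with le have "(\<integral>w. ?q w \<partial>base_space) \<le> 12"
    by (simp del: ennreal_numeral)
  then have "- ln (pi\<^sup>2 * (1 + 8 * sq b * \<gamma>)) - 12 \<le>
      (\<integral>w. - ln (pi\<^sup>2 * (1 + 8 * sq b * \<gamma>)) - ?q w \<partial>base_space)"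
    by (subst Bochner_Integration.integral_diff[OF _ int]) (auto simp: base.prob_space)
  also have "\<dots> \<le> mean_ln_h d1 d2"
  proof (rule integral_mono[OF _ integrable_ln_h[OF d]])
    show "integrable base_space (\<lambda>w. - ln (pi\<^sup>2 * (1 + 8 * sq b * \<gamma>)) - ?q w)"
      by (intro Bochner_Integration.integrable_diff int) auto
    fix w :: "complex \<times> complex \<times> (nat \<Rightarrow> complex)"
    obtain x1 x2 z where w: "w = (x1, x2, z)" by (cases w)
    show "- ln (pi\<^sup>2 * (1 + 8 * sq b * \<gamma>)) - ?q w \<le> (case w of (x1, x2, z) \<Rightarrow> ln (h x1 d1 d2 (out x1 x2 d1 d2 z)))"
      using h_out_ge[OF d(2), of x2 z x1 d1] by (simp add: w algebra_simps)
  qed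
  finally show ?thesis .
qed

lemma k_eq: "k x1 x2 d1 d2 y = 1 / pi\<^sup>2 *
    exp (- (sq ((y 0 - a * x1 * sig 0 d1) - (b * sig 0 d2) * x2) +
      sq ((y 1 - a * x1 * sig 1 d1) - (b * sig 1 d2) * x2)))"
  by (simp add: k_def prod_lessThan_two gauss_density_def exp_add[symmetric] power2_eq_square algebra_simps)

lemma ennreal_k: "ennreal (k x1 x2 d1 d2 y) = ennreal (1 / pi\<^sup>2) *
    ennreal (exp (- (sq ((y 0 - a * x1 * sig 0 d1) - (b * sig 0 d2) * x2) +
      sq ((y 1 - a * x1 * sig 1 d1) - (b * sig 1 d2) * x2))))"
  unfolding k_eq by (intro ennreal_mult) auto

text \<open>The Gaussian prior is at most its peak value times Lebesgue measure. Each input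
  integrated in this way contributes one factor 1 / \<gamma>.\<close>

lemma nn_integral_prior_le:
  assumes [measurable]: "F \<in> borel_measurable borel"
  shows "(\<integral>\<^sup>+ x. F x \<partial>CN \<gamma>) \<le> ennreal (1 / (pi * \<gamma>)) * (\<integral>\<^sup>+ x. F x \<partial>lborel)"
proof -
  have "(\<integral>\<^sup>+ x. F x \<partial>CN \<gamma>) \<le> (\<integral>\<^sup>+ x. ennreal (1 / (pi * \<gamma>)) * F x \<partial>lborel)"
    using \<gamma> gauss_density_le[of \<gamma>]
    by (subst nn_integral_complex_gaussian) (auto intro!: nn_integral_mono mult_right_mono ennreal_leI)
  also have "\<dots> = ennreal (1 / (pi * \<gamma>)) * (\<integral>\<^sup>+ x. F x \<partial>lborel)"
    by (rule nn_integral_cmult) measurable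
  finally show ?thesis .
qed

lemma cmod_sig_ge:
  assumes "s \<in> set_pmf D" "i < 2"
  shows "sq c \<le> sq (c * sig i s)"
proof -
  have "1 \<le> \<bar>real_of_int (s i)\<bar>" using supp[OF assms] by linarith
  then have "1\<^sup>2 \<le> \<bar>real_of_int (s i)\<bar>\<^sup>2" by (intro power_mono) auto
  then have "1 \<le> (real_of_int (s i))\<^sup>2" by simp
  then show ?thesis unfolding cmod_sig using mult_left_mono[of 1 "(real_of_int (s i))\<^sup>2" "sq c"] by simp
qed

lemma h_upper:
  assumes d: "d2 \<in> set_pmf D" and y: "y \<in> space ref"
  shows "h x1 d1 d2 y \<le> 1 / (pi\<^sup>2 * sq b * \<gamma>)"
proof -
  have s0: "b * sig 0 d2 \<noteq> 0" using supp[OF d, of 0] b by (simp add: sig_def)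
  have [measurable]: "(\<lambda>x. k x1 x d1 d2 y) \<in> borel_measurable borel" unfolding k_eq by measurable
  have "ennreal (h x1 d1 d2 y) = (\<integral>\<^sup>+ x. ennreal (k x1 x d1 d2 y) \<partial>CN \<gamma>)"
    by (rule ennreal_h) (auto simp: y)
  also have "\<dots> \<le> ennreal (1 / (pi * \<gamma>)) * (\<integral>\<^sup>+ x. ennreal (k x1 x d1 d2 y) \<partial>lborel)"
    by (rule nn_integral_prior_le) measurable
  \<comment> \<open>The second coordinate is discarded; the first suffices to integrate out
    \<open>x\<close>.\<close>
  also have "\<dots> \<le> ennreal (1 / (pi * \<gamma>)) * (\<integral>\<^sup>+ x. ennreal (1 / pi\<^sup>2) *
      ennreal (exp (- (sq ((y 0 - a * x1 * sig 0 d1) - (b * sig 0 d2) * x) / 1))) \<partial>lborel)"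
    unfolding ennreal_k by (intro mult_left_mono nn_integral_mono ennreal_leI) auto
  also have "\<dots> = ennreal (1 / (pi * \<gamma>)) * (ennreal (1 / pi\<^sup>2) * ennreal (pi * 1 / sq (b * sig 0 d2)))"
    using nn_integral_exp_affine[OF s0, of 1 "y 0 - a * x1 * sig 0 d1"] by (subst nn_integral_cmult) auto
  also have "\<dots> = ennreal (1 / (pi * \<gamma>) * (1 / pi\<^sup>2 * (pi / sq (b * sig 0 d2))))"
    using \<gamma> by (simp add: ennreal_mult[symmetric])
  finally have "h x1 d1 d2 y \<le> 1 / (pi * \<gamma>) * (1 / pi\<^sup>2 * (pi / sq (b * sig 0 d2)))"
    using \<gamma> by (subst (asm) ennreal_le_iff) auto
  also have "\<dots> \<le> 1 / (pi * \<gamma>) * (1 / pi\<^sup>2 * (pi / sq b))"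
    using \<gamma> b s0 cmod_sig_ge[OF d, of 0 b] by (intro mult_left_mono divide_left_mono mult_pos_pos) auto
  also have "\<dots> = 1 / (pi\<^sup>2 * sq b * \<gamma>)"
    using \<gamma> b by (simp add: field_simps power2_eq_square)
  finally show ?thesis .
qed

lemma g_cond_upper:
  assumes d: "d2 \<in> set_pmf D" and y: "y \<in> space ref"
  shows "g_cond d1 d2 y \<le> 1 / (pi\<^sup>2 * sq b * \<gamma>)"
  unfolding g_cond_def using h_upper[OF d y] by (intro P.integral_le_const integrable_h y) auto

text \<open>Both inputs are integrated against Lebesgue measure, which gives \<gamma>^(-2).
  Integrating out the second leaves a Gaussian in the determinant E - \<delta> x1, which varies with
  x1 because the words are not parallel; its width \<open>S\<close> cancels.\<close>

lemma g_cond_upper_nonparallel: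
  assumes d: "d1 \<in> set_pmf D" "d2 \<in> set_pmf D" and y: "y \<in> space ref"
    and np: "nonparallel d1 d2"
  shows "g_cond d1 d2 y \<le> 1 / (pi\<^sup>2 * sq a * sq b * \<gamma>\<^sup>2)"
proof -
  define S where "S = sq (b * sig 0 d2) + sq (b * sig 1 d2)"
  define \<delta> where "\<delta> = a * b * of_int (d1 0 * d2 1 - d1 1 * d2 0)"
  have \<delta>: "\<delta> \<noteq> 0" using np a b by (simp add: \<delta>_def flip: of_int_mult)
  have "sq b > 0" using b by simp
  then have S: "0 < S" using cmod_sig_ge[OF d(2), of 0 b] unfolding S_def
    by (intro add_pos_nonneg) auto
  \<comment> \<open>A nonzero integer has modulus at least 1, so the bound does not depend on the
    code words.\<close>
  have "1 \<le> \<bar>real_of_int (d1 0 * d2 1 - d1 1 * d2 0)\<bar>" using np by linarith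
  then have "1\<^sup>2 \<le> \<bar>real_of_int (d1 0 * d2 1 - d1 1 * d2 0)\<bar>\<^sup>2" by (intro power_mono) auto
  then have \<delta>_ge: "sq a * sq b \<le> sq \<delta>"
    using mult_left_mono[of 1 "(real_of_int (d1 0 * d2 1 - d1 1 * d2 0))\<^sup>2" "sq a * sq b"]
    by (simp add: \<delta>_def norm_mult power_mult_distrib del: of_int_diff of_int_mult)
  define E where "E = (b * sig 1 d2) * y 0 - (b * sig 0 d2) * y 1"
  have [measurable]: "(\<lambda>x. k x1 x d1 d2 y) \<in> borel_measurable borel" for x1 unfolding k_eq by measurable
  have inner: "(\<integral>\<^sup>+ x. ennreal (k x1 x d1 d2 y) \<partial>lborel) =
      ennreal (1 / (pi * S)) * ennreal (exp (- (sq (E - \<delta> * x1) / S)))" for x1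
  proof -
    have eq: "(b * sig 1 d2) * (y 0 - a * x1 * sig 0 d1) - (b * sig 0 d2) * (y 1 - a * x1 * sig 1 d1) = E - \<delta> * x1"
      by (simp add: E_def \<delta>_def sig_def algebra_simps)
    have "(\<integral>\<^sup>+ x. ennreal (k x1 x d1 d2 y) \<partial>lborel) = ennreal (1 / pi\<^sup>2) *
      (ennreal (pi / S) * ennreal (exp (- (sq (E - \<delta> * x1) / S))))"
      unfolding ennreal_k
      by (subst nn_integral_cmult, measurable)
        (simp only: nn_integral_exp_quadratic_0[of "b * sig 0 d2" "b * sig 1 d2"
          "y 0 - a * x1 * sig 0 d1" "y 1 - a * x1 * sig 1 d1", folded S_def, OF S] eq)
    also have "\<dots> = ennreal (1 / (pi * S)) * ennreal (exp (- (sq (E - \<delta> * x1) / S)))"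
      using S by (simp add: mult.assoc[symmetric] ennreal_mult[symmetric] power2_eq_square)
    finally show ?thesis .
  qed
  have "ennreal (g_cond d1 d2 y) = (\<integral>\<^sup>+ x1. \<integral>\<^sup>+ x. ennreal (k x1 x d1 d2 y) \<partial>CN \<gamma> \<partial>CN \<gamma>)"
    using y by (simp add: ennreal_g_cond ennreal_h cong: nn_integral_cong)
  also have "\<dots> \<le> (\<integral>\<^sup>+ x1. ennreal (1 / (pi * \<gamma>)) * (\<integral>\<^sup>+ x. ennreal (k x1 x d1 d2 y) \<partial>lborel) \<partial>CN \<gamma>)"
    by (intro nn_integral_mono nn_integral_prior_le) measurable
  also have "\<dots> = (\<integral>\<^sup>+ x1. ennreal (1 / (pi * \<gamma>)) * (ennreal (1 / (pi * S)) *
      ennreal (exp (- (sq (E - \<delta> * x1) / S)))) \<partial>CN \<gamma>)"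
    unfolding inner ..
  also have "\<dots> \<le> ennreal (1 / (pi * \<gamma>)) * (\<integral>\<^sup>+ x1. ennreal (1 / (pi * \<gamma>)) * (ennreal (1 / (pi * S)) *
      ennreal (exp (- (sq (E - \<delta> * x1) / S)))) \<partial>lborel)"
    by (rule nn_integral_prior_le) measurable
  also have "\<dots> = ennreal (1 / (pi * \<gamma>)) * (ennreal (1 / (pi * \<gamma>)) * (ennreal (1 / (pi * S)) *
      ennreal (pi * S / sq \<delta>)))"
    using nn_integral_exp_affine[OF \<delta> S, of E] by (simp add: nn_integral_cmult)
  also have "\<dots> = ennreal (1 / (pi * \<gamma>) * (1 / (pi * \<gamma>) * (1 / (pi * S) * (pi * S / sq \<delta>))))"
    using \<gamma> S by (simp add: ennreal_mult[symmetric])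
  finally have "g_cond d1 d2 y \<le> 1 / (pi * \<gamma>) * (1 / (pi * \<gamma>) * (1 / (pi * S) * (pi * S / sq \<delta>)))"
    using \<gamma> S by (subst (asm) ennreal_le_iff) auto
  also have "\<dots> = 1 / (pi\<^sup>2 * \<gamma>\<^sup>2) * (1 / sq \<delta>)"
    using \<gamma> S by (simp add: power2_eq_square)
  also have "\<dots> \<le> 1 / (pi\<^sup>2 * \<gamma>\<^sup>2) * (1 / (sq a * sq b))"
    using \<delta>_ge \<delta> a b by (intro mult_left_mono divide_left_mono) auto
  also have "\<dots> = 1 / (pi\<^sup>2 * sq a * sq b * \<gamma>\<^sup>2)" by (simp add: mult_ac)
  finally show ?thesis .
qed

lemma expectation_ln_g_cond_le:
  assumes d: "d1 \<in> set_pmf D" "d2 \<in> set_pmf D" and M: "\<And>y. y \<in> space ref \<Longrightarrow> g_cond d1 d2 y \<le> M"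
  shows "mean_ln_g_cond d1 d2 \<le> ln M"
proof -
  interpret base: prob_space base_space by (rule prob_spaces)
  have y: "out x1 x2 d1 d2 z \<in> space ref" for x1 x2 z by (simp add: out_def space_PiM)
  show ?thesis
  proof (rule base.integral_le_const[OF integrable_ln_g_cond[OF d]], rule AE_I2)
    fix w
    show "(case w of (x1, x2, z) \<Rightarrow> ln (g_cond d1 d2 (out x1 x2 d1 d2 z))) \<le> ln M"
      using M[OF y] g_cond_pos[OF y] less_le_trans[OF g_cond_pos[OF y] M[OF y]]
      by (cases w) (auto intro!: ln_mono)
  qed
qed

text \<open>Independent of \<gamma> and of the code words; the absolute values cover the parallel
  and the nonparallel case at once.\<close>

definition offset where
  "offset = ln (pi\<^sup>2 * (1 + 8 * sq b)) + 12 + \<bar>ln (pi\<^sup>2 * sq b)\<bar> + \<bar>ln (pi\<^sup>2 * sq a * sq b)\<bar>"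

text \<open>The term with \<open>h\<close> costs one ln \<gamma>, and the term with
  \<open>g_cond\<close> returns one for parallel and two for nonparallel words, which is the rank of
  the pair.\<close>

lemma slice_ge:
  assumes d: "d1 \<in> set_pmf D" "d2 \<in> set_pmf D"
  shows "of_bool (nonparallel d1 d2) * ln \<gamma> - offset \<le>
    mean_ln_h d1 d2 -
       mean_ln_g_cond d1 d2"
proof -
  have "pi\<^sup>2 * (1 + 8 * sq b * \<gamma>) \<le> pi\<^sup>2 * ((1 + 8 * sq b) * \<gamma>)"
    using \<gamma> by (intro mult_left_mono) (auto simp: algebra_simps)
  moreover have "0 < pi\<^sup>2 * (1 + 8 * sq b * \<gamma>)"
    using \<gamma> by (intro mult_pos_pos add_pos_nonneg) auto
  ultimately have "ln (pi\<^sup>2 * (1 + 8 * sq b * \<gamma>)) \<le> ln (pi\<^sup>2 * (1 + 8 * sq b) * \<gamma>)"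
    by (intro ln_mono) (auto simp: mult.assoc)
  also have "\<dots> = ln (pi\<^sup>2 * (1 + 8 * sq b)) + ln \<gamma>"
    using \<gamma> by (intro ln_mult_pos mult_pos_pos add_pos_nonneg) auto
  finally have 1: "- (ln (pi\<^sup>2 * (1 + 8 * sq b)) + ln \<gamma>) - 12 \<le>
      mean_ln_h d1 d2"
    using expectation_ln_h_ge[OF d] by linarith
  show ?thesis
  proof (cases "d1 0 * d2 1 = d1 1 * d2 0")
    case True
    have "ln (1 / (pi\<^sup>2 * sq b * \<gamma>)) = - ln (pi\<^sup>2 * sq b) - ln \<gamma>"
      using \<gamma> b by (simp add: ln_divide_pos ln_mult_pos)
    with expectation_ln_g_cond_le[OF d g_cond_upper[OF d(2)]] True 1 show ?thesis
      unfolding offset_def by auto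
  next
    case False
    have "ln (1 / (pi\<^sup>2 * sq a * sq b * \<gamma>\<^sup>2)) = - ln (pi\<^sup>2 * sq a * sq b) - 2 * ln \<gamma>"
      using \<gamma> a b by (simp add: ln_divide_pos ln_mult_pos power2_eq_square)
    with expectation_ln_g_cond_le[OF d g_cond_upper_nonparallel[OF d _ False]] False 1 show ?thesis
      unfolding offset_def by auto
  qed
qed

definition information where
  "information = prob_space.mutual_information full_space 2 (borel \<Otimes>\<^sub>M count_space UNIV) (PiM {..<2} (\<lambda>_. borel))
      channel_input channel_output"

text \<open>\<open>p0\<close> turns the cost of the unknown second code word into a
  constant.\<close>

lemma information_ge:
  assumes p0: "0 < p0" "\<And>s. s \<in> set_pmf D \<Longrightarrow> p0 \<le> pmf D s"
  shows "(\<Sum>s1\<in>set_pmf D. \<Sum>s2\<in>set_pmf D. pmf D s1 * pmf D s2 * of_bool (nonparallel s1 s2)) * ln \<gamma>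
    - offset + ln p0 \<le> ln 2 * information"
proof -
  have *: "sets (borel \<Otimes>\<^sub>M count_space UNIV) = sets (CN \<gamma> \<Otimes>\<^sub>M count_space (UNIV :: (nat \<Rightarrow> int) set))"
    by (intro sets_pair_measure_cong) (auto simp: sets_complex_gaussian)
  have **: "sets (PiM {..<2 :: nat} (\<lambda>_. borel :: complex measure)) = sets ref"
    by (intro sets_PiM_cong) auto
  have one: "(\<Sum>s1\<in>set_pmf D. \<Sum>s2\<in>set_pmf D. pmf D s1 * pmf D s2) = 1"
    by (simp add: sum_distrib_left[symmetric])
  have "(\<Sum>s1\<in>set_pmf D. \<Sum>s2\<in>set_pmf D. pmf D s1 * pmf D s2 * of_bool (nonparallel s1 s2)) * ln \<gamma>
    - offset + ln p0 = (\<Sum>s1\<in>set_pmf D. \<Sum>s2\<in>set_pmf D. pmf D s1 * pmf D s2 *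
      (of_bool (nonparallel s1 s2) * ln \<gamma> - offset + ln p0))"
  proof -
    have "(\<Sum>s1\<in>set_pmf D. \<Sum>s2\<in>set_pmf D. pmf D s1 * pmf D s2 *
        (of_bool (nonparallel s1 s2) * ln \<gamma> - offset + ln p0)) =
      (\<Sum>s1\<in>set_pmf D. \<Sum>s2\<in>set_pmf D. pmf D s1 * pmf D s2 * of_bool (nonparallel s1 s2) * ln \<gamma> +
        pmf D s1 * pmf D s2 * (ln p0 - offset))"
      by (intro sum.cong refl) (simp add: algebra_simps)
    also have "\<dots> = (\<Sum>s1\<in>set_pmf D. \<Sum>s2\<in>set_pmf D. pmf D s1 * pmf D s2 * of_bool (nonparallel s1 s2)) * ln \<gamma> +
        (\<Sum>s1\<in>set_pmf D. \<Sum>s2\<in>set_pmf D. pmf D s1 * pmf D s2) * (ln p0 - offset)"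
      by (simp only: sum.distrib sum_distrib_right)
    finally show ?thesis unfolding one by simp
  qed
  also have "\<dots> \<le> (\<Sum>d1\<in>set_pmf D. \<Sum>d2\<in>set_pmf D. pmf D d1 * pmf D d2 *
      (mean_ln_h d1 d2 -
       mean_ln_g_cond d1 d2 + ln (pmf D d2)))"
    using p0 by (intro sum_mono mult_left_mono add_mono slice_ge ln_mono) (auto intro: pmf_positive)
  also have "\<dots> \<le> ln 2 * information"
    unfolding information_def by (rule mutual_information_ge[OF _ * **]) simp
  finally show ?thesis .
qed

end

section \<open>Uniform words of length two over four letters\<close>

definition letters :: "int set" where "letters = {- 2, - 1, 1, 2}"

definition code_word :: "int \<times> int \<Rightarrow> nat \<Rightarrow> int" where
  "code_word uv i = (if i = 0 then fst uv else if i = 1 then snd uv else 0)"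

lemma inj_code_word: "inj_on code_word A"
proof (rule inj_onI)
  fix x y assume "code_word x = code_word y"
  then have "code_word x 0 = code_word y 0" "code_word x 1 = code_word y 1" by simp_all
  then show "x = y" by (simp add: code_word_def prod_eq_iff)
qed

lemma signature_pmf_letters:
  "signature_pmf 2 (pmf_of_set letters) 1 = pmf_of_set (code_word ` (letters \<times> letters))"
proof -
  have fin: "finite letters" "letters \<noteq> {}" by (auto simp: letters_def)
  have b: "bernoulli_pmf 1 = return_pmf True"
  proof (rule pmf_eqI)
    show "pmf (bernoulli_pmf 1) i = pmf (return_pmf True) i" for i by (cases i) auto
  qed
  have "signature_pmf 2 (pmf_of_set letters) 1 =
    map_pmf (\<lambda>a i. a i * of_bool (i < 2)) (Pi_pmf {..<2} 0 (\<lambda>_. pmf_of_set letters))"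
    by (simp add: signature_pmf_def b pair_return_pmf2 map_pmf_comp) (intro map_pmf_cong refl ext, simp)
  \<comment> \<open>Outside the index set the mask is off, but the letter there is already 0, so the
    factor changes nothing.\<close>
  also have "\<dots> = map_pmf id (Pi_pmf {..<2} 0 (\<lambda>_. pmf_of_set letters))"
    using set_Pi_pmf_subset[of "{..<2 :: nat}" 0 "\<lambda>_. pmf_of_set letters"]
    by (intro map_pmf_cong refl) (auto simp: fun_eq_iff subset_iff)
  also have "\<dots> = pmf_of_set (PiE_dflt {..<2 :: nat} 0 (\<lambda>_. letters))"
    using fin by (simp add: Pi_pmf_of_set)
  also have "PiE_dflt {..<2 :: nat} 0 (\<lambda>_. letters) = code_word ` (letters \<times> letters)"
  proof safe
    fix f assume f: "f \<in> PiE_dflt {..<2 :: nat} 0 (\<lambda>_. letters)"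
    then have "f i = code_word (f 0, f 1) i" for i
      by (cases "i < 2") (auto simp: code_word_def PiE_dflt_def less_2_cases_iff)
    then have "f = code_word (f 0, f 1)" by blast
    with f show "f \<in> code_word ` (letters \<times> letters)" by (auto simp: PiE_dflt_def)
  qed (auto simp: PiE_dflt_def code_word_def less_2_cases_iff)
  finally show ?thesis .
qed

lemma finite_words: "finite (code_word ` (letters \<times> letters))" "code_word ` (letters \<times> letters) \<noteq> {}"
  by (auto simp: letters_def)

lemma card_words: "card (code_word ` (letters \<times> letters)) = 16"
  by (simp add: card_image inj_code_word card_cartesian_product) (simp add: letters_def)

lemma sum_words: "(\<Sum>s\<in>code_word ` (letters \<times> letters). F s) = (\<Sum>u\<in>letters. \<Sum>v\<in>letters. F (code_word (u, v)))"
  by (simp add: sum.reindex inj_code_word sum.cartesian_product)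

text \<open>Words are parallel when the quotients of their letters agree. The quotients 1 and -1
  have four words each, and 2, -2, 1/2 and -1/2 have two each, so 2 * 16 + 4 * 4 = 48 of the 256
  pairs are parallel.\<close>

lemma nonparallel_probability:
  fixes D defines "D \<equiv> pmf_of_set (code_word ` (letters \<times> letters))"
  shows "(\<Sum>s1\<in>set_pmf D. \<Sum>s2\<in>set_pmf D. pmf D s1 * pmf D s2 * of_bool (nonparallel s1 s2)) = (13 / 16 :: real)"
proof -
  have "(\<Sum>s1\<in>set_pmf D. \<Sum>s2\<in>set_pmf D. pmf D s1 * pmf D s2 * of_bool (nonparallel s1 s2)) =
    (\<Sum>s1\<in>code_word ` (letters \<times> letters). \<Sum>s2\<in>code_word ` (letters \<times> letters).
      of_bool (nonparallel s1 s2) / (256 :: real))"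
    unfolding D_def set_pmf_of_set[OF finite_words(2,1)] pmf_of_set[OF finite_words(2,1)]
    by (intro sum.cong refl) (simp add: card_words)
  also have "\<dots> = 13 / 16"
    unfolding sum_words by (simp add: letters_def code_word_def)
  finally show ?thesis .
qed

text \<open>Each squared letter has mean 5 / 2; hence the choice 1 / sqrt 5 for \<beta> in
  \<open>achievable_rate\<close>.\<close>

lemma code_word_energy:
  "measure_pmf.expectation (pmf_of_set (code_word ` (letters \<times> letters))) (\<lambda>s. \<Sum>i<2. (real_of_int (s i))\<^sup>2) = 5"
  unfolding integral_pmf_of_set[OF finite_words(2,1)] sum_words card_words
  by (simp add: letters_def code_word_def sum_lessThan_two)

lemma achievable_rate:
  assumes h: "h11 \<noteq> 0" "h21 \<noteq> 0"
  shows "\<exists>C. \<forall>\<gamma>\<ge>1. achievable_by_spreading_and_masking \<gamma> h11 h21 ((13 / 32 * ln \<gamma> - C) / ln 2)"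
proof -
  define \<beta> :: real where "\<beta> = 1 / sqrt 5"
  define a b where "a = of_real \<beta> * h11" and "b = of_real \<beta> * h21"
  let ?D = "pmf_of_set (code_word ` (letters \<times> letters))"
  have ab: "a \<noteq> 0" "b \<noteq> 0" using h by (auto simp: a_def b_def \<beta>_def)
  \<comment> \<open>\<open>offset\<close> depends on the gains only, so one constant serves all
    \<gamma>. The halves come from dividing by the length 2.\<close>
  have "achievable_by_spreading_and_masking \<gamma> h11 h21
    ((13 / 32 * ln \<gamma> - (spreading.offset a b - ln (1 / 16)) / 2) / ln 2)" if \<gamma>: "1 \<le> \<gamma>" for \<gamma>
  proof -
    interpret spreading \<gamma> ?D a b
    proof
      show "s i \<noteq> 0 \<and> \<bar>s i\<bar> \<le> 2" if "s \<in> set_pmf ?D" "i < 2" for s and i :: nat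
        using that by (auto simp: set_pmf_of_set[OF finite_words(2,1)] code_word_def letters_def less_2_cases_iff)
    qed (use \<gamma> ab in \<open>auto simp: set_pmf_of_set[OF finite_words(2,1)] finite_words\<close>)
    have "spreading_information \<gamma> h11 h21 2 (pmf_of_set letters) 1 \<beta> = information"
      unfolding spreading_information_def spreading_space_def spreading_output_def signature_pmf_letters
        information_def out_def sig_def by (simp only: a_def b_def)
    moreover have "13 / 16 * ln \<gamma> - offset + ln (1 / 16) \<le> ln 2 * information"
    proof -
      have "1 / 16 \<le> pmf ?D s" if "s \<in> set_pmf ?D" for s
        using that by (simp add: set_pmf_of_set[OF finite_words(2,1)] pmf_of_set[OF finite_words(2,1)] card_words)
      from information_ge[OF _ this] show ?thesis
        unfolding nonparallel_probability by simp
    qed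
    ultimately have R: "(13 / 32 * ln \<gamma> - (offset - ln (1 / 16)) / 2) / ln 2 \<le>
        spreading_information \<gamma> h11 h21 2 (pmf_of_set letters) 1 \<beta> / real 2"
      by (simp add: field_simps)
    show ?thesis
      unfolding achievable_by_spreading_and_masking_def
    proof (intro exI conjI R)
      show "finite letters" "0 \<notin> letters" "uminus ` letters = letters" "set_pmf (pmf_of_set letters) \<subseteq> letters"
        by (auto simp: letters_def)
      show "\<beta>\<^sup>2 * measure_pmf.expectation (signature_pmf 2 (pmf_of_set letters) 1) (\<lambda>s. \<Sum>i<2. (real_of_int (s i))\<^sup>2) = 1"
        unfolding signature_pmf_letters code_word_energy by (simp add: \<beta>_def power_divide)
    qed (use R in \<open>auto simp: \<beta>_def\<close>)
  qed
  then show ?thesis by blast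
qed

section \<open>The optimal masking probability\<close>

text \<open>The product is 0 at 0, which is also its limit there. This point is needed for the
  binary entropy at 1, an admissible masking probability.\<close>

lemma continuous_on_mult_ln: "continuous_on {0..} (\<lambda>t::real. t * ln t)"
  unfolding continuous_on_eq_continuous_within
proof
  fix x :: real assume "x \<in> {0..}"
  show "continuous (at x within {0..}) (\<lambda>t. t * ln t)"
  proof (cases "x = 0")
    case True
    have "((\<lambda>t::real. t * ln t) \<longlongrightarrow> 0) (at_right 0)" by real_asymp
    then show ?thesis by (simp add: True continuous_within at_within_Ici_at_right)
  next
    case False
    then have "isCont (\<lambda>t. t * ln t) x" by (intro continuous_intros) auto
    then show ?thesis by (rule continuous_at_imp_continuous_at_within)
  qed
qed

lemma continuous_on_binary_entropy: "continuous_on {0..1} binary_entropy"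
proof -
  have "binary_entropy x = - (x * ln x) / ln 2 - ((1 - x) * ln (1 - x)) / ln 2" for x
    by (simp add: binary_entropy_def log_def)
  then have eq: "binary_entropy = (\<lambda>x. - (x * ln x) / ln 2 - ((1 - x) * ln (1 - x)) / ln 2)" by (rule ext)
  show ?thesis
    unfolding eq
    by (intro continuous_intros continuous_on_compose2[OF continuous_on_mult_ln, of _ "\<lambda>x. x"]
      continuous_on_compose2[OF continuous_on_mult_ln, of _ "\<lambda>x. 1 - x"]) auto
qed

lemma binary_entropy_nonneg:
  assumes "0 \<le> x" "x \<le> 1"
  shows "0 \<le> binary_entropy x"
proof -
  have "t * log 2 t \<le> 0" if "0 \<le> t" "t \<le> 1" for t :: real
    using that by (cases "t = 0") (auto intro!: mult_nonneg_nonpos)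
  from this[of x] this[of "1 - x"] assms show ?thesis
    by (simp add: binary_entropy_def)
qed

lemma binary_entropy_half: "binary_entropy (1 / 2) = 1"
  by (simp add: binary_entropy_def log_divide)

section \<open>Fading averages and deep fades\<close>

abbreviation fading :: "(complex \<times> complex) measure" where
  "fading \<equiv> CN 1 \<Otimes>\<^sub>M CN 1"

definition snr :: "real \<Rightarrow> real \<Rightarrow> complex \<times> complex \<Rightarrow> real" where
  "snr \<gamma> \<epsilon> h = 2 powr (- binary_entropy \<epsilon>) * sq (fst h) * \<gamma> / (\<epsilon> * (1 + sq (snd h) * \<gamma> / \<epsilon>) powr \<epsilon>)"

abbreviation "rate \<gamma> \<epsilon> h \<equiv> \<epsilon> * ln (1 + snr \<gamma> \<epsilon> h)"

definition nat_objective :: "real \<Rightarrow> real \<Rightarrow> real" where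
  "nat_objective \<gamma> \<epsilon> = (\<integral>h. rate \<gamma> \<epsilon> h \<partial>fading)"

lemma masking_objective_eq: "masking_objective \<gamma> \<epsilon> = nat_objective \<gamma> \<epsilon> / ln 2"
  unfolding masking_objective_def nat_objective_def
  by (subst integral_divide_zero[symmetric])
    (intro Bochner_Integration.integral_cong refl, simp add: split_beta' log_def snr_def)

lemma snr_measurable [measurable]: "snr \<gamma> \<epsilon> \<in> borel_measurable fading"
  unfolding snr_def[abs_def] by measurable

interpretation G1: prob_space "CN 1" by (rule prob_space_complex_gaussian) simp
interpretation fading: prob_space fading by (intro prob_space_pair G1.prob_space_axioms)

lemma nn_integral_fading_fst:
  assumes [measurable]: "F \<in> borel_measurable borel"
  shows "(\<integral>\<^sup>+ h. F (fst h) \<partial>fading) = (\<integral>\<^sup>+ z. F z \<partial>CN 1)"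
  by (subst G1.nn_integral_fst[symmetric]) (auto simp: G1.emeasure_space_1 simp del: space_complex_gaussian)

lemma nn_integral_fading_snd:
  assumes [measurable]: "F \<in> borel_measurable borel"
  shows "(\<integral>\<^sup>+ h. F (snd h) \<partial>fading) = (\<integral>\<^sup>+ z. F z \<partial>CN 1)"
  by (subst G1.nn_integral_fst[symmetric]) (auto simp: G1.emeasure_space_1 simp del: space_complex_gaussian)

lemma integral_le_of_nn_integral_le:
  fixes F :: "'a \<Rightarrow> real"
  assumes "F \<in> borel_measurable M" "\<And>x. 0 \<le> F x" "0 \<le> c" and le: "(\<integral>\<^sup>+ x. ennreal (F x) \<partial>M) \<le> ennreal c"
  shows "integrable M F" "(\<integral>x. F x \<partial>M) \<le> c"
proof -
  show int: "integrable M F"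
    using assms by (intro integrableI_nonneg) (auto intro: le_less_trans)
  have "(\<integral>\<^sup>+ x. ennreal (F x) \<partial>M) = ennreal (\<integral>x. F x \<partial>M)"
    by (intro nn_integral_eq_integral int) (simp add: assms)
  then show "(\<integral>x. F x \<partial>M) \<le> c" using le assms(3) by simp
qed

lemma fading_moment:
  "integrable fading (\<lambda>h. sq (fst h))" "(\<integral>h. sq (fst h) \<partial>fading) \<le> 4"
  "integrable fading (\<lambda>h. sq (snd h))" "(\<integral>h. sq (snd h) \<partial>fading) \<le> 4"
proof -
  have le: "(\<integral>\<^sup>+ h. ennreal (sq (fst h)) \<partial>fading) \<le> ennreal 4"
      "(\<integral>\<^sup>+ h. ennreal (sq (snd h)) \<partial>fading) \<le> ennreal 4"
    using complex_gaussian_second_moment[of 1]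
    by (simp_all add: nn_integral_fading_fst[of "\<lambda>z. ennreal (sq z)"] nn_integral_fading_snd[of "\<lambda>z. ennreal (sq z)"])
  show "integrable fading (\<lambda>h. sq (fst h))" "(\<integral>h. sq (fst h) \<partial>fading) \<le> 4"
    by (rule integral_le_of_nn_integral_le[OF _ _ _ le(1)]; simp)+
  show "integrable fading (\<lambda>h. sq (snd h))" "(\<integral>h. sq (snd h) \<partial>fading) \<le> 4"
    by (rule integral_le_of_nn_integral_le[OF _ _ _ le(2)]; simp)+
qed

text \<open>Near a zero of the gain its logarithm is unbounded below. On this event only trivial
  estimates are used; the threshold 1 / 1000 makes it rare enough for the comparison in
  \<open>optimal_masking\<close>.\<close>

definition deep_fade :: "complex \<Rightarrow> real" where
  "deep_fade z = of_bool (sq z < 1 / 1000)"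

lemma deep_fade_measurable [measurable]: "deep_fade \<in> borel_measurable borel"
  unfolding deep_fade_def[abs_def] by measurable

text \<open>On the event exp (- 1000 |z|^2) is at least exp (- 1) >= 1 / 3, so three times this
  Gaussian dominates the indicator, and the mass is at most 3 / 1000.\<close>

lemma nn_integral_deep_fade: "(\<integral>\<^sup>+ z. ennreal (deep_fade z) \<partial>CN 1) \<le> ennreal (1 / 200)"
proof -
  have "(\<integral>\<^sup>+ z. ennreal (deep_fade z) \<partial>CN 1) =
      (\<integral>\<^sup>+ z. ennreal (gauss_density 1 z) * ennreal (deep_fade z) \<partial>lborel)"
    by (rule nn_integral_complex_gaussian) measurable
  also have "\<dots> \<le> (\<integral>\<^sup>+ z. ennreal (3 / pi) * ennreal (exp (- 1000 * sq (z - 0))) \<partial>lborel)"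
  proof (rule nn_integral_mono)
    fix z
    have "gauss_density 1 z * deep_fade z \<le> 3 / pi * exp (- 1000 * sq z)"
    proof (cases "sq z < 1 / 1000")
      case True
      have "1 / 3 \<le> exp (- 1 :: real)"
        using exp_le by (simp add: exp_minus field_simps)
      also have "\<dots> \<le> exp (- 1000 * sq z)" using True by simp
      finally have "1 / pi \<le> 3 / pi * exp (- 1000 * sq z)" by (simp add: field_simps)
      then show ?thesis using gauss_density_le[of 1 z] True by (simp add: deep_fade_def)
    qed (simp add: deep_fade_def)
    then show "ennreal (gauss_density 1 z) * ennreal (deep_fade z) \<le> ennreal (3 / pi) * ennreal (exp (- 1000 * sq (z - 0)))"
      by (simp add: ennreal_mult[symmetric] gauss_density_pos less_imp_le deep_fade_def)
  qed
  also have "\<dots> = ennreal (3 / pi) * ennreal (pi / 1000)"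
    using nn_integral_exp_neg_cmod_square[of 1000 0] by (simp add: nn_integral_cmult)
  also have "\<dots> \<le> ennreal (1 / 200)"
    by (simp add: ennreal_mult[symmetric] ennreal_leI)
  finally show ?thesis .
qed

lemma fading_deep_fade:
  "integrable fading (\<lambda>h. deep_fade (fst h))" "(\<integral>h. deep_fade (fst h) \<partial>fading) \<le> 1 / 200"
  "integrable fading (\<lambda>h. deep_fade (snd h))" "(\<integral>h. deep_fade (snd h) \<partial>fading) \<le> 1 / 200"
proof -
  have le: "(\<integral>\<^sup>+ h. ennreal (deep_fade (fst h)) \<partial>fading) \<le> ennreal (1 / 200)"
      "(\<integral>\<^sup>+ h. ennreal (deep_fade (snd h)) \<partial>fading) \<le> ennreal (1 / 200)"
    using nn_integral_deep_fade
    by (simp_all add: nn_integral_fading_fst[of "\<lambda>z. ennreal (deep_fade z)"] nn_integral_fading_snd[of "\<lambda>z. ennreal (deep_fade z)"])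
  have nn: "0 \<le> deep_fade z" for z by (simp add: deep_fade_def)
  show "integrable fading (\<lambda>h. deep_fade (fst h))" "(\<integral>h. deep_fade (fst h) \<partial>fading) \<le> 1 / 200"
    by (rule integral_le_of_nn_integral_le[OF _ _ _ le(1)]; simp add: nn)+
  show "integrable fading (\<lambda>h. deep_fade (snd h))" "(\<integral>h. deep_fade (snd h) \<partial>fading) \<le> 1 / 200"
    by (rule integral_le_of_nn_integral_le[OF _ _ _ le(2)]; simp add: nn)+
qed

context
  fixes \<gamma> :: real
  assumes \<gamma>: "1 \<le> \<gamma>"
begin

section \<open>Estimates of the objective for fixed power\<close>

lemma snr_nonneg: "0 < \<epsilon> \<Longrightarrow> 0 \<le> snr \<gamma> \<epsilon> h"
  using \<gamma> by (simp add: snr_def)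

lemma snr_le_power:
  assumes eps: "0 < \<epsilon>" "\<epsilon> \<le> 1" and t: "0 < t" "t \<le> (1 + sq (snd h) * \<gamma> / \<epsilon>) powr \<epsilon>"
  shows "snr \<gamma> \<epsilon> h \<le> sq (fst h) * \<gamma> / (\<epsilon> * t)"
proof -
  have "2 powr (- binary_entropy \<epsilon>) \<le> (2::real) powr 0"
    using binary_entropy_nonneg[of \<epsilon>] eps by (intro powr_mono) auto
  then have "2 powr (- binary_entropy \<epsilon>) * (sq (fst h) * \<gamma>) \<le> 1 * (sq (fst h) * \<gamma>)"
    using \<gamma> by (intro mult_right_mono) auto
  then have "snr \<gamma> \<epsilon> h \<le> sq (fst h) * \<gamma> / (\<epsilon> * (1 + sq (snd h) * \<gamma> / \<epsilon>) powr \<epsilon>)"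
    using eps unfolding snr_def by (intro divide_right_mono) (auto simp: mult.assoc)
  also have "\<dots> \<le> sq (fst h) * \<gamma> / (\<epsilon> * t)"
    using eps t \<gamma> by (intro divide_left_mono mult_left_mono mult_pos_pos) auto
  finally show ?thesis .
qed

lemma snr_le:
  assumes eps: "0 < \<epsilon>" "\<epsilon> \<le> 1"
  shows "snr \<gamma> \<epsilon> h \<le> sq (fst h) * \<gamma> / \<epsilon>"
proof -
  have "1 \<le> (1 + sq (snd h) * \<gamma> / \<epsilon>) powr \<epsilon>"
    using eps \<gamma> by (intro ge_one_powr_ge_zero) auto
  then show ?thesis using snr_le_power[OF eps, of 1 h] by simp
qed

text \<open>From ln (1 + t) <= t; the factor \<epsilon> cancels the 1 / \<epsilon> in the ratio. The
  bound is free of \<epsilon> and therefore serves dominated convergence in \<epsilon> as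
  well.\<close>

lemma integrand_bounds:
  assumes eps: "0 < \<epsilon>" "\<epsilon> \<le> 1"
  shows "0 \<le> rate \<gamma> \<epsilon> h" "rate \<gamma> \<epsilon> h \<le> \<gamma> * sq (fst h)"
proof -
  show "0 \<le> rate \<gamma> \<epsilon> h"
    using eps snr_nonneg[of \<epsilon> h] by simp
  have "rate \<gamma> \<epsilon> h \<le> \<epsilon> * snr \<gamma> \<epsilon> h"
    using eps snr_nonneg[of \<epsilon> h] by (intro mult_left_mono ln_add_one_self_le_self) auto
  also have "\<dots> \<le> \<epsilon> * (sq (fst h) * \<gamma> / \<epsilon>)"
    using eps by (intro mult_left_mono snr_le) auto
  also have "\<dots> = \<gamma> * sq (fst h)" using eps by simp
  finally show "rate \<gamma> \<epsilon> h \<le> \<gamma> * sq (fst h)" .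
qed

lemma integrable_integrand:
  assumes eps: "0 < \<epsilon>" "\<epsilon> \<le> 1"
  shows "integrable fading (\<lambda>h. rate \<gamma> \<epsilon> h)"
proof (rule Bochner_Integration.integrable_bound)
  show "integrable fading (\<lambda>h. \<gamma> * sq (fst h))"
    by (intro integrable_mult_right fading_moment)
  show "AE h in fading. norm (rate \<gamma> \<epsilon> h) \<le> norm (\<gamma> * sq (fst h))"
  proof (rule AE_I2)
    fix h
    show "norm (rate \<gamma> \<epsilon> h) \<le> norm (\<gamma> * sq (fst h))"
      using integrand_bounds[OF eps, of h] \<gamma> unfolding real_norm_def by linarith
  qed
qed measurable

lemma continuous_on_nat_objective: "continuous_on {0<..1} (nat_objective \<gamma>)"
  unfolding continuous_on_sequentially
proof (intro allI ballI impI)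
  fix x :: "nat \<Rightarrow> real" and a assume a: "a \<in> {0<..1}" and x: "(\<forall>n. x n \<in> {0<..1}) \<and> x \<longlonglongrightarrow> a"
  have cont: "continuous_on {0<..1} (\<lambda>\<epsilon>. rate \<gamma> \<epsilon> h)" for h
  proof -
    have pos: "0 < 1 + snr \<gamma> \<epsilon> h" if "0 < \<epsilon>" for \<epsilon>
      using snr_nonneg[OF that, of h] by linarith
    have pos': "0 < 1 + sq (snd h) * \<gamma> / \<epsilon>" if "0 < \<epsilon>" for \<epsilon> :: real
      using that \<gamma> by (intro add_pos_nonneg) auto
    have "continuous_on {0<..1} (\<lambda>\<epsilon>. snr \<gamma> \<epsilon> h)"
      unfolding snr_def
      using pos' by (intro continuous_intros continuous_on_subset[OF continuous_on_binary_entropy]) (fastforce)+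
    moreover have "\<forall>\<epsilon>\<in>{0<..1}. 1 + snr \<gamma> \<epsilon> h \<noteq> 0"
      using pos by (metis greaterThanAtMost_iff less_irrefl)
    ultimately show ?thesis
      by (intro continuous_intros) auto
  qed
  have "(\<lambda>n. \<integral>h. x n * ln (1 + snr \<gamma> (x n) h) \<partial>fading) \<longlonglongrightarrow> (\<integral>h. a * ln (1 + snr \<gamma> a h) \<partial>fading)"
  proof (rule integral_dominated_convergence)
    show "integrable fading (\<lambda>h. \<gamma> * sq (fst h))"
      by (intro integrable_mult_right fading_moment)
    show "AE h in fading. (\<lambda>n. x n * ln (1 + snr \<gamma> (x n) h)) \<longlonglongrightarrow> a * ln (1 + snr \<gamma> a h)"
    proof (rule AE_I2)
      fix h
      show "(\<lambda>n. x n * ln (1 + snr \<gamma> (x n) h)) \<longlonglongrightarrow> a * ln (1 + snr \<gamma> a h)"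
        using cont[of h, unfolded continuous_on_sequentially] a x by (auto simp: comp_def)
    qed
    show "AE h in fading. norm (x n * ln (1 + snr \<gamma> (x n) h)) \<le> \<gamma> * sq (fst h)" for n
    proof (rule AE_I2)
      fix h
      show "norm (x n * ln (1 + snr \<gamma> (x n) h)) \<le> \<gamma> * sq (fst h)"
        using integrand_bounds[of "x n" h] x unfolding real_norm_def by (auto simp: abs_le_iff)
    qed
  qed measurable
  then show "(nat_objective \<gamma> \<circ> x) \<longlonglongrightarrow> nat_objective \<gamma> a"
    by (simp add: nat_objective_def comp_def)
qed

text \<open>Interference is dropped. The factor 1 / \<epsilon> in the ratio is harmless because
  \<epsilon> ln (1 / \<epsilon>) <= 1 - \<epsilon>; the 5 is this 1 plus the bound 4 on the mean
  squared gain.\<close>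

lemma nat_objective_small:
  assumes eps: "0 < \<epsilon>" "\<epsilon> \<le> 1 / 8"
  shows "nat_objective \<gamma> \<epsilon> \<le> 1 / 8 * ln \<gamma> + 5"
proof -
  have eps': "0 < \<epsilon>" "\<epsilon> \<le> 1" using eps by auto
  have bound: "rate \<gamma> \<epsilon> h \<le> 1 / 8 * ln \<gamma> + 1 + sq (fst h)" for h
  proof -
    let ?X = "sq (fst h)"
    have "1 \<le> \<gamma> / \<epsilon>" using eps \<gamma> by (simp add: field_simps)
    then have "1 + snr \<gamma> \<epsilon> h \<le> \<gamma> / \<epsilon> + ?X * \<gamma> / \<epsilon>"
      by (intro add_mono snr_le eps')
    also have "\<dots> = (1 + ?X) * (\<gamma> * (1 / \<epsilon>))" by (simp add: algebra_simps add_divide_distrib)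
    finally have "ln (1 + snr \<gamma> \<epsilon> h) \<le> ln ((1 + ?X) * (\<gamma> * (1 / \<epsilon>)))"
      using snr_nonneg[OF eps(1), of h] by (intro ln_mono) auto
    also have "\<dots> = ln (1 + ?X) + (ln \<gamma> + ln (1 / \<epsilon>))"
    proof -
      have "0 < 1 + ?X" using zero_le_power2[of "cmod (fst h)"] by linarith
      then show ?thesis using \<gamma> eps by (simp only: ln_mult_pos mult_pos_pos zero_less_divide_1_iff)
    qed
    also have "\<dots> \<le> ?X + (ln \<gamma> + (1 / \<epsilon> - 1))"
      using eps by (intro add_mono ln_add_one_self_le_self ln_le_minus_one) auto
    finally have "rate \<gamma> \<epsilon> h \<le> \<epsilon> * (?X + (ln \<gamma> + (1 / \<epsilon> - 1)))"
      using eps by (intro mult_left_mono) auto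
    also have "\<dots> = \<epsilon> * ?X + \<epsilon> * ln \<gamma> + 1 - \<epsilon>" using eps by (simp add: field_simps)
    also have "\<dots> \<le> 1 * ?X + 1 / 8 * ln \<gamma> + 1 - 0"
      using eps \<gamma> by (intro add_mono diff_mono mult_right_mono) auto
    finally show ?thesis by simp
  qed
  have "nat_objective \<gamma> \<epsilon> \<le> (\<integral>h. 1 / 8 * ln \<gamma> + 1 + sq (fst h) \<partial>fading)"
    unfolding nat_objective_def
    by (intro integral_mono integrable_integrand eps' bound Bochner_Integration.integrable_add fading_moment) simp_all
  also have "\<dots> = 1 / 8 * ln \<gamma> + 1 + (\<integral>h. sq (fst h) \<partial>fading)"
    by (subst Bochner_Integration.integral_add) (auto simp: fading_moment fading.prob_space)
  finally show ?thesis using fading_moment(2) by linarith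
qed

text \<open>In a deep fade of the interfering link the interference is ignored, at a cost of at most
  ln \<gamma> times 1 / 200. Otherwise the denominator is at least of order \<gamma>^\<epsilon> and
  leaves \<epsilon> (1 - \<epsilon>) ln \<gamma>. Hence 49 / 200 = 6 / 25 + 1 / 200, and 8000 = 2000
  * 4.\<close>

lemma nat_objective_large:
  assumes eps: "3 / 5 \<le> \<epsilon>" "\<epsilon> \<le> 1"
  shows "nat_objective \<gamma> \<epsilon> \<le> 49 / 200 * ln \<gamma> + 8000"
proof -
  have eps': "0 < \<epsilon>" "\<epsilon> \<le> 1" using eps by auto
  have lng: "0 \<le> ln \<gamma>" using \<gamma> by simp
  have e2: "\<epsilon> * (1 - \<epsilon>) \<le> 6 / 25"
  proof -
    \<comment> \<open>The product expands to \<epsilon>^2 - \<epsilon> + 6 / 25.\<close>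
    have "0 \<le> (\<epsilon> - 3 / 5) * (\<epsilon> - 2 / 5)" using eps by (intro mult_nonneg_nonneg) auto
    then show ?thesis by (simp add: algebra_simps)
  qed
  have bound: "rate \<gamma> \<epsilon> h \<le> 6 / 25 * ln \<gamma> + ln \<gamma> * deep_fade (snd h) + 2000 * sq (fst h)" for h
  proof -
    let ?X = "sq (fst h)"
    have X: "0 < 1 + 2000 * ?X" using zero_le_power2[of "cmod (fst h)"] by linarith
    show ?thesis
    proof (cases "sq (snd h) < 1 / 1000")
      case True
      have "snr \<gamma> \<epsilon> h \<le> ?X * \<gamma> / \<epsilon>" by (rule snr_le[OF eps'])
      also have "\<dots> = (?X * \<gamma>) * (1 / \<epsilon>)" by simp
      \<comment> \<open>A generous constant, chosen to agree with the other case, where 2000 is 1000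
        times the bound 2 for 1 / \<epsilon>.\<close>
      also have "\<dots> \<le> (?X * \<gamma>) * 2000"
        using eps \<gamma> by (intro mult_left_mono) (auto simp: field_simps)
      finally have "1 + snr \<gamma> \<epsilon> h \<le> \<gamma> + ?X * \<gamma> * 2000" using \<gamma> by linarith
      also have "\<dots> = (1 + 2000 * ?X) * \<gamma>" by (simp add: algebra_simps)
      finally have "ln (1 + snr \<gamma> \<epsilon> h) \<le> ln ((1 + 2000 * ?X) * \<gamma>)"
        using snr_nonneg[OF eps'(1), of h] by (intro ln_mono) auto
      also have "\<dots> = ln (1 + 2000 * ?X) + ln \<gamma>"
        using \<gamma> X by (simp only: ln_mult_pos)
      also have "\<dots> \<le> 2000 * ?X + ln \<gamma>"
        by (intro add_right_mono ln_add_one_self_le_self) auto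
      finally have "rate \<gamma> \<epsilon> h \<le> 1 * (2000 * ?X + ln \<gamma>)"
        using eps snr_nonneg[OF eps'(1), of h] by (intro mult_mono) auto
      then show ?thesis using True lng by (simp add: deep_fade_def)
    next
      case False
      have "1 / 1000 * \<gamma> powr \<epsilon> \<le> (1 / 1000) powr \<epsilon> * \<gamma> powr \<epsilon>"
        using eps powr_mono'[of \<epsilon> 1 "1 / 1000 :: real"] by (intro mult_right_mono) auto
      also have "\<dots> = (1 / 1000 * \<gamma>) powr \<epsilon>"
        using \<gamma> by (subst powr_mult) auto
      also have "\<dots> \<le> (1 + sq (snd h) * \<gamma> / \<epsilon>) powr \<epsilon>"
      proof (rule powr_mono2)
        have "1 / 1000 * \<gamma> \<le> sq (snd h) * \<gamma>" using False \<gamma> by (intro mult_right_mono) auto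
        also have "\<dots> \<le> sq (snd h) * \<gamma> / \<epsilon>"
          using mult_left_mono[of 1 "1 / \<epsilon>" "sq (snd h) * \<gamma>"] eps \<gamma> by simp
        finally show "1 / 1000 * \<gamma> \<le> 1 + sq (snd h) * \<gamma> / \<epsilon>" by simp
      qed (use eps \<gamma> in auto)
      finally have "snr \<gamma> \<epsilon> h \<le> ?X * \<gamma> / (\<epsilon> * (1 / 1000 * \<gamma> powr \<epsilon>))"
        using \<gamma> by (intro snr_le_power eps') auto
      also have "\<dots> = ?X * 1000 / \<epsilon> * \<gamma> powr (1 - \<epsilon>)"
        using \<gamma> by (simp add: powr_diff)
      also have "\<dots> \<le> ?X * 2000 * \<gamma> powr (1 - \<epsilon>)"
      proof (rule mult_right_mono)
        have "?X * 1000 / \<epsilon> = (?X * 1000) * (1 / \<epsilon>)" by simp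
        also have "\<dots> \<le> (?X * 1000) * 2" using eps by (intro mult_left_mono) (auto simp: field_simps)
        finally show "?X * 1000 / \<epsilon> \<le> ?X * 2000" by simp
      qed simp
      finally have "1 + snr \<gamma> \<epsilon> h \<le> \<gamma> powr (1 - \<epsilon>) + ?X * 2000 * \<gamma> powr (1 - \<epsilon>)"
        using ge_one_powr_ge_zero[of \<gamma> "1 - \<epsilon>"] \<gamma> eps by (intro add_mono) auto
      also have "\<dots> = (1 + 2000 * ?X) * \<gamma> powr (1 - \<epsilon>)" by (simp add: algebra_simps)
      finally have "ln (1 + snr \<gamma> \<epsilon> h) \<le> ln ((1 + 2000 * ?X) * \<gamma> powr (1 - \<epsilon>))"
        using snr_nonneg[OF eps'(1), of h] by (intro ln_mono) auto
      also have "\<dots> = ln (1 + 2000 * ?X) + (1 - \<epsilon>) * ln \<gamma>"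
        using \<gamma> X by (subst ln_mult_pos) (auto simp: ln_powr)
      also have "\<dots> \<le> 2000 * ?X + (1 - \<epsilon>) * ln \<gamma>"
        by (intro add_right_mono ln_add_one_self_le_self) auto
      finally have "rate \<gamma> \<epsilon> h \<le> \<epsilon> * (2000 * ?X + (1 - \<epsilon>) * ln \<gamma>)"
        using eps by (intro mult_left_mono) auto
      also have "\<dots> = \<epsilon> * (2000 * ?X) + \<epsilon> * (1 - \<epsilon>) * ln \<gamma>" by (simp add: algebra_simps)
      also have "\<dots> \<le> 1 * (2000 * ?X) + 6 / 25 * ln \<gamma>"
        using eps e2 lng by (intro add_mono mult_right_mono) auto
      finally show ?thesis using False by (simp add: deep_fade_def)
    qed
  qed
  have "nat_objective \<gamma> \<epsilon> \<le> (\<integral>h. 6 / 25 * ln \<gamma> + ln \<gamma> * deep_fade (snd h) + 2000 * sq (fst h) \<partial>fading)"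
    unfolding nat_objective_def
    by (intro integral_mono integrable_integrand eps' bound Bochner_Integration.integrable_add
      integrable_mult_right fading_moment fading_deep_fade) simp_all
  also have "\<dots> = 6 / 25 * ln \<gamma> + ln \<gamma> * (\<integral>h. deep_fade (snd h) \<partial>fading) + 2000 * (\<integral>h. sq (fst h) \<partial>fading)"
    using fading_moment fading_deep_fade by (simp add: fading.prob_space)
  also have "\<dots> \<le> 6 / 25 * ln \<gamma> + ln \<gamma> * (1 / 200) + 2000 * 4"
    by (intro add_mono mult_left_mono fading_moment fading_deep_fade lng order_refl) auto
  finally show ?thesis by simp
qed

text \<open>A deep fade of the direct link gives up the coefficient 1 / 4 with probability at most 1
  / 200, whence 199 / 800. Elsewhere ln \<gamma> is halved once by the interference and once by the
  factor \<epsilon> = 1 / 2.\<close>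

lemma nat_objective_half: "199 / 800 * ln \<gamma> - (2 + ln 1000) \<le> nat_objective \<gamma> (1 / 2)"
proof -
  have lng: "0 \<le> ln \<gamma>" using \<gamma> by simp
  have bound: "1 / 4 * ln \<gamma> - 1 / 4 * ln \<gamma> * deep_fade (fst h) - ln 1000 - 1 / 2 * sq (snd h) \<le> 1 / 2 * ln (1 + snr \<gamma> (1 / 2) h)" for h
  proof (cases "sq (fst h) < 1 / 1000")
    case True
    have "0 \<le> 1 / 2 * ln (1 + snr \<gamma> (1 / 2) h)"
      using integrand_bounds(1)[of "1 / 2" h] by simp
    moreover have "0 \<le> ln (1000 :: real)" by simp
    moreover have d: "deep_fade (fst h) = 1" using True by (simp add: deep_fade_def)
    moreover have "0 \<le> 1 / 2 * sq (snd h)" by simp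
    ultimately show ?thesis unfolding d by linarith
  next
    case False
    let ?Y = "sq (snd h)"
    have Y: "0 < 1 + 2 * ?Y" using zero_le_power2[of "cmod (snd h)"] by linarith
    have Y': "0 < 1 + ?Y * \<gamma> * 2" using \<gamma> by (intro add_pos_nonneg) auto
    \<comment> \<open>One bit of entropy cancels the factor 1 / \<epsilon> = 2.\<close>
    have snr: "snr \<gamma> (1 / 2) h = sq (fst h) * \<gamma> / (1 + ?Y * \<gamma> * 2) powr (1 / 2)"
      by (simp add: snr_def binary_entropy_half powr_minus)
    have "(1 + ?Y * \<gamma> * 2) powr (1 / 2) \<le> ((1 + 2 * ?Y) * \<gamma>) powr (1 / 2)"
      using \<gamma> by (intro powr_mono2) (auto simp: algebra_simps)
    also have "\<dots> = (1 + 2 * ?Y) powr (1 / 2) * \<gamma> powr (1 / 2)"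
      by (rule powr_mult)
    finally have "1 / 1000 * \<gamma> / ((1 + 2 * ?Y) powr (1 / 2) * \<gamma> powr (1 / 2)) \<le> snr \<gamma> (1 / 2) h"
      unfolding snr using False \<gamma> Y Y'
      by (intro frac_le mult_right_mono) auto
    then have "1 / 1000 * (\<gamma> powr (1 / 2) / (1 + 2 * ?Y) powr (1 / 2)) \<le> snr \<gamma> (1 / 2) h"
    proof -
      have root: "\<gamma> / \<gamma> powr (1 / 2) = \<gamma> powr (1 / 2)" using \<gamma> powr_diff[of \<gamma> 1 "1 / 2"] by simp
      have "1 / 1000 * \<gamma> / (Z * r) = 1 / 1000 * (\<gamma> / r / Z)" for r Z :: real by simp
      from this[of "(1 + 2 * ?Y) powr (1 / 2)" "\<gamma> powr (1 / 2)"]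
      have "1 / 1000 * \<gamma> / ((1 + 2 * ?Y) powr (1 / 2) * \<gamma> powr (1 / 2)) =
          1 / 1000 * (\<gamma> powr (1 / 2) / (1 + 2 * ?Y) powr (1 / 2))"
        unfolding root .
      with \<open>1 / 1000 * \<gamma> / ((1 + 2 * ?Y) powr (1 / 2) * \<gamma> powr (1 / 2)) \<le> snr \<gamma> (1 / 2) h\<close>
      show ?thesis by simp
    qed
    then have "ln (1 / 1000 * (\<gamma> powr (1 / 2) / (1 + 2 * ?Y) powr (1 / 2))) \<le> ln (1 + snr \<gamma> (1 / 2) h)"
      using \<gamma> Y snr_nonneg[of "1 / 2" h] by (intro ln_mono) auto
    moreover have "ln (1 / 1000 * (\<gamma> powr (1 / 2) / (1 + 2 * ?Y) powr (1 / 2))) =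
        - ln 1000 + (1 / 2 * ln \<gamma> - 1 / 2 * ln (1 + 2 * ?Y))"
      using \<gamma> Y by (simp add: ln_mult_pos ln_divide_pos ln_powr)
    moreover have "ln (1 + 2 * ?Y) \<le> 2 * ?Y"
      by (intro ln_add_one_self_le_self) auto
    moreover have "0 \<le> ln (1000 :: real)" by simp
    moreover have d: "deep_fade (fst h) = 0" using False by (simp add: deep_fade_def)
    ultimately show ?thesis unfolding d by linarith
  qed
  have "199 / 800 * ln \<gamma> - (2 + ln 1000) \<le>
    1 / 4 * ln \<gamma> - 1 / 4 * ln \<gamma> * (\<integral>h. deep_fade (fst h) \<partial>fading) - ln 1000 - 1 / 2 * (\<integral>h. sq (snd h) \<partial>fading)"
  proof -
    have "1 / 4 * ln \<gamma> * (\<integral>h. deep_fade (fst h) \<partial>fading) \<le> 1 / 4 * ln \<gamma> * (1 / 200)"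
      using lng by (intro mult_left_mono fading_deep_fade) auto
    then show ?thesis using fading_moment(4) by simp
  qed
  also have "\<dots> = (\<integral>h. 1 / 4 * ln \<gamma> - 1 / 4 * ln \<gamma> * deep_fade (fst h) - ln 1000 - 1 / 2 * sq (snd h) \<partial>fading)"
    using fading_moment fading_deep_fade by (simp add: fading.prob_space)
  also have "\<dots> \<le> nat_objective \<gamma> (1 / 2)"
    unfolding nat_objective_def using fading_moment fading_deep_fade
    by (intro integral_mono integrable_integrand bound) auto
  finally show ?thesis .
qed

text \<open>The coefficient 199 / 800 at 1 / 2 beats both 49 / 200 = 196 / 800 and 1 / 8. The
  smaller gap (3 / 800) ln \<gamma> has to exceed 8000 + 2 + ln 1000 <= 9001, which the assumption
  ensures with room to spare.\<close>

lemma optimal_masking: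
  assumes large: "8 * 200 * 8100 \<le> ln \<gamma>"
  shows "\<exists>\<epsilon>. is_optimal_masking \<gamma> \<epsilon>" "is_optimal_masking \<gamma> \<epsilon> \<Longrightarrow> \<epsilon> \<in> {1 / 8<..<3 / 5}"
proof -
  have le: "masking_objective \<gamma> x \<le> masking_objective \<gamma> y \<longleftrightarrow> nat_objective \<gamma> x \<le> nat_objective \<gamma> y" for x y
    by (simp add: masking_objective_eq divide_le_cancel)
  have opt: "is_optimal_masking \<gamma> x \<longleftrightarrow> x \<in> {0<..1} \<and> (\<forall>y\<in>{0<..1}. nat_objective \<gamma> y \<le> nat_objective \<gamma> x)" for x
    unfolding is_optimal_masking_def is_arg_max_def by (auto simp: not_less le)
  have "ln 1000 \<le> (1000 - 1 :: real)" by (intro ln_le_minus_one) simp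
  then have outside: "nat_objective \<gamma> x < nat_objective \<gamma> (1 / 2)" if "x \<in> {0<..1}" "x \<notin> {1 / 8<..<3 / 5}" for x
    using nat_objective_half nat_objective_small[of x] nat_objective_large[of x] large that
    by (cases "x \<le> 1 / 8") auto
  \<comment> \<open>(0, 1] is not compact, so the maximum is taken over [1 / 8, 1]; smaller values
    lose against 1 / 2.\<close>
  have "\<exists>x\<in>{1 / 8..1}. \<forall>y\<in>{1 / 8..1}. nat_objective \<gamma> y \<le> nat_objective \<gamma> x"
    by (intro continuous_attains_sup continuous_on_subset[OF continuous_on_nat_objective]) auto
  then obtain x where x: "x \<in> {1 / 8..1}" "\<And>y. y \<in> {1 / 8..1} \<Longrightarrow> nat_objective \<gamma> y \<le> nat_objective \<gamma> x"
    by blast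
  have "nat_objective \<gamma> y \<le> nat_objective \<gamma> x" if "y \<in> {0<..1}" for y
  proof (cases "y \<le> 1 / 8")
    case True
    then show ?thesis using outside[OF that] x(2)[of "1 / 2"] by auto
  qed (use x that in auto)
  then show "\<exists>\<epsilon>. is_optimal_masking \<gamma> \<epsilon>"
    using x(1) by (auto simp: opt intro!: exI[of _ x])
  show "\<epsilon> \<in> {1 / 8<..<3 / 5}" if "is_optimal_masking \<gamma> \<epsilon>"
  proof (rule ccontr)
    assume "\<epsilon> \<notin> {1 / 8<..<3 / 5}"
    moreover have "\<epsilon> \<in> {0<..1}" "nat_objective \<gamma> (1 / 2) \<le> nat_objective \<gamma> \<epsilon>"
      using that by (auto simp: opt)
    ultimately show False using outside[of \<epsilon>] by linarith
  qed
qed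

end

section \<open>Comparison\<close>

text \<open>Uniqueness of the maximiser is not claimed: the assertion covers every maximiser, and
  existence keeps it from being vacuous. The threshold for \<gamma> may depend on the gains, the
  interval does not.\<close>

theorem theorem1:
  shows "\<exists>\<alpha>1 \<alpha>2 :: real. \<alpha>1 \<in> {0..<1/2} \<and> \<alpha>2 \<in> {1/2<..1} \<and>
    (\<forall>h11 h21 :: complex. h11 \<noteq> 0 \<longrightarrow> h21 \<noteq> 0 \<longrightarrow>
      (\<forall>\<^sub>F \<gamma> :: real in at_top.
        (\<exists>\<epsilon>. is_optimal_masking \<gamma> \<epsilon>) \<and>
        (\<forall>\<epsilon>. is_optimal_masking \<gamma> \<epsilon> \<longrightarrow>
          \<epsilon> \<in> {\<alpha>1<..<\<alpha>2} \<and>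
          (\<exists>R. achievable_by_spreading_and_masking \<gamma> h11 h21 R \<and>
               masking_capacity \<epsilon> \<gamma> h11 h21 < ereal R))))"
proof (rule exI[of _ "1 / 8"], rule exI[of _ "3 / 5"], intro conjI allI impI)
  show "(1 / 8 :: real) \<in> {0..<1/2}" "(3 / 5 :: real) \<in> {1/2<..1}" by simp_all
  fix h11 h21 :: complex assume h: "h11 \<noteq> 0" "h21 \<noteq> 0"
  obtain C where C: "\<And>\<gamma>. 1 \<le> \<gamma> \<Longrightarrow>
      achievable_by_spreading_and_masking \<gamma> h11 h21 ((13 / 32 * ln \<gamma> - C) / ln 2)"
    using achievable_rate[OF h] by blast
  \<comment> \<open>The part of the bound for the capacity that does not grow with \<gamma>.\<close>
  define c where "c = 9 / 25 * (ln pi + 32 * ((cmod h11)\<^sup>2 + (cmod h21)\<^sup>2) + 8) + ln pi +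
    8 * (cmod (h11 / h21))\<^sup>2 + 12"
  have large: "\<forall>\<^sub>F \<gamma> in at_top. Z \<le> ln \<gamma>" for Z :: real
    using ln_at_top by (simp add: filterlim_at_top)
  show "\<forall>\<^sub>F \<gamma> in at_top. (\<exists>\<epsilon>. is_optimal_masking \<gamma> \<epsilon>) \<and>
    (\<forall>\<epsilon>. is_optimal_masking \<gamma> \<epsilon> \<longrightarrow> \<epsilon> \<in> {1 / 8<..<3 / 5} \<and>
      (\<exists>R. achievable_by_spreading_and_masking \<gamma> h11 h21 R \<and> masking_capacity \<epsilon> \<gamma> h11 h21 < ereal R))"
    \<comment> \<open>13 / 32 - 9 / 25 = 37 / 800; the summand 1 makes the final inequality
      strict.\<close>
    using eventually_ge_at_top[of 1] large[of "8 * 200 * 8100"] large[of "800 / 37 * (c + C + 1)"]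
  proof eventually_elim
    case (elim \<gamma>)
    have "masking_capacity \<epsilon> \<gamma> h11 h21 < ereal ((13 / 32 * ln \<gamma> - C) / ln 2)"
      if "is_optimal_masking \<gamma> \<epsilon>" for \<epsilon>
    proof -
      have "\<epsilon> \<in> {1 / 8<..<3 / 5}"
        using optimal_masking(2)[OF elim(1,2) that] .
      then have "masking_capacity \<epsilon> \<gamma> h11 h21 \<le> ereal ((9 / 25 * ln \<gamma> + c) / ln 2)"
        using masking_capacity_le[OF elim(1) _ _ h(2), of \<epsilon> h11] by (simp add: c_def algebra_simps)
      also have "\<dots> < ereal ((13 / 32 * ln \<gamma> - C) / ln 2)"
        using elim(3) by (simp add: divide_strict_right_mono)
      finally show ?thesis .
    qed
    with optimal_masking[OF elim(1,2)] C[OF elim(1)] show ?case by blast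
  qed
qed

end
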